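(* Let $A$ be an extension base (no type over $A$ forks over $A$; e.g. $A$ is a model). Then for every type $p\in S(A)$, $\mathrm{dp\text{-}rk}(p)\ge \mathrm{spwt}(p)$.
   Context: $T$ is a complete dependent (NIP) theory, $T=T^{eq}$, working in a monster model $\mathfrak{C}$. Dividing: $\varphi(x,c)$ divides over $A$ if for some $A$-indiscernible $(c_i)_{i<\omega}$ with $c_0=c$, $\{\varphi(x,c_i)\}$ is inconsistent; forking: implies a finite disjunction of dividing formulas; a type forks if it contains a forking formula. A nonforking sequence in $q\in S(A)$ is a sequence of realizations of $q$ indiscernible over $A$ with $\mathrm{tp}(b_i/A\cup\{b_j:j<i\})$ not forking over $A$; $q$ is generically stable if some nonforking sequence $(b_i)_{i<\omega}$ in $q$ is an indiscernible set over $A$. A set $\{b_i\}$ is independent over $A$ if for each subset $S$ of indices, $\mathrm{tp}(\{b_i:i\in S\}/A\cup\{b_j:j\notin S\})$ does not fork over $A$. A randomness pattern of depth $\kappa$ for $p$ over $A$ is an array $(b^\alpha_i:\alpha<\kappa,i<\omega)$ with formulas $\varphi_\alpha(x,y_\alpha)$ such that each $J_\alpha=(b^\alpha_i)_{i<\omega}$ is indiscernible over $A\cup\bigcup_{\beta\neq\alpha}J_\beta$, $\mathrm{len}(b^\alpha_i)=\mathrm{len}(y_\alpha)$, and for every $\eta\in{}^\kappa\omega$ the set $\{\varphi_\alpha(x,b^\alpha_{\eta(\alpha)}):\alpha<\kappa\}\cup\{\neg\varphi_\alpha(x,b^\alpha_i):\alpha<\kappa,i<\omega,i\neq\eta(\alpha)\}$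 is consistent with $p$. $\mathrm{dp\text{-}rk}(p)$ is the supremum of all $\kappa$ admitting a randomness pattern of depth $\kappa$ for $p$. The stable pre-weight $\mathrm{spwt}(p)$ is the supremum of all $\alpha$ such that there exist $a\models p$, generically stable types $q_i\in S(A)$ and $b_i\models q_i$ ($i<\alpha$) with $\{b_i:i<\alpha\}$ independent over $A$ and $\mathrm{tp}(a/A b_i)$ dividing over $A$ for every $i<\alpha$. *)

theory Defs
  imports Main
begin

unbundle cardinal_syntax

text \<open>
  Every element of \<^typ>\<open>'s\<close> is a sort of the language.  The symbols are the elements of
  \<^typ>\<open>'f\<close> and \<^typ>\<open>'r\<close> at which the signature is defined, so that a language may have
  no function symbols, or no relation symbols.
\<close>

record ('s, 'f, 'r) lang =
  fsig :: "'f \<Rightarrow> ('s list \<times> 's) option"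
  rsig :: "'r \<Rightarrow> 's list option"

text \<open>
  Variables are de Bruijn indices: a formula in the free variables \<open>x\<^sub>0, \<dots>, x\<^sub>n\<close> of sorts
  \<open>w = [s\<^sub>0, \<dots>, s\<^sub>n]\<close> is a formula that is well-formed in the context \<open>w\<close>.  A quantifier
  binds index 0 of the context of its body.
\<close>

datatype 'f tm = Var nat | Fn 'f "'f tm list"

datatype ('s, 'f, 'r) fm =
    Eq "'f tm" "'f tm"
  | Rel 'r "'f tm list"
  | Neg "('s, 'f, 'r) fm"
  | And "('s, 'f, 'r) fm" "('s, 'f, 'r) fm"
  | Forall 's "('s, 'f, 'r) fm"

inductive wf_tm :: "('s, 'f, 'r) lang \<Rightarrow> 's list \<Rightarrow> 'f tm \<Rightarrow> 's \<Rightarrow> bool" for L w where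
  "n < length w \<Longrightarrow> wf_tm L w (Var n) (w ! n)"
| "fsig L f = Some (ss, s) \<Longrightarrow> list_all2 (wf_tm L w) ts ss \<Longrightarrow> wf_tm L w (Fn f ts) s"

primrec wf_fm :: "('s, 'f, 'r) lang \<Rightarrow> 's list \<Rightarrow> ('s, 'f, 'r) fm \<Rightarrow> bool" where
  "wf_fm L w (Eq t u) = (\<exists>s. wf_tm L w t s \<and> wf_tm L w u s)"
| "wf_fm L w (Rel r ts) = (\<exists>ss. rsig L r = Some ss \<and> list_all2 (wf_tm L w) ts ss)"
| "wf_fm L w (Neg \<phi>) = wf_fm L w \<phi>"
| "wf_fm L w (And \<phi> \<psi>) = (wf_fm L w \<phi> \<and> wf_fm L w \<psi>)"
| "wf_fm L w (Forall s \<phi>) = wf_fm L (s # w) \<phi>"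

text \<open>
  The universe of a structure is the whole type \<^typ>\<open>'m\<close>, the disjoint union of the sorts.
\<close>

record ('s, 'f, 'r, 'm) struct =
  srt :: "'m \<Rightarrow> 's"
  fint :: "'f \<Rightarrow> 'm list \<Rightarrow> 'm"
  rint :: "'r \<Rightarrow> 'm list \<Rightarrow> bool"

abbreviation sorts :: "('s, 'f, 'r, 'm) struct \<Rightarrow> 'm list \<Rightarrow> 's list" where
  "sorts M \<equiv> map (srt M)"

definition is_struct :: "('s, 'f, 'r) lang \<Rightarrow> ('s, 'f, 'r, 'm) struct \<Rightarrow> bool" where
  "is_struct L M \<longleftrightarrow>
     (\<forall>s. \<exists>m. srt M m = s) \<and>
     (\<forall>f ss s xs. fsig L f = Some (ss, s) \<and> sorts M xs = ss \<longrightarrow> srt M (fint M f xs) = s)"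

primrec tm_val :: "('s, 'f, 'r, 'm) struct \<Rightarrow> 'm list \<Rightarrow> 'f tm \<Rightarrow> 'm" where
  "tm_val M e (Var n) = e ! n"
| "tm_val M e (Fn f ts) = fint M f (map (tm_val M e) ts)"

primrec sat :: "('s, 'f, 'r, 'm) struct \<Rightarrow> ('s, 'f, 'r) fm \<Rightarrow> 'm list \<Rightarrow> bool" where
  "sat M (Eq t u) = (\<lambda>e. tm_val M e t = tm_val M e u)"
| "sat M (Rel r ts) = (\<lambda>e. rint M r (map (tm_val M e) ts))"
| "sat M (Neg \<phi>) = (\<lambda>e. \<not> sat M \<phi> e)"
| "sat M (And \<phi> \<psi>) = (\<lambda>e. sat M \<phi> e \<and> sat M \<psi> e)"
| "sat M (Forall s \<phi>) = (\<lambda>e. \<forall>m. srt M m = s \<longrightarrow> sat M \<phi> (m # e))"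

definition complete_theory ::
  "('s, 'f, 'r) lang \<Rightarrow> ('s, 'f, 'r) fm set \<Rightarrow> bool" where
  "complete_theory L T \<longleftrightarrow>
     (\<forall>\<sigma>\<in>T. wf_fm L [] \<sigma>) \<and> (\<forall>\<sigma>. wf_fm L [] \<sigma> \<longrightarrow> \<sigma> \<in> T \<or> Neg \<sigma> \<in> T)"

definition models ::
  "('s, 'f, 'r) lang \<Rightarrow> ('s, 'f, 'r, 'm) struct \<Rightarrow> ('s, 'f, 'r) fm set \<Rightarrow> bool" where
  "models L M T \<longleftrightarrow> is_struct L M \<and> (\<forall>\<sigma>\<in>T. sat M \<sigma> [])"

text \<open>
  A pair \<open>(\<phi>, c)\<close> stands for the formula \<open>\<phi>(x, c)\<close> in the variables \<open>x\<close>, whose sorts \<open>w\<close> are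
  given separately; the parameters \<open>c\<close> are substituted for the variables following \<open>x\<close>.
\<close>

type_synonym ('s, 'f, 'r, 'm) pfm = "('s, 'f, 'r) fm \<times> 'm list"

definition pfms :: "('s, 'f, 'r) lang \<Rightarrow> ('s, 'f, 'r, 'm) struct \<Rightarrow> 's list \<Rightarrow> 'm set \<Rightarrow>
    ('s, 'f, 'r, 'm) pfm set" where
  "pfms L M w A = {(\<phi>, c). set c \<subseteq> A \<and> wf_fm L (w @ sorts M c) \<phi>}"

definition realizes :: "('s, 'f, 'r, 'm) struct \<Rightarrow> 's list \<Rightarrow> 'm list \<Rightarrow>
    ('s, 'f, 'r, 'm) pfm set \<Rightarrow> bool" where
  "realizes M w a \<Sigma> \<longleftrightarrow> sorts M a = w \<and> (\<forall>(\<phi>, c)\<in>\<Sigma>. sat M \<phi> (a @ c))"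

text \<open>Consistency is with the elementary diagram of \<open>M\<close>, that is, finite satisfiability in \<open>M\<close>.\<close>

definition consistent :: "('s, 'f, 'r, 'm) struct \<Rightarrow> 's list \<Rightarrow>
    ('s, 'f, 'r, 'm) pfm set \<Rightarrow> bool" where
  "consistent M w \<Sigma> \<longleftrightarrow> (\<forall>\<Sigma>0 \<subseteq> \<Sigma>. finite \<Sigma>0 \<longrightarrow> (\<exists>a. realizes M w a \<Sigma>0))"

definition complete_types :: "('s, 'f, 'r) lang \<Rightarrow> ('s, 'f, 'r, 'm) struct \<Rightarrow> 's list \<Rightarrow>
    'm set \<Rightarrow> ('s, 'f, 'r, 'm) pfm set set" where
  "complete_types L M w A =
     {p. p \<subseteq> pfms L M w A \<and> consistent M w p \<and>
         (\<forall>(\<phi>, c)\<in>pfms L M w A. (\<phi>, c) \<in> p \<or> (Neg \<phi>, c) \<in> p)}"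

definition tp :: "('s, 'f, 'r) lang \<Rightarrow> ('s, 'f, 'r, 'm) struct \<Rightarrow> 'm list \<Rightarrow> 'm set \<Rightarrow>
    ('s, 'f, 'r, 'm) pfm set" where
  "tp L M a A = {(\<phi>, c) \<in> pfms L M (sorts M a) A. sat M \<phi> (a @ c)}"

definition saturated ::
  "('s, 'f, 'r) lang \<Rightarrow> 'k rel \<Rightarrow> ('s, 'f, 'r, 'm) struct \<Rightarrow> bool" where
  "saturated L \<kappa> M \<longleftrightarrow>
     (\<forall>A s p. |A| <o \<kappa> \<and> p \<in> complete_types L M [s] A \<longrightarrow> (\<exists>a. realizes M [s] a p))"

definition partial_elementary ::
  "('s, 'f, 'r) lang \<Rightarrow> ('s, 'f, 'r, 'm) struct \<Rightarrow> 'm set \<Rightarrow> ('m \<Rightarrow> 'm) \<Rightarrow> bool" where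
  "partial_elementary L M A h \<longleftrightarrow>
     (\<forall>a\<in>A. srt M (h a) = srt M a) \<and>
     (\<forall>xs \<phi>. set xs \<subseteq> A \<and> wf_fm L (sorts M xs) \<phi> \<longrightarrow> (sat M \<phi> (map h xs) \<longleftrightarrow> sat M \<phi> xs))"

definition automorphism ::
  "('s, 'f, 'r) lang \<Rightarrow> ('s, 'f, 'r, 'm) struct \<Rightarrow> ('m \<Rightarrow> 'm) \<Rightarrow> bool" where
  "automorphism L M h \<longleftrightarrow>
     bij h \<and> (\<forall>a. srt M (h a) = srt M a) \<and>
     (\<forall>f ss s xs. fsig L f = Some (ss, s) \<and> sorts M xs = ss \<longrightarrow>
        h (fint M f xs) = fint M f (map h xs)) \<and>
     (\<forall>r ss xs. rsig L r = Some ss \<and> sorts M xs = ss \<longrightarrow>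
        (rint M r (map h xs) \<longleftrightarrow> rint M r xs))"

definition strongly_homogeneous ::
  "('s, 'f, 'r) lang \<Rightarrow> 'k rel \<Rightarrow> ('s, 'f, 'r, 'm) struct \<Rightarrow> bool" where
  "strongly_homogeneous L \<kappa> M \<longleftrightarrow>
     (\<forall>A h. |A| <o \<kappa> \<and> partial_elementary L M A h \<longrightarrow>
        (\<exists>g. automorphism L M g \<and> (\<forall>a\<in>A. g a = h a)))"

text \<open>
  A monster model for small sets of parameters, small meaning of cardinality less than \<open>\<kappa>\<close>.
  Of the size of \<open>\<kappa>\<close> only \<open>\<kappa> > |T|\<close> is required, \<open>|T|\<close> being the (infinite) number of
  formulas of the language.
\<close>

definition monster_model ::
  "('s, 'f, 'r) lang \<Rightarrow> ('s, 'f, 'r) fm set \<Rightarrow> 'k rel \<Rightarrow> ('s, 'f, 'r, 'm) struct \<Rightarrow> bool" where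
  "monster_model L T \<kappa> M \<longleftrightarrow>
     Card_order \<kappa> \<and> |{\<phi>. \<exists>w. wf_fm L w \<phi>}| <o \<kappa> \<and>
     models L M T \<and> saturated L \<kappa> M \<and> strongly_homogeneous L \<kappa> M"

text \<open>
  As usual, the independence property of the formula \<open>\<phi>(x, y)\<close> (and likewise \<open>T = T\<^sup>e\<^sup>q\<close> below)
  is expressed in the monster model \<open>M\<close> of the complete theory.
\<close>

definition has_IP :: "('s, 'f, 'r, 'm) struct \<Rightarrow> 's list \<Rightarrow> 's list \<Rightarrow>
    ('s, 'f, 'r) fm \<Rightarrow> bool" where
  "has_IP M wx wy \<phi> \<longleftrightarrow>
     (\<exists>(a :: nat \<Rightarrow> 'm list) (b :: nat set \<Rightarrow> 'm list).
        (\<forall>i. sorts M (a i) = wx) \<and> (\<forall>S. sorts M (b S) = wy) \<and>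
        (\<forall>i S. sat M \<phi> (a i @ b S) \<longleftrightarrow> i \<in> S))"

definition dependent_theory :: "('s, 'f, 'r) lang \<Rightarrow> ('s, 'f, 'r, 'm) struct \<Rightarrow> bool" where
  "dependent_theory L M \<longleftrightarrow> (\<forall>wx wy \<phi>. wf_fm L (wx @ wy) \<phi> \<longrightarrow> \<not> has_IP M wx wy \<phi>)"

text \<open>
  \<open>T = T\<^sup>e\<^sup>q\<close>: the quotient of every finite product of sorts by a \<open>\<emptyset>\<close>-definable equivalence
  relation \<open>E\<close> is a sort \<open>s\<close>, the quotient map being \<open>\<emptyset>\<close>-definable by a formula \<open>F\<close>.
\<close>

definition has_quotient_sorts :: "('s, 'f, 'r) lang \<Rightarrow> ('s, 'f, 'r, 'm) struct \<Rightarrow> bool" where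
  "has_quotient_sorts L M \<longleftrightarrow>
     (\<forall>w E. wf_fm L (w @ w) E \<and>
        equiv {a. sorts M a = w} {(a, b). sorts M a = w \<and> sorts M b = w \<and> sat M E (a @ b)} \<longrightarrow>
        (\<exists>s F \<pi>. wf_fm L (w @ [s]) F \<and>
           \<pi> ` {a. sorts M a = w} = {z. srt M z = s} \<and>
           (\<forall>a b. sorts M a = w \<and> sorts M b = w \<longrightarrow> (\<pi> a = \<pi> b \<longleftrightarrow> sat M E (a @ b))) \<and>
           (\<forall>a z. sorts M a = w \<and> srt M z = s \<longrightarrow> (sat M F (a @ [z]) \<longleftrightarrow> \<pi> a = z))))"

definition indiscernible_seq :: "('s, 'f, 'r) lang \<Rightarrow> ('s, 'f, 'r, 'm) struct \<Rightarrow> 'm set \<Rightarrow>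
    (nat \<Rightarrow> 'm list) \<Rightarrow> bool" where
  "indiscernible_seq L M A c \<longleftrightarrow>
     (\<forall>i j. sorts M (c i) = sorts M (c j)) \<and>
     (\<forall>is js. sorted_wrt (<) is \<and> sorted_wrt (<) js \<and> length is = length js \<longrightarrow>
        tp L M (concat (map c is)) A = tp L M (concat (map c js)) A)"

definition indiscernible_set :: "('s, 'f, 'r) lang \<Rightarrow> ('s, 'f, 'r, 'm) struct \<Rightarrow> 'm set \<Rightarrow>
    (nat \<Rightarrow> 'm list) \<Rightarrow> bool" where
  "indiscernible_set L M A c \<longleftrightarrow>
     (\<forall>i j. sorts M (c i) = sorts M (c j)) \<and>
     (\<forall>is js. distinct is \<and> distinct js \<and> length is = length js \<longrightarrow>
        tp L M (concat (map c is)) A = tp L M (concat (map c js)) A)"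

fun divides :: "('s, 'f, 'r) lang \<Rightarrow> ('s, 'f, 'r, 'm) struct \<Rightarrow> 'm set \<Rightarrow> 's list \<Rightarrow>
    ('s, 'f, 'r, 'm) pfm \<Rightarrow> bool" where
  "divides L M A w (\<phi>, c) \<longleftrightarrow>
     (\<exists>cs. indiscernible_seq L M A cs \<and> cs 0 = c \<and> \<not> consistent M w (range (\<lambda>i. (\<phi>, cs i))))"

fun forks :: "('s, 'f, 'r) lang \<Rightarrow> ('s, 'f, 'r, 'm) struct \<Rightarrow> 'm set \<Rightarrow> 's list \<Rightarrow>
    ('s, 'f, 'r, 'm) pfm \<Rightarrow> bool" where
  "forks L M A w (\<phi>, c) \<longleftrightarrow>
     (\<exists>D. finite D \<and> D \<subseteq> pfms L M w UNIV \<and> (\<forall>d\<in>D. divides L M A w d) \<and>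
        (\<forall>a. sorts M a = w \<and> sat M \<phi> (a @ c) \<longrightarrow> (\<exists>(\<psi>, d)\<in>D. sat M \<psi> (a @ d))))"

definition type_divides :: "('s, 'f, 'r) lang \<Rightarrow> ('s, 'f, 'r, 'm) struct \<Rightarrow> 'm set \<Rightarrow> 's list \<Rightarrow>
    ('s, 'f, 'r, 'm) pfm set \<Rightarrow> bool" where
  "type_divides L M A w p \<longleftrightarrow> (\<exists>\<psi>\<in>p. divides L M A w \<psi>)"

definition type_forks :: "('s, 'f, 'r) lang \<Rightarrow> ('s, 'f, 'r, 'm) struct \<Rightarrow> 'm set \<Rightarrow> 's list \<Rightarrow>
    ('s, 'f, 'r, 'm) pfm set \<Rightarrow> bool" where
  "type_forks L M A w p \<longleftrightarrow> (\<exists>\<psi>\<in>p. forks L M A w \<psi>)"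

definition extension_base ::
  "('s, 'f, 'r) lang \<Rightarrow> ('s, 'f, 'r, 'm) struct \<Rightarrow> 'm set \<Rightarrow> bool" where
  "extension_base L M A \<longleftrightarrow> (\<forall>w. \<forall>p\<in>complete_types L M w A. \<not> type_forks L M A w p)"

definition nonforking_seq :: "('s, 'f, 'r) lang \<Rightarrow> ('s, 'f, 'r, 'm) struct \<Rightarrow> 'm set \<Rightarrow>
    's list \<Rightarrow> ('s, 'f, 'r, 'm) pfm set \<Rightarrow> (nat \<Rightarrow> 'm list) \<Rightarrow> bool" where
  "nonforking_seq L M A w q b \<longleftrightarrow>
     (\<forall>i. realizes M w (b i) q) \<and> indiscernible_seq L M A b \<and>
     (\<forall>i. \<not> type_forks L M A w (tp L M (b i) (A \<union> (\<Union>j<i. set (b j)))))"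

definition generically_stable :: "('s, 'f, 'r) lang \<Rightarrow> ('s, 'f, 'r, 'm) struct \<Rightarrow> 'm set \<Rightarrow>
    's list \<Rightarrow> ('s, 'f, 'r, 'm) pfm set \<Rightarrow> bool" where
  "generically_stable L M A w q \<longleftrightarrow>
     q \<in> complete_types L M w A \<and>
     (\<exists>b. nonforking_seq L M A w q b \<and> indiscernible_set L M A b)"

text \<open>
  The type of the possibly infinite tuple \<open>(b\<^sub>i)\<^sub>i\<^sub>\<in>\<^sub>S\<close> consists of formulas in finitely many
  variables, so it forks iff its restriction to the variables of some finite subtuple does.
\<close>

definition indep_family :: "('s, 'f, 'r) lang \<Rightarrow> ('s, 'f, 'r, 'm) struct \<Rightarrow> 'm set \<Rightarrow>
    'i set \<Rightarrow> ('i \<Rightarrow> 'm list) \<Rightarrow> bool" where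
  "indep_family L M A I b \<longleftrightarrow>
     (\<forall>S \<subseteq> I. \<forall>is. distinct is \<and> set is \<subseteq> S \<longrightarrow>
        \<not> type_forks L M A (sorts M (concat (map b is)))
            (tp L M (concat (map b is)) (A \<union> (\<Union>j\<in>I - S. set (b j)))))"

text \<open>
  The supremum of a set of cardinals on a fixed type.  All cardinals on \<^typ>\<open>'i\<close> are bounded by
  the cardinality of \<^typ>\<open>'i\<close>, so there is a least upper bound, unique up to \<open>=o\<close>.
\<close>

definition is_card_sup :: "'i rel set \<Rightarrow> 'i rel \<Rightarrow> bool" where
  "is_card_sup X \<mu> \<longleftrightarrow>
     Card_order \<mu> \<and> (\<forall>\<kappa>\<in>X. \<kappa> \<le>o \<mu>) \<and>
     (\<forall>\<nu> :: 'i rel. Card_order \<nu> \<and> (\<forall>\<kappa>\<in>X. \<kappa> \<le>o \<nu>) \<longrightarrow> \<mu> \<le>o \<nu>)"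

definition card_sup :: "'i rel set \<Rightarrow> 'i rel" where
  "card_sup X = (SOME \<mu>. is_card_sup X \<mu>)"

definition randomness_pattern :: "('s, 'f, 'r) lang \<Rightarrow> ('s, 'f, 'r, 'm) struct \<Rightarrow> 'm set \<Rightarrow>
    's list \<Rightarrow> ('s, 'f, 'r, 'm) pfm set \<Rightarrow> 'i set \<Rightarrow> ('i \<Rightarrow> ('s, 'f, 'r) fm) \<Rightarrow>
    ('i \<Rightarrow> nat \<Rightarrow> 'm list) \<Rightarrow> bool" where
  "randomness_pattern L M A w p I \<phi> b \<longleftrightarrow>
     (\<forall>\<alpha>\<in>I. indiscernible_seq L M (A \<union> (\<Union>\<beta>\<in>I - {\<alpha>}. \<Union>i. set (b \<beta> i))) (b \<alpha>)) \<and>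
     (\<forall>\<alpha>\<in>I. \<forall>i. wf_fm L (w @ sorts M (b \<alpha> i)) (\<phi> \<alpha>)) \<and>
     (\<forall>\<eta> :: 'i \<Rightarrow> nat. consistent M w
        (p \<union> {(\<phi> \<alpha>, b \<alpha> (\<eta> \<alpha>)) | \<alpha>. \<alpha> \<in> I}
           \<union> {(Neg (\<phi> \<alpha>), b \<alpha> i) | \<alpha> i. \<alpha> \<in> I \<and> i \<noteq> \<eta> \<alpha>}))"

definition spwt_witness :: "('s, 'f, 'r) lang \<Rightarrow> ('s, 'f, 'r, 'm) struct \<Rightarrow> 'm set \<Rightarrow>
    's list \<Rightarrow> ('s, 'f, 'r, 'm) pfm set \<Rightarrow> 'i set \<Rightarrow> 'm list \<Rightarrow>
    ('i \<Rightarrow> 's list) \<Rightarrow> ('i \<Rightarrow> ('s, 'f, 'r, 'm) pfm set) \<Rightarrow> ('i \<Rightarrow> 'm list) \<Rightarrow> bool" where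
  "spwt_witness L M A w p I a v q b \<longleftrightarrow>
     realizes M w a p \<and>
     (\<forall>i\<in>I. generically_stable L M A (v i) (q i) \<and> realizes M (v i) (b i) (q i)) \<and>
     indep_family L M A I b \<and>
     (\<forall>i\<in>I. type_divides L M A w (tp L M a (A \<union> set (b i))))"

text \<open>
  The suprema range over cardinals (well-orders \<open>\<kappa>\<close> with \<^term>\<open>Card_order \<kappa>\<close>, with
  \<^term>\<open>Field \<kappa>\<close> as index set) on the type of finite tuples of \<open>M\<close>.  This is no restriction:
  in a randomness pattern the tuples \<open>b\<^sup>\<alpha>\<^sub>0\<close> are pairwise distinct, since \<open>J\<^sub>\<alpha>\<close> is non-constant
  and indiscernible over the other \<open>J\<^sub>\<beta>\<close>; in a witness for the stable pre-weight the \<open>b\<^sub>i\<close> are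
  pairwise distinct, since \<open>b\<^sub>i = b\<^sub>j\<close> with \<open>i \<noteq> j\<close> would by independence be algebraic over \<open>A\<close>,
  and then the type of \<open>a\<close> over \<open>A b\<^sub>i\<close> would not divide over \<open>A\<close>.  So the index sets always
  have cardinality at most that of \<^typ>\<open>'m list\<close>.
\<close>

definition dp_rk :: "('s, 'f, 'r) lang \<Rightarrow> ('s, 'f, 'r, 'm) struct \<Rightarrow> 'm set \<Rightarrow>
    's list \<Rightarrow> ('s, 'f, 'r, 'm) pfm set \<Rightarrow> 'm list rel" where
  "dp_rk L M A w p =
     card_sup {\<kappa>. Card_order \<kappa> \<and> (\<exists>\<phi> b. randomness_pattern L M A w p (Field \<kappa>) \<phi> b)}"

definition spwt :: "('s, 'f, 'r) lang \<Rightarrow> ('s, 'f, 'r, 'm) struct \<Rightarrow> 'm set \<Rightarrow>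
    's list \<Rightarrow> ('s, 'f, 'r, 'm) pfm set \<Rightarrow> 'm list rel" where
  "spwt L M A w p =
     card_sup {\<kappa>. Card_order \<kappa> \<and> (\<exists>a v q b. spwt_witness L M A w p (Field \<kappa>) a v q b)}"

end

theory Submission
  imports Defs "HOL-Library.Ramsey" "HOL-Library.Countable_Set"
begin

text \<open>
  Let \<open>a\<close> realize \<open>p\<close> and let \<open>(b\<^sub>i)\<close> be an independent family of realizations of generically stable
  types such that some \<open>\<psi>\<^sub>i(x, b\<^sub>i)\<close> true of \<open>a\<close> divides over \<open>A\<close>.  Independence and average types allow
  one to complete finitely many of the \<open>b\<^sub>i\<close> to nonforking indiscernible sets that are mutually
  indiscernible over \<open>A\<close>.  A nonforking indiscernible set witnesses every instance of dividing over the extension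
  base \<open>A\<close>, so \<open>\<psi>\<^sub>i(a, y)\<close> holds on only finitely many elements of the \<open>i\<close>-th row, and thinning out the rows
  leaves exactly one.  By mutual indiscernibility as sets, the rows can be permuted independently of each other, which
  moves the exceptional element of each row to any prescribed place: this is a randomness pattern.
  If infinitely many of the \<open>\<psi>\<^sub>i\<close> were the same formula, these patterns would give it the independence property.
  Hence there are few indices, and compactness yields the pattern for all of them.
\<close>

subsection \<open>Substitution of variables\<close>

text \<open>A formula dividing over \<open>A\<close> does so along some indiscernible sequence of
  its parameters, which need not be the generically stable one. The extension base bridges this gap:
  any tuple \<open>d\<close> starts an \<open>A\<close>-indiscernible sequence whose next term is
  nonforking over \<open>d\<close> and a whole given row. If \<open>\<psi>(d, y)\<close> held along
  a row indiscernible over \<open>A d\<close>, the next term would satisfy \<open>\<psi>\<close> at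
  some member of the row, so \<open>\<psi>\<close> could not fork. Definability and stationarity of
  generically stable types are never established; nonforking realizations of averages do their work,
  and dependence enters only as the statement that no formula cuts out every subset of every initial
  segment of a sequence. Cardinality is the second obstacle. Saturation and homogeneity reach only
  below \<open>\<kappa>\<close>, whereas an independent family is at first bounded just by the
  number of tuples of the model; this is why finite patterns must come before compactness.
  Compactness is then asked for one path only, together with invariance of the rows under all
  injective moves; automorphisms supply the remaining paths.\<close>

primrec tren :: "(nat \<Rightarrow> nat) \<Rightarrow> 'f tm \<Rightarrow> 'f tm" where
  "tren f (Var n) = Var (f n)"
| "tren f (Fn g ts) = Fn g (map (tren f) ts)"

primrec fren :: "(nat \<Rightarrow> nat) \<Rightarrow> ('s, 'f, 'r) fm \<Rightarrow> ('s, 'f, 'r) fm" where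
  "fren f (Eq t u) = Eq (tren f t) (tren f u)"
| "fren f (Rel r ts) = Rel r (map (tren f) ts)"
| "fren f (Neg \<phi>) = Neg (fren f \<phi>)"
| "fren f (And \<phi> \<psi>) = And (fren f \<phi>) (fren f \<psi>)"
| "fren f (Forall s \<phi>) = Forall s (fren (case_nat 0 (Suc \<circ> f)) \<phi>)"

lemma wf_tm_tren:
  assumes "wf_tm L w t s" "\<forall>n<length w. f n < length w' \<and> w' ! f n = w ! n"
  shows "wf_tm L w' (tren f t) s"
  using assms(1)
proof induction
  case (1 n)
  then show ?case using assms(2) wf_tm.intros(1)[of "f n" w' L] by auto
next
  case (2 g ss s ts)
  have "list_all2 (wf_tm L w') (map (tren f) ts) ss"
    using 2(2) by (auto simp: list_all2_conv_all_nth)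
  then show ?case using 2(1) by (auto intro: wf_tm.intros)
qed

lemma tm_val_tren:
  assumes "wf_tm L w t s" "\<forall>n<length w. e ! f n = e' ! n"
  shows "tm_val M e (tren f t) = tm_val M e' t"
  using assms(1)
proof induction
  case (1 n)
  then show ?case using assms(2) by auto
next
  case (2 g ss s ts)
  have "map (tm_val M e \<circ> tren f) ts = map (tm_val M e') ts"
    using 2(2) by (intro nth_equalityI) (auto simp: list_all2_conv_all_nth)
  then have "map (tm_val M e) (map (tren f) ts) = map (tm_val M e') ts" by simp
  then show ?case by (simp only: tren.simps tm_val.simps)
qed

lemma wf_fm_fren:
  "wf_fm L w \<phi> \<Longrightarrow> \<forall>n<length w. f n < length w' \<and> w' ! f n = w ! n \<Longrightarrow> wf_fm L w' (fren f \<phi>)"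
proof (induction \<phi> arbitrary: w w' f)
  case (Eq t u)
  then obtain s where s: "wf_tm L w t s" "wf_tm L w u s" by auto
  show ?case using wf_tm_tren[OF s(1) Eq(2)] wf_tm_tren[OF s(2) Eq(2)] by auto
next
  case (Rel r ts)
  then show ?case by (auto simp: list_all2_conv_all_nth intro!: wf_tm_tren)
next
  case (Forall s \<phi>)
  have "\<forall>n<length (s # w). case_nat 0 (Suc \<circ> f) n < length (s # w') \<and>
      (s # w') ! case_nat 0 (Suc \<circ> f) n = (s # w) ! n"
    using Forall.prems(2) by (auto split: nat.split)
  then show ?case using Forall.IH[of "s # w"] Forall.prems(1) by simp
qed auto

lemma sat_fren:
  "wf_fm L w \<phi> \<Longrightarrow> \<forall>n<length w. e ! f n = e' ! n \<Longrightarrow> sat M (fren f \<phi>) e = sat M \<phi> e'"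
proof (induction \<phi> arbitrary: w e e' f)
  case (Eq t u)
  then obtain s where s: "wf_tm L w t s" "wf_tm L w u s" by auto
  show ?case by (simp add: tm_val_tren[OF s(1) Eq(2)] tm_val_tren[OF s(2) Eq(2)])
next
  case (Rel r ts)
  then obtain ss where ss: "list_all2 (wf_tm L w) ts ss" by auto
  have "tm_val M e (tren f (ts ! i)) = tm_val M e' (ts ! i)" if "i < length ts" for i
    by (rule tm_val_tren[OF _ Rel(2)]) (use ss that in \<open>auto simp: list_all2_conv_all_nth\<close>)
  then have "map (tm_val M e) (map (tren f) ts) = map (tm_val M e') ts"
    by (intro nth_equalityI) auto
  then show ?case by (simp only: fren.simps sat.simps)
next
  case (Forall s \<phi>)
  have "\<forall>n<length (s # w). (m # e) ! case_nat 0 (Suc \<circ> f) n = (m # e') ! n" for m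
    using Forall.prems(2) by (auto split: nat.split)
  then have "sat M (fren (case_nat 0 (Suc \<circ> f)) \<phi>) (m # e) = sat M \<phi> (m # e')" for m
    using Forall.IH[of "s # w" "m # e"] Forall.prems(1) by simp
  then show ?case by (simp only: fren.simps sat.simps)
next
  case (Neg \<phi>)
  then show ?case using Neg.IH[of w e f e'] by simp
next
  case (And \<phi> \<psi>)
  then show ?case using And.IH(1)[of w e f e'] And.IH(2)[of w e f e'] by simp
qed

text \<open>Renaming along \<open>(!) js\<close> permutes, repeats and omits variables in one
  operation, so every later change of argument order or insertion of dummy variables is an
  instance.\<close>

lemma fm_select:
  assumes "wf_fm L (map ((!) w) js) \<phi>" "\<forall>j\<in>set js. j < length w"
  shows "\<exists>\<phi>'. wf_fm L w \<phi>' \<and> (\<forall>e :: 'm list. sat M \<phi>' e = sat M \<phi> (map ((!) e) js))"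
proof (intro exI[of _ "fren ((!) js) \<phi>"] conjI allI)
  show "wf_fm L w (fren ((!) js) \<phi>)"
    by (rule wf_fm_fren[OF assms(1)]) (use assms(2) in auto)
  show "sat M (fren ((!) js) \<phi>) e = sat M \<phi> (map ((!) e) js)" for e
    by (rule sat_fren[OF assms(1)]) auto
qed

text \<open>The positions depend only on the lengths of the blocks. The same \<open>p\<close>
  therefore serves the sorts and all families \<open>E\<close> at once, which is what makes a single
  renamed formula correct for every assignment.\<close>

lemma block_positions:
  assumes "b \<in> set bs"
  shows "\<exists>p. (\<forall>j\<in>set p. j < length (concat (map S bs))) \<and> map ((!) (concat (map S bs))) p = S b \<and>
    (\<forall>E :: _ \<Rightarrow> 'm list. (\<forall>b\<in>set bs. length (E b) = length (S b)) \<longrightarrow>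
       map ((!) (concat (map E bs))) p = E b)"
  using assms
proof (induction bs)
  case (Cons a bs)
  show ?case
  proof (cases "b = a")
    case True
    show ?thesis
      by (rule exI[of _ "[0..<length (S a)]"]) (auto simp: True nth_append intro!: nth_equalityI)
  next
    case False
    then obtain p where p: "\<forall>j\<in>set p. j < length (concat (map S bs))"
      "map ((!) (concat (map S bs))) p = S b"
      "\<And>E :: _ \<Rightarrow> 'm list. (\<forall>b\<in>set bs. length (E b) = length (S b)) \<longrightarrow>
         map ((!) (concat (map E bs))) p = E b"
      using Cons by auto
    have eq: "map ((!) (xs @ ys)) (map ((+) (length xs)) p) = map ((!) ys) p" for xs ys :: "'z list"
      by simp
    show ?thesis
    proof (intro exI[of _ "map ((+) (length (S a))) p"] conjI allI impI)
      show "\<forall>j\<in>set (map ((+) (length (S a))) p). j < length (concat (map S (a # bs)))"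
        using p(1) by auto
      show "map ((!) (concat (map S (a # bs)))) (map ((+) (length (S a))) p) = S b"
        using p(2) eq[of "S a" "concat (map S bs)"] by (simp del: map_map)
      fix E :: "_ \<Rightarrow> 'm list" assume E: "\<forall>b\<in>set (a # bs). length (E b) = length (S b)"
      then have "length (S a) = length (E a)" by simp
      then show "map ((!) (concat (map E (a # bs)))) (map ((+) (length (S a))) p) = E b"
        using p(3)[of E] E eq[of "E a" "concat (map E bs)"] by (simp del: map_map)
    qed
  qed
qed simp

lemma block_select:
  fixes M :: "('s, 'f, 'r, 'm) struct" and S :: "'b \<Rightarrow> 's list"
  assumes "wf_fm L (concat (map S bs')) \<phi>" "set bs' \<subseteq> set bs"
  shows "\<exists>\<phi>'. wf_fm L (concat (map S bs)) \<phi>' \<and>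
    (\<forall>E. (\<forall>b\<in>set bs. sorts M (E b) = S b) \<longrightarrow>
       sat M \<phi>' (concat (map E bs)) = sat M \<phi> (concat (map E bs')))"
proof -
  have "\<forall>b\<in>set bs'. \<exists>p. (\<forall>j\<in>set p. j < length (concat (map S bs))) \<and>
    map ((!) (concat (map S bs))) p = S b \<and>
    (\<forall>E :: _ \<Rightarrow> 'm list. (\<forall>b\<in>set bs. length (E b) = length (S b)) \<longrightarrow>
       map ((!) (concat (map E bs))) p = E b)"
    using block_positions[of _ bs S] assms(2) by blast
  then obtain p where p: "\<forall>b\<in>set bs'. (\<forall>j\<in>set (p b). j < length (concat (map S bs))) \<and>
    map ((!) (concat (map S bs))) (p b) = S b \<and>
    (\<forall>E :: _ \<Rightarrow> 'm list. (\<forall>b\<in>set bs. length (E b) = length (S b)) \<longrightarrow>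
       map ((!) (concat (map E bs))) (p b) = E b)"
    by (rule bchoice[THEN exE])
  let ?js = "concat (map p bs')"
  have "map ((!) (concat (map S bs))) ?js = concat (map S bs')"
    using p by (auto simp: map_concat intro!: arg_cong[where f = concat])
  then obtain \<phi>' where \<phi>': "wf_fm L (concat (map S bs)) \<phi>'"
      "\<forall>e :: 'm list. sat M \<phi>' e = sat M \<phi> (map ((!) e) ?js)"
    using fm_select[of L "concat (map S bs)" ?js \<phi> M] assms(1) p by auto
  have "sat M \<phi>' (concat (map E bs)) = sat M \<phi> (concat (map E bs'))"
    if E: "\<forall>b\<in>set bs. sorts M (E b) = S b" for E
  proof -
    have "\<forall>b\<in>set bs. length (E b) = length (S b)" using E by (metis length_map)
    then have "map ((!) (concat (map E bs))) ?js = concat (map E bs')"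
      using p by (auto simp: map_concat intro!: arg_cong[where f = concat])
    then show ?thesis using \<phi>'(2) by simp
  qed
  then show ?thesis using \<phi>'(1) by blast
qed

lemma fm_ex:
  "wf_fm L (w @ v) \<phi> \<Longrightarrow> \<exists>\<phi>'. wf_fm L v \<phi>' \<and>
     (\<forall>e. sat M \<phi>' e \<longleftrightarrow> (\<exists>a. sorts M a = w \<and> sat M \<phi> (a @ e)))"
proof (induction w arbitrary: \<phi>)
  case (Cons s w)
  have "wf_fm L (w @ v) (Neg (Forall s (Neg \<phi>)))" using Cons.prems by simp
  from Cons.IH[OF this] obtain \<phi>' where \<phi>': "wf_fm L v \<phi>'"
    "\<forall>e. sat M \<phi>' e \<longleftrightarrow> (\<exists>a. sorts M a = w \<and> sat M (Neg (Forall s (Neg \<phi>))) (a @ e))"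
    by (elim exE conjE)
  have "(\<exists>a. sorts M a = w \<and> (\<exists>m. srt M m = s \<and> sat M \<phi> (m # a @ e))) \<longleftrightarrow>
      (\<exists>a. sorts M a = s # w \<and> sat M \<phi> (a @ e))" for e
  proof
    assume "\<exists>a. sorts M a = w \<and> (\<exists>m. srt M m = s \<and> sat M \<phi> (m # a @ e))"
    then obtain a m where "sorts M a = w" "srt M m = s" "sat M \<phi> (m # a @ e)" by auto
    then show "\<exists>a. sorts M a = s # w \<and> sat M \<phi> (a @ e)" by (intro exI[of _ "m # a"]) simp
  next
    assume "\<exists>a. sorts M a = s # w \<and> sat M \<phi> (a @ e)"
    then obtain b where b: "sorts M b = s # w" "sat M \<phi> (b @ e)" by (elim exE conjE)
    obtain m a where ma: "b = m # a" using b(1) by (cases b) auto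
    from b[unfolded ma] show "\<exists>a. sorts M a = w \<and> (\<exists>m. srt M m = s \<and> sat M \<phi> (m # a @ e))"
      by (intro exI[of _ a] conjI exI[of _ m]) auto
  qed
  then show ?case using \<phi>' by (intro exI[of _ \<phi>'] conjI allI) simp_all
next
  case Nil
  then show ?case by (intro exI[of _ \<phi>]) simp
qed

lemma split_blocks:
  assumes "distinct us" "sorts M a = concat (map S us)" "\<forall>v. sorts M (e0 v) = S v"
  shows "\<exists>e. (\<forall>v. sorts M (e v) = S v) \<and> concat (map e us) = a \<and> (\<forall>v. v \<notin> set us \<longrightarrow> e v = e0 v)"
  using assms(1,2)
proof (induction us arbitrary: a)
  case Nil
  then show ?case using assms(3) by (intro exI[of _ e0]) auto
next
  case (Cons u us)
  let ?n = "length (S u)"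
  have "sorts M (drop ?n a) = concat (map S us)" using Cons.prems by (simp add: drop_map[symmetric])
  then obtain e where e: "\<forall>v. sorts M (e v) = S v" "concat (map e us) = drop ?n a"
      "\<forall>v. v \<notin> set us \<longrightarrow> e v = e0 v"
    using Cons.IH[of "drop ?n a"] Cons.prems(1) by (auto simp del: drop_map)
  have "sorts M (take ?n a) = S u" using Cons.prems by (simp add: take_map[symmetric])
  moreover have "concat (map (e(u := take ?n a)) us) = concat (map e us)"
    using Cons.prems by (auto intro!: arg_cong[where f = concat])
  ultimately have "concat (map (e(u := take ?n a)) (u # us)) = a" using e(2) by (simp del: fun_upd_apply) simp
  moreover have "\<forall>v. sorts M ((e(u := take ?n a)) v) = S v"
    "\<forall>v. v \<notin> set (u # us) \<longrightarrow> (e(u := take ?n a)) v = e0 v"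
    using e \<open>sorts M (take ?n a) = S u\<close> by auto
  ultimately show ?case by (intro exI[of _ "e(u := take ?n a)"] conjI)
qed

lemma sel:
  fixes M :: "('s, 'f, 'r, 'm) struct"
  assumes "wf_fm L (concat (map ((!) ws) js)) \<phi>" "\<forall>j\<in>set js. j < length ws"
  shows "\<exists>\<phi>'. wf_fm L (concat ws) \<phi>' \<and>
    (\<forall>es. map (sorts M) es = ws \<longrightarrow> sat M \<phi>' (concat es) = sat M \<phi> (concat (map ((!) es) js)))"
proof -
  have "set js \<subseteq> set [0..<length ws]" using assms(2) by auto
  from block_select[where S = "(!) ws" and M = M, OF assms(1) this]
  obtain \<phi>' where \<phi>': "wf_fm L (concat ws) \<phi>'"
    "\<forall>E. (\<forall>b\<in>set [0..<length ws]. sorts M (E b) = ws ! b) \<longrightarrow>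
       sat M \<phi>' (concat (map E [0..<length ws])) = sat M \<phi> (concat (map E js))"
    by (auto simp: map_nth)
  have "sat M \<phi>' (concat es) = sat M \<phi> (concat (map ((!) es) js))" if es: "map (sorts M) es = ws" for es
  proof -
    have l: "length es = length ws" using es by auto
    then have "\<forall>b\<in>set [0..<length ws]. sorts M (es ! b) = ws ! b" using es by auto
    moreover have "map ((!) es) [0..<length ws] = es" using l by (metis map_nth)
    ultimately show ?thesis using \<phi>'(2) by metis
  qed
  then show ?thesis using \<phi>'(1) by blast
qed

lemma consistentI: "(\<And>F. F \<subseteq> \<Sigma> \<Longrightarrow> finite F \<Longrightarrow> \<exists>a. realizes M w a F) \<Longrightarrow> consistent M w \<Sigma>"
  unfolding consistent_def by simp

lemma consistentD: "consistent M w \<Sigma> \<Longrightarrow> F \<subseteq> \<Sigma> \<Longrightarrow> finite F \<Longrightarrow> \<exists>a. realizes M w a F"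
  unfolding consistent_def by simp

lemma realizes_mono: "realizes M w a \<Sigma>' \<Longrightarrow> \<Sigma> \<subseteq> \<Sigma>' \<Longrightarrow> realizes M w a \<Sigma>"
  by (auto simp: realizes_def)

locale monster =
  fixes L :: "('s, 'f, 'r) lang"
    and \<kappa> :: "'k rel"
    and M :: "('s, 'f, 'r, 'm) struct"
  assumes card_order: "Card_order \<kappa>"
    and card_formulas: "|{\<phi>. \<exists>w. wf_fm L w \<phi>}| <o \<kappa>"
    and is_struct: "is_struct L M"
    and saturated: "saturated L \<kappa> M"
    and homogeneous: "strongly_homogeneous L \<kappa> M"
    and dependent: "dependent_theory L M"
begin

subsection \<open>Small sets\<close>

definition small :: "'a set \<Rightarrow> bool" where
  "small X \<longleftrightarrow> |X| <o \<kappa>"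

text \<open>Even with an empty signature the iterated negations of \<open>x = x\<close> are pairwise
  distinct. As \<open>\<kappa>\<close> exceeds the number of formulas, it is uncountable and all
  countable sets are small.\<close>

lemma infinite_formulas: "infinite {\<phi>. \<exists>w. wf_fm L w \<phi>}"
proof -
  let ?f = "\<lambda>n. (Neg ^^ n) (Eq (Var 0) (Var 0)) :: ('s, 'f, 'r) fm"
  have wf: "wf_fm L [s] (?f n)" for s n
    by (induction n) (auto intro: wf_tm.intros(1)[of 0 "[s]", simplified])
  have size: "size (?f n) = n + size (?f 0)" for n by (induction n) auto
  have "inj ?f"
  proof (rule injI)
    fix m n assume "?f m = ?f n"
    then have "size (?f m) = size (?f n)" by (rule arg_cong)
    then show "m = n" unfolding size[of m] size[of n] by simp
  qed
  then have "infinite (range ?f)" by (simp add: finite_image_iff)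
  moreover have "range ?f \<subseteq> {\<phi>. \<exists>w. wf_fm L w \<phi>}" using wf by blast
  ultimately show ?thesis using finite_subset by blast
qed

lemma small_nat: "small (UNIV :: nat set)"
  using infinite_formulas card_formulas infinite_iff_card_of_nat ordLeq_ordLess_trans
  unfolding small_def by blast

lemma infinite_Field: "infinite (Field \<kappa>)"
proof
  assume "finite (Field \<kappa>)"
  moreover have "|UNIV :: nat set| \<le>o |Field \<kappa>|"
    using small_nat card_order card_of_Field_ordIso ordIso_symmetric ordLess_imp_ordLeq ordLeq_ordIso_trans
    unfolding small_def by blast
  ultimately show False using card_of_ordLeq_finite by blast
qed

lemma small_mono: "small Y \<Longrightarrow> X \<subseteq> Y \<Longrightarrow> small X"
  unfolding small_def using card_of_mono1 ordLeq_ordLess_trans by blast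

lemma small_image: "small X \<Longrightarrow> small (f ` X)"
  unfolding small_def using card_of_image ordLeq_ordLess_trans by blast

lemma small_Un: "small (X \<union> Y) \<longleftrightarrow> small X \<and> small Y"
proof
  assume "small (X \<union> Y)"
  then show "small X \<and> small Y" using small_mono by blast
next
  assume "small X \<and> small Y"
  then show "small (X \<union> Y)"
    unfolding small_def using card_of_Un_ordLess_infinite_Field[OF infinite_Field card_order] by blast
qed

lemma small_countable: assumes "countable X" shows "small X"
proof (cases "X = {}")
  case False
  then have "X \<subseteq> range (from_nat_into X)" using assms by (intro subset_range_from_nat_into)
  then show ?thesis by (rule small_mono[OF small_image[OF small_nat]])
qed (use small_mono[OF small_image[OF small_nat]] in blast)

lemma small_Times:
  assumes "small X" shows "small (X \<times> (UNIV :: nat set))"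
proof (cases "finite X")
  case True
  then show ?thesis by (intro small_countable countable_SIGMA) (simp_all add: countable_finite)
next
  case False
  then have "|X \<times> (UNIV :: nat set)| \<le>o |X|"
    using card_of_Times_ordLeq_infinite_Field[of "|X|" X "UNIV :: nat set"] infinite_iff_card_of_nat[of X]
      card_of_Card_order[of X] by (simp add: Field_card_of card_of_mono1)
  then show ?thesis using assms ordLeq_ordLess_trans unfolding small_def by blast
qed

lemma small_finite: "finite X \<Longrightarrow> small X"
  using small_countable countable_finite by blast

lemma small_tuples: "small I \<Longrightarrow> small (\<Union>i\<in>I. set (f i :: 'a list))"
proof -
  assume "small I"
  then have "small ((\<lambda>(i, n). f i ! n) ` (I \<times> (UNIV :: nat set)))"
    by (intro small_image small_Times)
  moreover have "(\<Union>i\<in>I. set (f i)) \<subseteq> (\<lambda>(i, n). f i ! n) ` (I \<times> (UNIV :: nat set))"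
    by (force simp: in_set_conv_nth)
  ultimately show ?thesis using small_mono by blast
qed

subsection \<open>Compactness\<close>

lemma finite_subset_chain:
  assumes "finite F" "F \<subseteq> \<Union>C" "C \<noteq> {}" "subset.chain \<A> C"
  shows "\<exists>Y\<in>C. F \<subseteq> Y"
  using finite_subset_Union_chain[OF assms] by blast

text \<open>Saturation is stated for complete types, so Zorn's lemma first yields a maximal
  consistent extension. It is complete: if neither \<open>\<phi>\<close> nor its negation could be
  added, a realization of the remainders of two finite inconsistent sets would realize one of
  them.\<close>

lemma realized_1:
  assumes "small B" "\<Sigma> \<subseteq> pfms L M [s] B" "consistent M [s] \<Sigma>"
  shows "\<exists>a. realizes M [s] a \<Sigma>"
proof -
  let ?A = "{p. \<Sigma> \<subseteq> p \<and> p \<subseteq> pfms L M [s] B \<and> consistent M [s] p}"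
  have "\<exists>p\<in>?A. \<forall>q\<in>?A. p \<subseteq> q \<longrightarrow> q = p"
  proof (rule subset_Zorn_nonempty)
    show "?A \<noteq> {}" using assms by blast
    fix C assume C: "C \<noteq> {}" "subset.chain ?A C"
    then have sub: "C \<subseteq> ?A" by (simp add: subset.chain_def)
    have "consistent M [s] (\<Union>C)"
    proof (rule consistentI)
      fix F assume F: "F \<subseteq> \<Union>C" "finite F"
      obtain Y where Y: "Y \<in> C" "F \<subseteq> Y" using finite_subset_chain[OF F(2,1) C] by (elim bexE)
      then have "consistent M [s] Y" using sub by blast
      then show "\<exists>a. realizes M [s] a F" using Y(2) F(2) by (rule consistentD)
    qed
    then show "\<Union>C \<in> ?A" using sub C(1) by blast
  qed
  then obtain p where pA: "p \<in> ?A" and max: "\<forall>q\<in>?A. p \<subseteq> q \<longrightarrow> q = p" by (elim bexE)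
  then have p: "\<Sigma> \<subseteq> p" "p \<subseteq> pfms L M [s] B" "consistent M [s] p" by simp_all
  have ins: "x \<in> p" if "x \<in> pfms L M [s] B" "consistent M [s] (insert x p)" for x
  proof -
    have "insert x p \<in> ?A" using p that by auto
    then have "insert x p = p" using max by (meson subset_insertI)
    then show ?thesis by blast
  qed
  have "(\<phi>, c) \<in> p \<or> (Neg \<phi>, c) \<in> p" if m: "(\<phi>, c) \<in> pfms L M [s] B" for \<phi> c
  proof (rule ccontr)
    assume n: "\<not> ?thesis"
    have m': "(Neg \<phi>, c) \<in> pfms L M [s] B" using m by (simp add: pfms_def)
    have "\<not> consistent M [s] (insert (\<phi>, c) p)" "\<not> consistent M [s] (insert (Neg \<phi>, c) p)"
      using n ins[OF m] ins[OF m'] by auto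
    then obtain F G where FG: "finite F" "F \<subseteq> insert (\<phi>, c) p" "\<not> (\<exists>a. realizes M [s] a F)"
      "finite G" "G \<subseteq> insert (Neg \<phi>, c) p" "\<not> (\<exists>a. realizes M [s] a G)"
      unfolding consistent_def by metis
    let ?H = "(F - {(\<phi>, c)}) \<union> (G - {(Neg \<phi>, c)})"
    have "?H \<subseteq> p" "finite ?H" using FG by auto
    with p(3) have "\<exists>a. realizes M [s] a ?H" by (rule consistentD)
    then obtain a where a: "realizes M [s] a ?H" by (elim exE)
    show False
    proof (cases "sat M \<phi> (a @ c)")
      case True
      then have "realizes M [s] a F" using a unfolding realizes_def by auto
      then show False by (rule notE[OF FG(3) exI])
    next
      case False
      then have "realizes M [s] a G" using a unfolding realizes_def by auto
      then show False by (rule notE[OF FG(6) exI])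
    qed
  qed
  then have pc: "p \<in> complete_types L M [s] B" using p unfolding complete_types_def by auto
  then have "\<exists>a. realizes M [s] a p"
    using saturated assms(1) unfolding saturated_def small_def by simp
  then obtain a where "realizes M [s] a p" by (elim exE)
  then have "realizes M [s] a \<Sigma>" using p(1) by (rule realizes_mono)
  then show ?thesis by (rule exI)
qed

text \<open>
  Types in infinitely many variables are treated through predicates on families of tuples
  that are given by a formula in finitely many of the tuples.
\<close>

definition fam :: "('v \<Rightarrow> 's list) \<Rightarrow> ('v \<Rightarrow> 'm list) \<Rightarrow> bool" where
  "fam S E \<longleftrightarrow> (\<forall>v. sorts M (E v) = S v)"

definition definable :: "('v \<Rightarrow> 's list) \<Rightarrow> 'v set \<Rightarrow> 'm set \<Rightarrow> (('v \<Rightarrow> 'm list) \<Rightarrow> bool) \<Rightarrow> bool" where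
  "definable S V X P \<longleftrightarrow> (\<exists>vs \<phi> c. set vs \<subseteq> V \<and> set c \<subseteq> X \<and>
     wf_fm L (concat (map S vs) @ sorts M c) \<phi> \<and>
     (\<forall>E. fam S E \<longrightarrow> (P E \<longleftrightarrow> sat M \<phi> (concat (map E vs) @ c))))"

lemma definable_sat:
  "set vs \<subseteq> V \<Longrightarrow> set c \<subseteq> X \<Longrightarrow> wf_fm L (concat (map S vs) @ sorts M c) \<phi> \<Longrightarrow>
   definable S V X (\<lambda>E. sat M \<phi> (concat (map E vs) @ c))"
  unfolding definable_def by blast

lemma definable_mono: "definable S V X P \<Longrightarrow> V \<subseteq> V' \<Longrightarrow> X \<subseteq> X' \<Longrightarrow> definable S V' X' P"
  unfolding definable_def by (meson subset_trans)

lemma definable_True: "definable S V X (\<lambda>E. True)"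
  unfolding definable_def
  \<comment> \<open>The true formula has to be well-formed in the empty context and over a signature
    without symbols, hence a bound variable, of an arbitrary sort.\<close>
  by (intro exI[of _ "[]"] exI[of _ "Forall undefined (Eq (Var 0) (Var 0))"])
    (auto intro: wf_tm.intros(1)[of 0 "[_]", simplified])

lemma definable_neg: assumes "definable S V X P" shows "definable S V X (\<lambda>E. \<not> P E)"
proof -
  obtain vs \<phi> c where *: "set vs \<subseteq> V" "set c \<subseteq> X" "wf_fm L (concat (map S vs) @ sorts M c) \<phi>"
    "\<forall>E. fam S E \<longrightarrow> P E \<longleftrightarrow> sat M \<phi> (concat (map E vs) @ c)"
    using assms unfolding definable_def by (elim exE conjE)
  then show ?thesis unfolding definable_def
    by (intro exI[of _ vs] exI[of _ "Neg \<phi>"] exI[of _ c]) auto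
qed

lemma definable_conj:
  assumes "definable S V X P" "definable S V X Q"
  shows "definable S V X (\<lambda>E. P E \<and> Q E)"
proof -
  obtain vs \<phi> c where P: "set vs \<subseteq> V" "set c \<subseteq> X" "wf_fm L (concat (map S vs) @ sorts M c) \<phi>"
    "\<forall>E. fam S E \<longrightarrow> P E \<longleftrightarrow> sat M \<phi> (concat (map E vs) @ c)"
    using assms(1) unfolding definable_def by (elim exE conjE)
  obtain us \<psi> d where Q: "set us \<subseteq> V" "set d \<subseteq> X" "wf_fm L (concat (map S us) @ sorts M d) \<psi>"
    "\<forall>E. fam S E \<longrightarrow> Q E \<longleftrightarrow> sat M \<psi> (concat (map E us) @ d)"
    using assms(2) unfolding definable_def by (elim exE conjE)
  let ?ws = "[concat (map S vs), concat (map S us), sorts M c, sorts M d]"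
  obtain \<phi>' where \<phi>': "wf_fm L (concat ?ws) \<phi>'"
    "\<And>es. map (sorts M) es = ?ws \<Longrightarrow> sat M \<phi>' (concat es) = sat M \<phi> (concat (map ((!) es) [0, 2]))"
    using sel[of L ?ws "[0,2]" \<phi> M] P(3) by auto
  obtain \<psi>' where \<psi>': "wf_fm L (concat ?ws) \<psi>'"
    "\<And>es. map (sorts M) es = ?ws \<Longrightarrow> sat M \<psi>' (concat es) = sat M \<psi> (concat (map ((!) es) [1, 3]))"
    using sel[of L ?ws "[1,3]" \<psi> M] Q(3) by auto
  have "P E \<and> Q E \<longleftrightarrow> sat M (And \<phi>' \<psi>') (concat (map E (vs @ us)) @ (c @ d))" if E: "fam S E" for E
  proof -
    have S: "sorts M (E v) = S v" for v using E by (simp add: fam_def)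
    have m: "map (sorts M) [concat (map E vs), concat (map E us), c, d] = ?ws"
      by (simp add: map_concat o_def S)
    show ?thesis using \<phi>'(2)[OF m] \<psi>'(2)[OF m] P(4)[rule_format, OF E] Q(4)[rule_format, OF E] by simp
  qed
  then show ?thesis unfolding definable_def using P Q \<phi>'(1) \<psi>'(1)
    by (intro exI[of _ "vs @ us"] exI[of _ "And \<phi>' \<psi>'"] exI[of _ "c @ d"]) simp
qed

lemma definable_iff:
  assumes "definable S V X P" "definable S V X Q"
  shows "definable S V X (\<lambda>E. P E \<longleftrightarrow> Q E)"
proof -
  have "definable S V X (\<lambda>E. \<not> (P E \<and> \<not> Q E) \<and> \<not> (Q E \<and> \<not> P E))"
    by (intro definable_conj definable_neg assms)
  moreover have "(\<lambda>E. \<not> (P E \<and> \<not> Q E) \<and> \<not> (Q E \<and> \<not> P E)) = (\<lambda>E. P E \<longleftrightarrow> Q E)" by auto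
  ultimately show ?thesis by simp
qed

lemma definable_Ball:
  "finite F \<Longrightarrow> \<forall>P\<in>F. definable S V X P \<Longrightarrow> definable S V X (\<lambda>E. \<forall>P\<in>F. P E)"
proof (induction F rule: finite_induct)
  case (insert P F)
  then show ?case using definable_conj[of S V X P "\<lambda>E. \<forall>P\<in>F. P E"] by simp
qed (simp add: definable_True)

lemma definable_comp:
  assumes "definable S V X P" "\<And>v. S' (f v) = S v" "f ` V \<subseteq> V'"
  shows "definable S' V' X (\<lambda>E. P (E \<circ> f))"
proof -
  obtain vs \<phi> c where P: "set vs \<subseteq> V" "set c \<subseteq> X" "wf_fm L (concat (map S vs) @ sorts M c) \<phi>"
    "\<forall>E. fam S E \<longrightarrow> P E \<longleftrightarrow> sat M \<phi> (concat (map E vs) @ c)"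
    using assms(1) unfolding definable_def by (elim exE conjE)
  have f: "fam S (E \<circ> f)" if "fam S' E" for E using that assms(2) by (simp add: fam_def)
  have 1: "set (map f vs) \<subseteq> V'" using P(1) assms(3) by auto
  have 2: "map S' (map f vs) = map S vs" using assms(2) by simp
  have 3: "map E (map f vs) = map (E \<circ> f) vs" for E :: "_ \<Rightarrow> 'm list" by simp
  show ?thesis unfolding definable_def
  proof (intro exI conjI allI impI)
    show "wf_fm L (concat (map S' (map f vs)) @ sorts M c) \<phi>" unfolding 2 by (rule P(3))
    show "P (E \<circ> f) \<longleftrightarrow> sat M \<phi> (concat (map E (map f vs)) @ c)" if "fam S' E" for E
      unfolding 3 using P(4) f[OF that] by blast
  qed (use 1 P(2) in auto)
qed

text \<open>The values on \<open>J\<close> become parameters and all other variables of the defining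
  formula are quantified existentially. What remains is the condition that a value at
  \<open>v\<close> must meet to be compatible with \<open>P\<close> and with the values already
  fixed; \<open>compactness_1\<close> imposes it on each new value.\<close>

lemma definable_projection:
  assumes "definable S V X P" "fam S e0" "finite J" "v \<notin> J"
  shows "\<exists>\<chi> d. set d \<subseteq> X \<union> (\<Union>u\<in>J. set (e0 u)) \<and> wf_fm L (S v @ sorts M d) \<chi> \<and>
    (\<forall>x. sorts M x = S v \<longrightarrow>
       (sat M \<chi> (x @ d) \<longleftrightarrow> (\<exists>E. fam S E \<and> E v = x \<and> (\<forall>u\<in>J. E u = e0 u) \<and> P E)))"
proof -
  obtain vs \<phi> c where P: "set vs \<subseteq> V" "set c \<subseteq> X" "wf_fm L (concat (map S vs) @ sorts M c) \<phi>"
    "\<forall>E. fam S E \<longrightarrow> P E \<longleftrightarrow> sat M \<phi> (concat (map E vs) @ c)"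
    using assms(1) unfolding definable_def by (elim exE conjE)
  obtain js where js: "set js = J" using finite_list[OF assms(3)] by blast
  define us where "us = remdups (filter (\<lambda>u. u \<noteq> v \<and> u \<notin> J) vs)"
  \<comment> \<open>The extra block \<open>None\<close> carries the parameters \<open>c\<close>, so
    that they are moved around like the variables.\<close>
  define S' where "S' = case_option (sorts M c) S"
  let ?bs = "map Some us @ [Some v] @ map Some js @ [None]"
  have S': "map S' (map Some xs) = map S xs" for xs by (simp add: S'_def)
  have "set (map Some vs @ [None]) \<subseteq> set ?bs" by (auto simp: us_def js)
  moreover have "wf_fm L (concat (map S' (map Some vs @ [None]))) \<phi>"
    using P(3) by (simp add: S'_def o_def)
  ultimately obtain \<phi>' where \<phi>': "wf_fm L (concat (map S' ?bs)) \<phi>'"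
    "\<And>E. (\<forall>b\<in>set ?bs. sorts M (E b) = S' b) \<Longrightarrow>
       sat M \<phi>' (concat (map E ?bs)) = sat M \<phi> (concat (map E (map Some vs @ [None])))"
    using block_select[where S = S' and bs = ?bs and bs' = "map Some vs @ [None]" and M = M and L = L]
    by blast
  have sat': "P E \<longleftrightarrow> sat M \<phi>' (concat (map E us) @ E v @ concat (map E js) @ c)" if E: "fam S E" for E
  proof -
    have S: "sorts M (E v) = S v" for v using E by (simp add: fam_def)
    have "\<forall>b\<in>set ?bs. sorts M (case_option c E b) = S' b" by (auto simp: S'_def S)
    from \<phi>'(2)[OF this] show ?thesis using P(4)[rule_format, OF E] by (simp add: o_def)
  qed
  let ?r = "S v @ concat (map S js) @ sorts M c"
  have "wf_fm L (concat (map S us) @ ?r) \<phi>'" using \<phi>'(1) by (simp add: S'_def o_def)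
  from fm_ex[OF this, of M] obtain \<chi> where \<chi>: "wf_fm L ?r \<chi>"
    "\<forall>e. sat M \<chi> e \<longleftrightarrow> (\<exists>a. sorts M a = concat (map S us) \<and> sat M \<phi>' (a @ e))"
    by (elim exE conjE)
  let ?d = "concat (map e0 js) @ c"
  have e0: "sorts M (e0 u) = S u" for u using assms(2) by (simp add: fam_def)
  have dist: "distinct us" "v \<notin> set us" "set us \<inter> J = {}" by (auto simp: us_def)
  have "sat M \<chi> (x @ ?d) \<longleftrightarrow> (\<exists>E. fam S E \<and> E v = x \<and> (\<forall>u\<in>J. E u = e0 u) \<and> P E)"
    if x: "sorts M x = S v" for x
  proof
    assume "sat M \<chi> (x @ ?d)"
    with \<chi>(2) obtain a where a: "sorts M a = concat (map S us)" "sat M \<phi>' (a @ x @ ?d)" by blast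
    have "\<forall>u. sorts M ((e0(v := x)) u) = S u" using e0 x by simp
    from split_blocks[OF dist(1) a(1) this] obtain E where
      E: "\<forall>u. sorts M (E u) = S u" "concat (map E us) = a" "\<forall>u. u \<notin> set us \<longrightarrow> E u = (e0(v := x)) u"
      by (elim exE conjE)
    have Ev: "E v = x" using E(3) dist by simp
    have EJ: "E u = e0 u" if "u \<in> J" for u
    proof -
      have "u \<notin> set us" "u \<noteq> v" using that dist assms(4) by auto
      then show ?thesis using E(3) by simp
    qed
    then have "concat (map E js) = concat (map e0 js)" using js by (metis map_cong)
    moreover have "fam S E" using E(1) by (simp add: fam_def)
    ultimately show "\<exists>E. fam S E \<and> E v = x \<and> (\<forall>u\<in>J. E u = e0 u) \<and> P E"
      using sat'[of E] a(2) E(2) Ev EJ by auto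
  next
    assume "\<exists>E. fam S E \<and> E v = x \<and> (\<forall>u\<in>J. E u = e0 u) \<and> P E"
    then obtain E where E: "fam S E" "E v = x" "\<forall>u\<in>J. E u = e0 u" "P E" by blast
    have "concat (map E js) = concat (map e0 js)" using E(3) js by (metis map_cong)
    then have "sat M \<phi>' (concat (map E us) @ x @ ?d)" using sat'[OF E(1)] E by simp
    moreover have "sorts M (concat (map E us)) = concat (map S us)"
      using E(1) by (simp add: map_concat o_def fam_def)
    ultimately show "sat M \<chi> (x @ ?d)" using \<chi>(2) by blast
  qed
  moreover have "set ?d \<subseteq> X \<union> (\<Union>u\<in>J. set (e0 u))" using P(2) js by auto
  moreover have "wf_fm L (S v @ sorts M ?d) \<chi>" using \<chi>(1) e0 by (simp add: map_concat o_def)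
  ultimately show ?thesis by (intro exI[of _ \<chi>] exI[of _ ?d]) simp
qed

lemma sort_inhabited: "\<exists>m. srt M m = s"
  using is_struct unfolding is_struct_def by blast

text \<open>Saturation realizes types in one variable, so values are assigned one variable at a
  time: a maximal partial assignment, each finite part of which is compatible with each finite part
  of \<open>\<Gamma>\<close>, must be total. It is kept as a set of pairs \<open>G\<close> to make
  unions of chains immediate; that it is a function follows from compatibility.\<close>

lemma compactness_1:
  fixes s :: "'v \<Rightarrow> 's"
  assumes small: "small V" "small X" and \<Gamma>: "\<And>P. P \<in> \<Gamma> \<Longrightarrow> definable S V X P"
    and S: "S = (\<lambda>v. [s v])"
    and fin: "\<And>F. F \<subseteq> \<Gamma> \<Longrightarrow> finite F \<Longrightarrow> \<exists>E. fam S E \<and> (\<forall>P\<in>F. P E)"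
  shows "\<exists>E. fam S E \<and> (\<forall>P\<in>\<Gamma>. P E)"
proof -
  define K where "K G \<longleftrightarrow> (\<forall>F H. finite F \<and> F \<subseteq> G \<and> finite H \<and> H \<subseteq> \<Gamma> \<longrightarrow>
    (\<exists>E. fam S E \<and> (\<forall>z\<in>F. E (fst z) = snd z) \<and> (\<forall>P\<in>H. P E)))" for G
  have KD: "\<exists>E. fam S E \<and> (\<forall>z\<in>F. E (fst z) = snd z) \<and> (\<forall>P\<in>H. P E)"
    if "K G" "finite F" "F \<subseteq> G" "finite H" "H \<subseteq> \<Gamma>" for F G H
    using that unfolding K_def by blast
  let ?A = "{G. G \<subseteq> V \<times> UNIV \<and> K G}"
  have "\<exists>G\<in>?A. \<forall>G'\<in>?A. G \<subseteq> G' \<longrightarrow> G' = G"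
  proof (rule subset_Zorn_nonempty)
    have "K {}" using fin unfolding K_def by auto
    then show "?A \<noteq> {}" by blast
    fix C assume C: "C \<noteq> {}" "subset.chain ?A C"
    then have sub: "C \<subseteq> ?A" by (simp add: subset.chain_def)
    have "K (\<Union>C)"
      unfolding K_def
    proof (intro allI impI, elim conjE)
      fix F H assume F: "finite F" "F \<subseteq> \<Union>C" and H: "finite H" "H \<subseteq> \<Gamma>"
      obtain Y where Y: "Y \<in> C" "F \<subseteq> Y" using finite_subset_chain[OF F C] by (elim bexE)
      then have "K Y" using sub by blast
      from KD[OF this F(1) Y(2) H]
      show "\<exists>E. fam S E \<and> (\<forall>z\<in>F. E (fst z) = snd z) \<and> (\<forall>P\<in>H. P E)" .
    qed
    then show "\<Union>C \<in> ?A" using sub by blast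
  qed
  then obtain G where GA: "G \<in> ?A" and max: "\<forall>G'\<in>?A. G \<subseteq> G' \<longrightarrow> G' = G" by (elim bexE)
  then have G: "G \<subseteq> V \<times> UNIV" "K G" by simp_all
  have uniq: "x = y" if xy: "(v, x) \<in> G" "(v, y) \<in> G" for v x y
  proof -
    have "{(v, x), (v, y)} \<subseteq> G" using xy by simp
    from KD[OF G(2) _ this, of "{}"] obtain E where "\<forall>z\<in>{(v, x), (v, y)}. E (fst z) = snd z" by auto
    then show ?thesis by auto
  qed
  have "inj_on fst G" by (intro inj_onI) (metis prod.collapse uniq)
  moreover have "small (fst ` G)" using G(1) by (intro small_mono[OF small(1)]) auto
  ultimately have "small G" unfolding small_def
    using card_of_ordIsoI[of fst G "fst ` G"] ordIso_ordLess_trans inj_on_imp_bij_betw by blast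
  then have smallB: "small (X \<union> (\<Union>z\<in>G. set (snd z)))"
    using small(2) small_tuples by (simp add: small_Un)
  have total: "\<exists>x. (v, x) \<in> G" if v: "v \<in> V" for v
  proof (rule ccontr)
    assume nx: "\<nexists>x. (v, x) \<in> G"
    define B where "B = X \<union> (\<Union>z\<in>G. set (snd z))"
    \<comment> \<open>\<open>R F H x\<close>: the formula \<open>x\<close> is forced at the missing
      variable \<open>v\<close> by the finite part \<open>F\<close> of the assignment and the finite
      set \<open>H\<close> of conditions. The type \<open>\<Sigma>\<close> of all forced formulas is
      what an admissible value must realize.\<close>
    define R where "R F H x \<longleftrightarrow> finite F \<and> F \<subseteq> G \<and> finite H \<and> H \<subseteq> \<Gamma> \<and>
       (\<forall>E. fam S E \<and> (\<forall>z\<in>F. E (fst z) = snd z) \<and> (\<forall>P\<in>H. P E) \<longrightarrow> sat M (fst x) (E v @ snd x))"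
      for F H x
    define \<Sigma> where "\<Sigma> = {x \<in> pfms L M [s v] B. \<exists>F H. R F H x}"
    have "consistent M [s v] \<Sigma>"
    proof (rule consistentI)
      fix Z assume Z: "Z \<subseteq> \<Sigma>" "finite Z"
      have "\<forall>x\<in>Z. \<exists>FH. R (fst FH) (snd FH) x"
      proof
        fix x assume "x \<in> Z"
        then have "\<exists>F H. R F H x" using Z(1) by (auto simp: \<Sigma>_def)
        then obtain F H where "R F H x" by (elim exE)
        then show "\<exists>FH. R (fst FH) (snd FH) x" by (intro exI[of _ "(F, H)"]) simp
      qed
      then obtain FH where FH: "\<forall>x\<in>Z. R (fst (FH x)) (snd (FH x)) x" by (rule bchoice[THEN exE])
      have "finite (\<Union>x\<in>Z. fst (FH x))" "(\<Union>x\<in>Z. fst (FH x)) \<subseteq> G"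
        "finite (\<Union>x\<in>Z. snd (FH x))" "(\<Union>x\<in>Z. snd (FH x)) \<subseteq> \<Gamma>"
        using FH Z(2) by (auto simp: R_def)
      from KD[OF G(2) this] obtain E where E: "fam S E"
        "\<forall>z\<in>(\<Union>x\<in>Z. fst (FH x)). E (fst z) = snd z" "\<forall>P\<in>(\<Union>x\<in>Z. snd (FH x)). P E"
        by (elim exE conjE)
      have "sat M (fst x) (E v @ snd x)" if x: "x \<in> Z" for x
      proof -
        have "R (fst (FH x)) (snd (FH x)) x" using FH x by simp
        then have "\<forall>E. fam S E \<and> (\<forall>z\<in>fst (FH x). E (fst z) = snd z) \<and> (\<forall>P\<in>snd (FH x). P E) \<longrightarrow>
          sat M (fst x) (E v @ snd x)" unfolding R_def by (elim conjE)
        then show ?thesis by (rule allE[of _ E], elim impE) (use E x in auto)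
      qed
      then have "realizes M [s v] (E v) Z" using E(1) S by (auto simp: realizes_def fam_def)
      then show "\<exists>a. realizes M [s v] a Z" by (rule exI)
    qed
    then obtain a where "realizes M [s v] a \<Sigma>"
      using realized_1[of B \<Sigma> "s v"] smallB B_def \<Sigma>_def by blast
    then have a: "sorts M a = [s v]" "\<And>x. x \<in> \<Sigma> \<Longrightarrow> sat M (fst x) (a @ snd x)"
      by (auto simp: realizes_def)
    have "K (insert (v, a) G)"
      unfolding K_def
    proof (intro allI impI, elim conjE)
      fix F H assume F: "finite F" "F \<subseteq> insert (v, a) G" and H: "finite H" "H \<subseteq> \<Gamma>"
      define F' where "F' = F - {(v, a)}"
      have F': "finite F'" "F' \<subseteq> G" using F by (auto simp: F'_def)
      from KD[OF G(2) F' H] obtain e0 where e0: "fam S e0" "\<forall>z\<in>F'. e0 (fst z) = snd z"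
        by (elim exE conjE)
      have ff: "finite (fst ` F')" "v \<notin> fst ` F'" using F' nx by auto
      have dH: "definable S V X (\<lambda>E. \<forall>P\<in>H. P E)" using H \<Gamma> by (intro definable_Ball) auto
      \<comment> \<open>\<open>\<chi>\<close> says that a value at \<open>v\<close> is compatible
        with \<open>F'\<close> and \<open>H\<close>. Every compatible family satisfies it, so it is
        forced, and hence the chosen \<open>a\<close> satisfies it and is compatible too.\<close>
      obtain \<chi> d where \<chi>: "set d \<subseteq> X \<union> (\<Union>u\<in>fst ` F'. set (e0 u))"
        "wf_fm L (S v @ sorts M d) \<chi>"
        "\<forall>x. sorts M x = S v \<longrightarrow> (sat M \<chi> (x @ d) \<longleftrightarrow>
           (\<exists>E. fam S E \<and> E v = x \<and> (\<forall>u\<in>fst ` F'. E u = e0 u) \<and> (\<forall>P\<in>H. P E)))"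
        using definable_projection[OF dH e0(1) ff] by (elim exE conjE)
      have "(\<Union>u\<in>fst ` F'. set (e0 u)) \<subseteq> (\<Union>z\<in>G. set (snd z))"
      proof
        fix y assume "y \<in> (\<Union>u\<in>fst ` F'. set (e0 u))"
        then obtain z where z: "z \<in> F'" "y \<in> set (e0 (fst z))" by (elim UN_E imageE) simp
        have "e0 (fst z) = snd z" using e0(2) z(1) by (rule bspec)
        then have "y \<in> set (snd z)" "z \<in> G" using z F'(2) by auto
        then show "y \<in> (\<Union>z\<in>G. set (snd z))" by blast
      qed
      then have "set d \<subseteq> B"
        unfolding B_def by (rule subset_trans[OF \<chi>(1) Un_mono[OF subset_refl]])
      then have pf: "(\<chi>, d) \<in> pfms L M [s v] B" using \<chi>(2) S by (simp add: pfms_def)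
      have satE: "sat M \<chi> (E v @ d)"
        if E: "fam S E" "\<forall>z\<in>F'. E (fst z) = snd z" "\<forall>P\<in>H. P E" for E
      proof -
        have J: "\<forall>u\<in>fst ` F'. E u = e0 u"
        proof
          fix u assume "u \<in> fst ` F'"
          then obtain z where z: "z \<in> F'" "u = fst z" by (elim imageE)
          show "E u = e0 u" unfolding z(2) using e0(2) E(2) z(1) by (metis (no_types, lifting))
        qed
        have "sorts M (E v) = S v" using E(1) by (simp add: fam_def)
        then show ?thesis
          by (rule \<chi>(3)[rule_format, THEN iffD2]) (intro exI[of _ E] conjI refl E(1,3) J)
      qed
      have "\<forall>E. fam S E \<and> (\<forall>z\<in>F'. E (fst z) = snd z) \<and> (\<forall>P\<in>H. P E) \<longrightarrow> sat M \<chi> (E v @ d)"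
        by (intro allI impI, elim conjE) (rule satE)
      then have "R F' H (\<chi>, d)" unfolding R_def fst_conv snd_conv by (intro conjI F' H)
      then have "(\<chi>, d) \<in> \<Sigma>" unfolding \<Sigma>_def using pf by auto
      then have "sat M \<chi> (a @ d)" using a(2)[of "(\<chi>, d)"] by simp
      moreover have "sorts M a = S v" using a(1) S by simp
      ultimately obtain E where E: "fam S E" "E v = a" "\<forall>u\<in>fst ` F'. E u = e0 u" "\<forall>P\<in>H. P E"
        by (elim \<chi>(3)[rule_format, THEN iffD1, elim_format] exE conjE)
      have "\<forall>z\<in>F. E (fst z) = snd z"
      proof
        fix z assume "z \<in> F"
        show "E (fst z) = snd z"
        proof (cases "z = (v, a)")
          case False
          then have "z \<in> F'" using \<open>z \<in> F\<close> by (simp add: F'_def)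
          then show ?thesis using E(3) e0(2) by simp
        qed (simp add: E(2))
      qed
      then show "\<exists>E. fam S E \<and> (\<forall>z\<in>F. E (fst z) = snd z) \<and> (\<forall>P\<in>H. P E)"
        by (intro exI[of _ E] conjI E(1,4))
    qed
    then have "insert (v, a) G \<in> ?A" using G(1) v by auto
    then have "insert (v, a) G = G" using max by (meson subset_insertI)
    then show False using nx by blast
  qed
  then have "\<forall>v\<in>V. \<exists>x. (v, x) \<in> G" by blast
  then obtain g where g: "\<forall>v\<in>V. (v, g v) \<in> G" by (rule bchoice[THEN exE])
  have "\<forall>t. \<exists>m. srt M m = t" using sort_inhabited by (rule allI)
  then obtain d where d: "\<forall>t. srt M (d t) = t" by (rule choice[THEN exE])
  define E where "E v = (if v \<in> V then g v else [d (s v)])" for v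
  have "sorts M (g v) = S v" if "v \<in> V" for v
  proof -
    have "{(v, g v)} \<subseteq> G" using g that by simp
    from KD[OF G(2) _ this, of "{}"]
    have "\<exists>E. fam S E \<and> (\<forall>z\<in>{(v, g v)}. E (fst z) = snd z)" by simp
    then obtain E where "fam S E" "\<forall>z\<in>{(v, g v)}. E (fst z) = snd z" by (elim exE conjE)
    then have "fam S E" "E v = g v" by simp_all
    then show ?thesis unfolding fam_def by (metis (no_types))
  qed
  then have famE: "fam S E" using d S by (simp add: fam_def E_def)
  have "P E" if P\<Gamma>: "P \<in> \<Gamma>" for P
  proof -
    obtain vs \<phi> c where P: "set vs \<subseteq> V" "set c \<subseteq> X" "wf_fm L (concat (map S vs) @ sorts M c) \<phi>"
      "\<forall>E. fam S E \<longrightarrow> P E \<longleftrightarrow> sat M \<phi> (concat (map E vs) @ c)"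
      using \<Gamma>[OF P\<Gamma>] unfolding definable_def by (elim exE conjE)
    have "(\<lambda>v. (v, g v)) ` set vs \<subseteq> G" using g P(1) by auto
    from KD[OF G(2) _ this, of "{P}"] obtain E' where
      E': "fam S E'" "\<forall>v\<in>set vs. E' v = g v" "P E'" using P\<Gamma> by auto
    have eq: "map E vs = map E' vs" using E'(2) P(1) by (auto simp: E_def)
    have "sat M \<phi> (concat (map E vs) @ c)"
      unfolding eq by (rule P(4)[rule_format, OF E'(1), THEN iffD1, OF E'(3)])
    then show ?thesis by (rule P(4)[rule_format, OF famE, THEN iffD2])
  qed
  then show ?thesis using famE by blast
qed

lemma compactness:
  fixes S :: "'v \<Rightarrow> 's list"
  assumes small: "small V" "small X" and \<Gamma>: "\<And>P. P \<in> \<Gamma> \<Longrightarrow> definable S V X P"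
    and fin: "\<And>F. F \<subseteq> \<Gamma> \<Longrightarrow> finite F \<Longrightarrow> \<exists>E. fam S E \<and> (\<forall>P\<in>F. P E)"
  shows "\<exists>E. fam S E \<and> (\<forall>P\<in>\<Gamma>. P E)"
proof -
  \<comment> \<open>Each tuple variable \<open>v\<close> is split into single variables
    \<open>(v, n)\<close>. Those with \<open>n\<close> beyond the length of the tuple are dummies of
    an arbitrary sort, ignored by \<open>lift\<close>.\<close>
  define s where "s z = (if snd z < length (S (fst z)) then S (fst z) ! snd z else undefined)"
    for z :: "'v \<times> nat"
  define T where "T = (\<lambda>z. [s z])"
  define lift where "lift E v = concat (map (\<lambda>n. E (v, n)) [0..<length (S v)])"
    for E :: "'v \<times> nat \<Rightarrow> 'm list" and v
  have lift_fam: "fam S (lift E)" if "fam T E" for E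
  proof -
    have *: "sorts M (E z) = [s z]" for z using that unfolding fam_def T_def by blast
    have "sorts M (lift E v) = map (\<lambda>n. s (v, n)) [0..<length (S v)]" for v
      by (simp add: lift_def map_concat o_def *)
    moreover have "map (\<lambda>n. s (v, n)) [0..<length (S v)] = S v" for v
      by (rule nth_equalityI) (auto simp: s_def)
    ultimately show ?thesis by (simp add: fam_def)
  qed
  have def: "definable T (V \<times> UNIV) X (\<lambda>E. P (lift E))" if P\<Gamma>: "P \<in> \<Gamma>" for P
  proof -
    obtain vs \<phi> c where P: "set vs \<subseteq> V" "set c \<subseteq> X" "wf_fm L (concat (map S vs) @ sorts M c) \<phi>"
      "\<forall>E. fam S E \<longrightarrow> P E \<longleftrightarrow> sat M \<phi> (concat (map E vs) @ c)"
      using \<Gamma>[OF P\<Gamma>] unfolding definable_def by (elim exE conjE)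
    let ?zs = "concat (map (\<lambda>v. map (Pair v) [0..<length (S v)]) vs)"
    have c: "concat (map E ?zs) = concat (map (lift E) vs)" for E
      by (induction vs) (auto simp: lift_def o_def)
    have "\<forall>t. \<exists>m. srt M m = t" using sort_inhabited by (rule allI)
    then obtain d where d: "\<forall>t. srt M (d t) = t" by (rule choice[THEN exE])
    have fT: "fam T (\<lambda>z. [d (s z)])" using d by (simp add: fam_def T_def)
    have "concat (map T ?zs) = sorts M (concat (map (\<lambda>z. [d (s z)]) ?zs))"
      using d by (simp add: T_def map_concat o_def)
    also have "\<dots> = concat (map S vs)"
      using lift_fam[OF fT] unfolding c by (simp add: fam_def map_concat o_def)
    finally have "wf_fm L (concat (map T ?zs) @ sorts M c) \<phi>" using P(3) by simp
    moreover have "set ?zs \<subseteq> V \<times> UNIV" using P(1) by auto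
    moreover have "\<forall>E. fam T E \<longrightarrow> P (lift E) = sat M \<phi> (concat (map E ?zs) @ c)"
      unfolding c using P(4) lift_fam by simp
    ultimately show ?thesis unfolding definable_def using P(2) by (intro exI conjI)
  qed
  have "\<exists>E. fam T E \<and> (\<forall>Q\<in>(\<lambda>P E. P (lift E)) ` \<Gamma>. Q E)"
  proof (rule compactness_1[OF _ small(2) _ T_def])
    show "small (V \<times> (UNIV :: nat set))" using small by (intro small_Times)
    show "definable T (V \<times> UNIV) X Q" if "Q \<in> (\<lambda>P E. P (lift E)) ` \<Gamma>" for Q
      using that def by auto
    fix F assume "F \<subseteq> (\<lambda>P E. P (lift E)) ` \<Gamma>" "finite F"
    then obtain F' where F': "F' \<subseteq> \<Gamma>" "finite F'" "F = (\<lambda>P E. P (lift E)) ` F'"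
      by (meson finite_subset_image)
    with fin obtain E where E: "fam S E" "\<forall>P\<in>F'. P E" by blast
    define E' where "E' z = [if snd z < length (S (fst z)) then E (fst z) ! snd z
      else (SOME m. srt M m = undefined)]" for z :: "'v \<times> nat"
    have len: "length (E v) = length (S v)" for v using E(1) by (metis fam_def length_map)
    have "lift E' = E"
    proof
      fix v
      have "lift E' v = map (\<lambda>n. E v ! n) [0..<length (E v)]"
        by (simp add: lift_def E'_def len)
      then show "lift E' v = E v" by (simp add: map_nth)
    qed
    moreover have "fam T E'"
    proof -
      have "srt M (E v ! n) = S v ! n" if "n < length (S v)" for v n
        using E(1) len that by (metis fam_def nth_map)
      then show ?thesis using someI_ex[OF sort_inhabited]
        by (simp add: fam_def T_def E'_def s_def)
    qed
    ultimately show "\<exists>E. fam T E \<and> (\<forall>Q\<in>F. Q E)" using E F'(3) by auto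
  qed
  then show ?thesis using lift_fam by auto
qed

lemma realized:
  assumes "small B" "\<Sigma> \<subseteq> pfms L M w B" "consistent M w \<Sigma>"
  shows "\<exists>a. realizes M w a \<Sigma>"
proof -
  let ?P = "\<lambda>x E. sat M (fst x) (E () @ snd x)"
  have "\<exists>E. fam (\<lambda>u::unit. w) E \<and> (\<forall>P\<in>?P ` \<Sigma>. P E)"
  proof (rule compactness[OF small_finite assms(1)])
    show "definable (\<lambda>u::unit. w) UNIV B P" if "P \<in> ?P ` \<Sigma>" for P
      using that assms(2) definable_sat[of "[()]" UNIV _ B "\<lambda>u::unit. w"] by (force simp: pfms_def)
    fix F assume "F \<subseteq> ?P ` \<Sigma>" "finite F"
    then obtain F' where F': "F' \<subseteq> \<Sigma>" "finite F'" "F = ?P ` F'" by (meson finite_subset_image)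
    then obtain a where a: "realizes M w a F'" using assms(3) unfolding consistent_def by blast
    then show "\<exists>E. fam (\<lambda>u::unit. w) E \<and> (\<forall>P\<in>F. P E)"
      unfolding F'(3) by (intro exI[of _ "\<lambda>_. a"]) (auto simp: realizes_def fam_def)
  qed simp
  then obtain E where "fam (\<lambda>u::unit. w) E" "\<forall>P\<in>?P ` \<Sigma>. P E" by blast
  then show ?thesis by (intro exI[of _ "E ()"]) (auto simp: realizes_def fam_def)
qed

end

lemma concat_map_eq_iff:
  "\<forall>v\<in>set vs. length (e v) = length (e' v) \<Longrightarrow>
   concat (map e vs) = concat (map e' vs) \<longleftrightarrow> (\<forall>v\<in>set vs. e v = e' v)"
  by (induction vs) auto

context monster
begin

subsection \<open>Automorphisms and types\<close>

definition Aut :: "'m set \<Rightarrow> ('m \<Rightarrow> 'm) set" where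
  "Aut X = {h. automorphism L M h \<and> (\<forall>x\<in>X. h x = x)}"

lemma Aut_mono: "h \<in> Aut Y \<Longrightarrow> X \<subseteq> Y \<Longrightarrow> h \<in> Aut X"
  by (auto simp: Aut_def)

lemma Aut_fix: "h \<in> Aut X \<Longrightarrow> set c \<subseteq> X \<Longrightarrow> map h c = c"
  by (auto simp: Aut_def intro!: map_idI)

lemma sorts_map_Aut: "h \<in> Aut X \<Longrightarrow> sorts M (map h e) = sorts M e"
  by (simp add: Aut_def automorphism_def)

lemma Aut_id: "id \<in> Aut X"
  by (simp add: Aut_def automorphism_def)

lemma Aut_comp: assumes "g \<in> Aut X" "h \<in> Aut X" shows "g \<circ> h \<in> Aut X"
proof -
  have s: "sorts M (map h xs) = sorts M xs" for xs using assms(2) by (rule sorts_map_Aut)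
  have 1: "(g \<circ> h) (fint M f xs) = fint M f (map (g \<circ> h) xs)"
    if "fsig L f = Some (ss, t)" "sorts M xs = ss" for f ss t xs
  proof -
    have "h (fint M f xs) = fint M f (map h xs)"
      using assms(2) that unfolding Aut_def automorphism_def by blast
    moreover have "g (fint M f (map h xs)) = fint M f (map g (map h xs))"
      using assms(1) that s[of xs] unfolding Aut_def automorphism_def by blast
    ultimately show ?thesis by simp
  qed
  have 2: "rint M r (map (g \<circ> h) xs) \<longleftrightarrow> rint M r xs"
    if "rsig L r = Some ss" "sorts M xs = ss" for r ss xs
  proof -
    have "rint M r (map h xs) \<longleftrightarrow> rint M r xs"
      using assms(2) that unfolding Aut_def automorphism_def by blast
    moreover have "rint M r (map g (map h xs)) \<longleftrightarrow> rint M r (map h xs)"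
      using assms(1) that s[of xs] unfolding Aut_def automorphism_def by blast
    ultimately show ?thesis by simp
  qed
  have "bij (g \<circ> h)" using assms by (intro bij_comp) (auto simp: Aut_def automorphism_def)
  moreover have "\<forall>a. srt M ((g \<circ> h) a) = srt M a" "\<forall>x\<in>X. (g \<circ> h) x = x"
    using assms by (auto simp: Aut_def automorphism_def)
  ultimately show ?thesis using 1 2 unfolding Aut_def automorphism_def by blast
qed

lemma Aut_inv: assumes "h \<in> Aut X" shows "inv h \<in> Aut X"
proof -
  have bij: "bij h" using assms by (simp add: Aut_def automorphism_def)
  have hi: "h (inv h x) = x" and ih: "inv h (h x) = x" for x
    using bij by (simp_all add: bij_is_surj surj_f_inv_f bij_is_inj)
  have srt: "srt M (inv h x) = srt M x" for x
  proof -
    have "srt M (h (inv h x)) = srt M (inv h x)" using assms by (simp add: Aut_def automorphism_def)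
    then show ?thesis by (simp add: hi)
  qed
  then have s: "sorts M (map (inv h) xs) = sorts M xs" for xs by simp
  have m: "map h (map (inv h) xs) = xs" for xs by (simp add: o_def hi)
  have 1: "inv h (fint M f xs) = fint M f (map (inv h) xs)"
    if "fsig L f = Some (ss, t)" "sorts M xs = ss" for f ss t xs
  proof -
    have "h (fint M f (map (inv h) xs)) = fint M f (map h (map (inv h) xs))"
      using assms that s[of xs] unfolding Aut_def automorphism_def by blast
    then show ?thesis unfolding m by (metis ih)
  qed
  have 2: "rint M r (map (inv h) xs) \<longleftrightarrow> rint M r xs"
    if "rsig L r = Some ss" "sorts M xs = ss" for r ss xs
  proof -
    have "rint M r (map h (map (inv h) xs)) \<longleftrightarrow> rint M r (map (inv h) xs)"
      using assms that s[of xs] unfolding Aut_def automorphism_def by blast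
    then show ?thesis unfolding m by simp
  qed
  have "inv h x = x" if "x \<in> X" for x
  proof -
    have "h x = x" using assms that by (simp add: Aut_def)
    then show ?thesis by (metis ih)
  qed
  moreover have "bij (inv h)" using bij by (rule bij_imp_bij_inv)
  ultimately show ?thesis using 1 2 srt unfolding Aut_def automorphism_def by blast
qed

lemma Aut_inv_map: "h \<in> Aut X \<Longrightarrow> map (inv h) (map h c) = c"
  by (simp add: Aut_def automorphism_def bij_is_inj o_def)

lemma tm_val_sort:
  "wf_tm L w t s \<Longrightarrow> w = sorts M e \<Longrightarrow> srt M (tm_val M e t) = s"
proof (induction rule: wf_tm.induct)
  case (2 f ss s ts)
  have "sorts M (map (tm_val M e) ts) = ss"
    using 2 by (intro nth_equalityI) (auto simp: list_all2_conv_all_nth)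
  then show ?case using is_struct 2(1) unfolding is_struct_def by simp
qed simp

lemma tm_val_Aut:
  assumes "wf_tm L w t s" "w = sorts M e" "h \<in> Aut X"
  shows "tm_val M (map h e) t = h (tm_val M e t)"
  using assms(1,2)
proof (induction rule: wf_tm.induct)
  case (2 f ss s ts)
  have 1: "sorts M (map (tm_val M e) ts) = ss"
    using 2 tm_val_sort[where e = e] by (intro nth_equalityI) (auto simp: list_all2_conv_all_nth)
  have 2: "map (tm_val M (map h e)) ts = map h (map (tm_val M e) ts)"
    using 2 by (intro nth_equalityI) (auto simp: list_all2_conv_all_nth)
  have "h (fint M f (map (tm_val M e) ts)) = fint M f (map h (map (tm_val M e) ts))"
    using assms(3) 1 \<open>fsig L f = Some (ss, s)\<close> unfolding Aut_def automorphism_def by blast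
  then show ?case unfolding tm_val.simps 2 by simp
qed simp

lemma sat_Aut:
  "h \<in> Aut X \<Longrightarrow> wf_fm L (sorts M e) \<phi> \<Longrightarrow> sat M \<phi> (map h e) \<longleftrightarrow> sat M \<phi> e"
proof (induction \<phi> arbitrary: e)
  case (Eq t u)
  then obtain s where s: "wf_tm L (sorts M e) t s" "wf_tm L (sorts M e) u s" by auto
  have "inj h" using Eq(1) by (simp add: Aut_def automorphism_def bij_is_inj)
  then show ?case using tm_val_Aut[OF s(1) refl Eq(1)] tm_val_Aut[OF s(2) refl Eq(1)]
    by (simp add: inj_eq)
next
  case (Rel r ts)
  then obtain ss where ss: "rsig L r = Some ss" "list_all2 (wf_tm L (sorts M e)) ts ss" by auto
  have 1: "sorts M (map (tm_val M e) ts) = ss"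
    using ss(2) tm_val_sort[where e = e] by (intro nth_equalityI) (auto simp: list_all2_conv_all_nth)
  have 2: "map (tm_val M (map h e)) ts = map h (map (tm_val M e) ts)"
  proof (intro nth_equalityI)
    fix i assume "i < length (map (tm_val M (map h e)) ts)"
    then have i: "i < length ts" by simp
    then have "wf_tm L (sorts M e) (ts ! i) (ss ! i)" using ss(2) by (simp add: list_all2_conv_all_nth)
    from tm_val_Aut[OF this refl Rel(1)] i
    show "map (tm_val M (map h e)) ts ! i = map h (map (tm_val M e) ts) ! i" by simp
  qed simp
  have "rint M r (map h (map (tm_val M e) ts)) \<longleftrightarrow> rint M r (map (tm_val M e) ts)"
    using Rel(1) 1 ss(1) unfolding Aut_def automorphism_def by blast
  then show ?case unfolding sat.simps 2 .
next
  case (Forall s \<phi>)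
  have bij: "bij h" and srt: "\<And>m. srt M (h m) = srt M m"
    using Forall.prems(1) by (simp_all add: Aut_def automorphism_def)
  have 1: "sat M \<phi> (h m # map h e) \<longleftrightarrow> sat M \<phi> (m # e)" if "srt M m = s" for m
    using Forall.IH[OF Forall.prems(1), of "m # e"] Forall.prems(2) that by simp
  show ?case
  proof
    assume *: "sat M (Forall s \<phi>) (map h e)"
    show "sat M (Forall s \<phi>) e" unfolding sat.simps
    proof (intro allI impI)
      fix m assume m: "srt M m = s"
      then have "sat M \<phi> (h m # map h e)" using * srt by simp
      then show "sat M \<phi> (m # e)" using 1[OF m] by simp
    qed
  next
    assume *: "sat M (Forall s \<phi>) e"
    show "sat M (Forall s \<phi>) (map h e)" unfolding sat.simps
    proof (intro allI impI)
      fix m assume m: "srt M m = s"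
      obtain m' where m': "m = h m'" using bij by (metis bij_pointE)
      then have "srt M m' = s" using m srt by simp
      then show "sat M \<phi> (m # map h e)" using 1 * m' by simp
    qed
  qed
qed auto

definition eqt :: "'m set \<Rightarrow> 'm list \<Rightarrow> 'm list \<Rightarrow> bool" where
  "eqt X a b \<longleftrightarrow> sorts M a = sorts M b \<and> tp L M a X = tp L M b X"

lemma eqt_iff: "eqt X a b \<longleftrightarrow> sorts M a = sorts M b \<and>
   (\<forall>\<phi> c. set c \<subseteq> X \<longrightarrow> wf_fm L (sorts M a @ sorts M c) \<phi> \<longrightarrow> sat M \<phi> (a @ c) = sat M \<phi> (b @ c))"
proof (cases "sorts M a = sorts M b")
  case True
  have tp: "(\<phi>, c) \<in> tp L M e X \<longleftrightarrow> set c \<subseteq> X \<and> wf_fm L (sorts M e @ sorts M c) \<phi> \<and> sat M \<phi> (e @ c)"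
    for e \<phi> c by (auto simp: tp_def pfms_def)
  have "tp L M a X = tp L M b X \<longleftrightarrow> (\<forall>\<phi> c. (\<phi>, c) \<in> tp L M a X \<longleftrightarrow> (\<phi>, c) \<in> tp L M b X)"
    by (simp add: set_eq_iff split_paired_All)
  also have "\<dots> \<longleftrightarrow> (\<forall>\<phi> c. set c \<subseteq> X \<longrightarrow> wf_fm L (sorts M a @ sorts M c) \<phi> \<longrightarrow>
      sat M \<phi> (a @ c) = sat M \<phi> (b @ c))"
    unfolding tp True by meson
  finally show ?thesis unfolding eqt_def using True by simp
qed (simp add: eqt_def)

lemma eqtD: "eqt X a b \<Longrightarrow> set c \<subseteq> X \<Longrightarrow> wf_fm L (sorts M a @ sorts M c) \<phi> \<Longrightarrow>
  sat M \<phi> (a @ c) = sat M \<phi> (b @ c)"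
  unfolding eqt_iff by blast

lemma eqt_sorts: "eqt X a b \<Longrightarrow> sorts M a = sorts M b"
  unfolding eqt_def by blast

lemma eqt_sym: "eqt X a b \<Longrightarrow> eqt X b a" by (simp add: eqt_def)
lemma eqt_trans: "eqt X a b \<Longrightarrow> eqt X b c \<Longrightarrow> eqt X a c" by (simp add: eqt_def)

lemma eqt_mono: "eqt Y a b \<Longrightarrow> X \<subseteq> Y \<Longrightarrow> eqt X a b"
  unfolding eqt_iff by (meson subset_trans)

lemma eqt_finite_base:
  assumes "\<And>d. set d \<subseteq> X \<Longrightarrow> eqt (set d) a b" shows "eqt X a b"
  unfolding eqt_iff
proof (intro conjI allI impI)
  show "sorts M a = sorts M b" using assms[of "[]"] eqt_sorts by simp
  fix \<phi> c assume "set c \<subseteq> X" "wf_fm L (sorts M a @ sorts M c) \<phi>"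
  then show "sat M \<phi> (a @ c) = sat M \<phi> (b @ c)" by (intro eqtD[OF assms]) auto
qed

lemma Aut_eqt: assumes "h \<in> Aut X" shows "eqt X a (map h a)"
  unfolding eqt_iff
proof (intro conjI allI impI)
  show "sorts M a = sorts M (map h a)" using sorts_map_Aut[OF assms] by simp
  fix \<phi> c assume c: "set c \<subseteq> X" "wf_fm L (sorts M a @ sorts M c) \<phi>"
  have "sat M \<phi> (map h (a @ c)) = sat M \<phi> (a @ c)" using c(2) by (intro sat_Aut[OF assms]) simp
  then show "sat M \<phi> (a @ c) = sat M \<phi> (map h a @ c)" using Aut_fix[OF assms c(1)] by simp
qed

text \<open>By \<open>fm_select\<close>, a formula about a list of pairs in the graph of
  \<open>xs\<close> to \<open>ys\<close> is a formula about \<open>xs\<close> and \<open>ys\<close>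
  themselves, so elementarity of the map is inherited by all such lists.\<close>

lemma sat_transfer:
  assumes "sorts M xs = sorts M ys" "\<And>\<phi>. wf_fm L (sorts M xs) \<phi> \<Longrightarrow> sat M \<phi> xs = sat M \<phi> ys"
    and "set ps \<subseteq> set (zip xs ys)"
  shows "sorts M (map fst ps) = sorts M (map snd ps)"
    and "wf_fm L (sorts M (map fst ps)) \<phi> \<Longrightarrow> sat M \<phi> (map fst ps) = sat M \<phi> (map snd ps)"
proof -
  have len: "length xs = length ys" using assms(1) by (rule map_eq_imp_length_eq)
  have "\<forall>p\<in>set ps. \<exists>j. j < length xs \<and> fst p = xs ! j \<and> snd p = ys ! j"
    using assms(3) by (fastforce simp: set_zip)
  then obtain j where j: "\<forall>p\<in>set ps. j p < length xs \<and> fst p = xs ! j p \<and> snd p = ys ! j p"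
    by (rule bchoice[THEN exE])
  let ?js = "map j ps"
  have f: "map fst ps = map ((!) xs) ?js" and s: "map snd ps = map ((!) ys) ?js"
    and js: "\<forall>i\<in>set ?js. i < length (sorts M xs)" using j by auto
  have fs: "sorts M (map ((!) xs) ?js) = map ((!) (sorts M xs)) ?js" using js by auto
  have ss: "sorts M (map ((!) ys) ?js) = map ((!) (sorts M ys)) ?js" using js len by auto
  show "sorts M (map fst ps) = sorts M (map snd ps)"
    unfolding f s fs ss assms(1) ..
  assume "wf_fm L (sorts M (map fst ps)) \<phi>"
  then have "wf_fm L (map ((!) (sorts M xs)) ?js) \<phi>" unfolding f fs .
  from fm_select[OF this js, of M] obtain \<phi>' where \<phi>': "wf_fm L (sorts M xs) \<phi>'"
    "\<forall>e. sat M \<phi>' e = sat M \<phi> (map ((!) e) ?js)" by (elim exE conjE)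
  show "sat M \<phi> (map fst ps) = sat M \<phi> (map snd ps)"
    unfolding f s using assms(2)[OF \<phi>'(1)] \<phi>'(2) by simp
qed

text \<open>A relation is taken instead of a function because tuples may repeat elements. That it is
  single-valued comes for free: equality of two variables is one of the formulas preserved. Strong
  homogeneity then extends it.\<close>

lemma Aut_exists:
  assumes "small (fst ` R)"
    and "\<And>ps. set ps \<subseteq> R \<Longrightarrow> \<exists>xs ys. set ps \<subseteq> set (zip xs ys) \<and> sorts M xs = sorts M ys \<and>
      (\<forall>\<phi>. wf_fm L (sorts M xs) \<phi> \<longrightarrow> sat M \<phi> xs = sat M \<phi> ys)"
  shows "\<exists>h. automorphism L M h \<and> (\<forall>z\<in>R. h (fst z) = snd z)"
proof -
  have el: "sorts M (map fst ps) = sorts M (map snd ps) \<and>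
    (wf_fm L (sorts M (map fst ps)) \<phi> \<longrightarrow> sat M \<phi> (map fst ps) = sat M \<phi> (map snd ps))"
    if psR: "set ps \<subseteq> R" for ps \<phi>
  proof -
    obtain xs ys where *: "set ps \<subseteq> set (zip xs ys)" "sorts M xs = sorts M ys"
      "\<forall>\<phi>. wf_fm L (sorts M xs) \<phi> \<longrightarrow> sat M \<phi> xs = sat M \<phi> ys"
      using assms(2)[OF psR] by (elim exE conjE)
    show ?thesis
      using sat_transfer(1)[OF *(2) *(3)[rule_format] *(1)]
        sat_transfer(2)[OF *(2) *(3)[rule_format] *(1)] by (intro conjI impI)
  qed
  have uniq: "y = y'" if "(x, y) \<in> R" "(x, y') \<in> R" for x y y'
  proof -
    have "set [(x, y), (x, y')] \<subseteq> R" using that by simp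
    moreover have "wf_tm L [srt M x, srt M x] (Var 0) (srt M x)" "wf_tm L [srt M x, srt M x] (Var 1) (srt M x)"
      using wf_tm.intros(1)[of 0 "[srt M x, srt M x]" L] wf_tm.intros(1)[of 1 "[srt M x, srt M x]" L]
      by simp_all
    then have "wf_fm L (sorts M (map fst [(x, y), (x, y')])) (Eq (Var 0) (Var 1))" by auto
    ultimately have "sat M (Eq (Var 0) (Var 1)) (map fst [(x, y), (x, y')]) =
      sat M (Eq (Var 0) (Var 1)) (map snd [(x, y), (x, y')])"
      using el by (metis (no_types))
    then show ?thesis by simp
  qed
  define h where "h x = (SOME y. (x, y) \<in> R)" for x
  have h: "(x, h x) \<in> R" if "x \<in> fst ` R" for x
  proof -
    from that obtain z where z: "x = fst z" "z \<in> R" by (elim imageE)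
    then have "(x, snd z) \<in> R" by simp
    then show ?thesis unfolding h_def by (rule someI)
  qed
  have h2: "h (fst z) = snd z" if "z \<in> R" for z
  proof -
    have "(fst z, snd z) \<in> R" using that by simp
    then show ?thesis by (rule uniq[OF h[OF imageI[OF that]]])
  qed
  have "partial_elementary L M (fst ` R) h"
    unfolding partial_elementary_def
  proof (intro conjI ballI allI impI)
    show "srt M (h x) = srt M x" if "x \<in> fst ` R" for x
      using el[of "[(x, h x)]"] h[OF that] by simp
    fix xs \<phi> assume *: "set xs \<subseteq> fst ` R \<and> wf_fm L (sorts M xs) \<phi>"
    have "(x, h x) \<in> R" if "x \<in> set xs" for x
      by (rule h, rule subsetD[OF conjunct1[OF *] that])
    then have "set (map (\<lambda>x. (x, h x)) xs) \<subseteq> R" by auto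
    from el[OF this, of \<phi>] * show "sat M \<phi> (map h xs) = sat M \<phi> xs" by (simp add: o_def)
  qed
  then have "\<exists>g. automorphism L M g \<and> (\<forall>a\<in>fst ` R. g a = h a)"
    by (intro homogeneous[unfolded strongly_homogeneous_def, rule_format] conjI assms(1)[unfolded small_def])
  then obtain g where g: "automorphism L M g" "\<forall>a\<in>fst ` R. g a = h a" by (elim exE conjE)
  have "\<forall>z\<in>R. g (fst z) = snd z" using g(2) h2 by simp
  then show ?thesis using g(1) by (intro exI[of _ g] conjI)
qed

definition eqf :: "'m set \<Rightarrow> 'v set \<Rightarrow> ('v \<Rightarrow> 'm list) \<Rightarrow> ('v \<Rightarrow> 'm list) \<Rightarrow> bool" where
  "eqf X J e e' \<longleftrightarrow> (\<forall>v\<in>J. sorts M (e v) = sorts M (e' v)) \<and>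
     (\<forall>vs. set vs \<subseteq> J \<longrightarrow> eqt X (concat (map e vs)) (concat (map e' vs)))"

lemma zip_concat_map:
  "\<forall>v\<in>set vs. length (e v) = length (e' v) \<Longrightarrow>
   set (zip (concat (map e vs) @ c) (concat (map e' vs) @ c)) =
     (\<Union>v\<in>set vs. set (zip (e v) (e' v))) \<union> (\<lambda>x. (x, x)) ` set c"
proof (induction vs)
  case Nil
  then show ?case by (auto simp: zip_same_conv_map)
qed auto

lemma eqf_Aut:
  assumes "small X" "small J" "eqf X J e e'"
  shows "\<exists>h\<in>Aut X. \<forall>v\<in>J. map h (e v) = e' v"
proof -
  let ?R = "(\<lambda>x. (x, x)) ` X \<union> (\<Union>v\<in>J. set (zip (e v) (e' v)))"
  have len: "length (e v) = length (e' v)" if "v \<in> J" for v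
    using assms(3) that unfolding eqf_def by (intro map_eq_imp_length_eq[of "srt M" _ "srt M"]) simp
  have "fst ` ?R \<subseteq> X \<union> (\<Union>v\<in>J. set (e v))" by (auto dest: set_zip_leftD)
  moreover have "small (X \<union> (\<Union>v\<in>J. set (e v)))"
    using assms(1) small_tuples[OF assms(2)] by (simp add: small_Un)
  ultimately have sm: "small (fst ` ?R)" using small_mono by blast
  have "\<exists>h. automorphism L M h \<and> (\<forall>z\<in>?R. h (fst z) = snd z)"
  proof (rule Aut_exists[OF sm])
    fix ps assume ps: "set ps \<subseteq> ?R"
    then have "\<exists>vs c. set vs \<subseteq> J \<and> set c \<subseteq> X \<and>
      set ps \<subseteq> (\<Union>v\<in>set vs. set (zip (e v) (e' v))) \<union> (\<lambda>x. (x, x)) ` set c"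
    proof (induction ps)
      case Nil
      show ?case by (intro exI[of _ "[]"]) simp
    next
      case (Cons p ps)
      then obtain vs c where vs: "set vs \<subseteq> J" "set c \<subseteq> X"
        "set ps \<subseteq> (\<Union>v\<in>set vs. set (zip (e v) (e' v))) \<union> (\<lambda>x. (x, x)) ` set c" by auto
      from Cons.prems consider x where "x \<in> X" "p = (x, x)" | v where "v \<in> J" "p \<in> set (zip (e v) (e' v))"
        by auto
      then show ?case
      proof cases
        case 1
        then show ?thesis using vs by (intro exI[of _ vs] exI[of _ "x # c"]) auto
      next
        case 2
        then show ?thesis using vs by (intro exI[of _ "v # vs"] exI[of _ c]) auto
      qed
    qed
    then obtain vs c where vs: "set vs \<subseteq> J" "set c \<subseteq> X"
      "set ps \<subseteq> (\<Union>v\<in>set vs. set (zip (e v) (e' v))) \<union> (\<lambda>x. (x, x)) ` set c" by (elim exE conjE)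
    let ?xs = "concat (map e vs) @ c" and ?ys = "concat (map e' vs) @ c"
    have "eqt X (concat (map e vs)) (concat (map e' vs))" using assms(3) vs(1) unfolding eqf_def by blast
    then have "sorts M ?xs = sorts M ?ys" "\<forall>\<phi>. wf_fm L (sorts M ?xs) \<phi> \<longrightarrow> sat M \<phi> ?xs = sat M \<phi> ?ys"
      using eqtD[OF _ vs(2)] eqt_sorts by (simp_all del: map_concat)
    moreover have "set ps \<subseteq> set (zip ?xs ?ys)" using vs len by (subst zip_concat_map) auto
    ultimately show "\<exists>xs ys. set ps \<subseteq> set (zip xs ys) \<and> sorts M xs = sorts M ys \<and>
      (\<forall>\<phi>. wf_fm L (sorts M xs) \<phi> \<longrightarrow> sat M \<phi> xs = sat M \<phi> ys)"
      by (intro exI[of _ ?xs] exI[of _ ?ys] conjI)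
  qed
  then obtain h where h: "automorphism L M h" "\<forall>z\<in>?R. h (fst z) = snd z" by (elim exE conjE)
  have "h x = x" if "x \<in> X" for x
    using bspec[OF h(2), of "(x, x)"] that by simp
  then have "h \<in> Aut X" using h(1) by (simp add: Aut_def)
  moreover have "map h (e v) = e' v" if v: "v \<in> J" for v
  proof (rule nth_equalityI)
    show "length (map h (e v)) = length (e' v)" using len[OF v] by simp
    fix i assume "i < length (map h (e v))"
    then have i: "i < length (e v)" "i < length (e' v)" using len[OF v] by auto
    then have "(e v ! i, e' v ! i) \<in> set (zip (e v) (e' v))" by (auto simp: set_zip)
    then have "(e v ! i, e' v ! i) \<in> ?R" using v by blast
    from bspec[OF h(2) this] show "map h (e v) ! i = e' v ! i" using i by simp
  qed
  ultimately show ?thesis by (intro bexI[of _ h] ballI)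
qed

lemma Aut_eqf:
  assumes "h \<in> Aut X" "\<And>v. v \<in> J \<Longrightarrow> map h (e v) = e' v" shows "eqf X J e e'"
  unfolding eqf_def
proof (intro conjI ballI allI impI)
  show "sorts M (e v) = sorts M (e' v)" if "v \<in> J" for v
    using sorts_map_Aut[OF assms(1), of "e v"] assms(2)[OF that] by simp
  fix vs assume "set vs \<subseteq> J"
  then have m: "map e' vs = map (map h) (map e vs)" using assms(2) by auto
  have "map h (concat (map e vs)) = concat (map e' vs)" unfolding m by (rule map_concat)
  then show "eqt X (concat (map e vs)) (concat (map e' vs))"
    using Aut_eqt[OF assms(1), of "concat (map e vs)"] by (simp only:)
qed

lemma eqt_concat_Aut:
  assumes "small X" "eqt X (concat (map e vs)) (concat (map e' vs))"
    "\<forall>v\<in>set vs. sorts M (e v) = sorts M (e' v)"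
  shows "\<exists>h\<in>Aut X. \<forall>v\<in>set vs. map h (e v) = e' v"
proof -
  let ?a = "concat (map e vs)" and ?b = "concat (map e' vs)"
  have len: "\<forall>v\<in>set vs. length (e v) = length (e' v)" using assms(3) by (auto dest: map_eq_imp_length_eq)
  \<comment> \<open>The whole concatenation is viewed as a family with one member. Lists over the
    index type \<open>unit\<close> are repetitions of it, and repetitions are absorbed by
    \<open>sat_transfer\<close>.\<close>
  have "eqf X {()} (\<lambda>_. ?a) (\<lambda>_. ?b)"
    unfolding eqf_def
  proof (intro conjI ballI allI impI)
    show s: "sorts M ?a = sorts M ?b" using assms(2) by (rule eqt_sorts)
    fix us :: "unit list"
    show "eqt X (concat (map (\<lambda>_. ?a) us)) (concat (map (\<lambda>_. ?b) us))"
      unfolding eqt_iff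
    proof (intro conjI allI impI)
      have l: "length ?a = length ?b" by (rule map_eq_imp_length_eq[OF s])
      show "sorts M (concat (map (\<lambda>_. ?a) us)) = sorts M (concat (map (\<lambda>_. ?b) us))"
        using s by (induction us) (simp_all del: map_concat)
      fix \<phi> c assume c: "set c \<subseteq> X" "wf_fm L (sorts M (concat (map (\<lambda>_. ?a) us)) @ sorts M c) \<phi>"
      let ?ps = "zip (concat (map (\<lambda>_. ?a) us) @ c) (concat (map (\<lambda>_. ?b) us) @ c)"
      have l2: "length (concat (map (\<lambda>_. ?a) us)) = length (concat (map (\<lambda>_. ?b) us))"
        using l by (induction us) auto
      have "set ?ps \<subseteq> set (zip (?a @ c) (?b @ c))"
        using zip_concat_map[of us "\<lambda>_. ?a" "\<lambda>_. ?b" c] zip_concat_map[of "[()]" "\<lambda>_. ?a" "\<lambda>_. ?b" c] l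
        by auto
      moreover have "sorts M (?a @ c) = sorts M (?b @ c)" using s by (simp del: map_concat)
      moreover have "sat M \<psi> (?a @ c) = sat M \<psi> (?b @ c)" if "wf_fm L (sorts M (?a @ c)) \<psi>" for \<psi>
        using eqtD[OF assms(2) c(1)] that by (simp del: map_concat)
      moreover have "map fst ?ps = concat (map (\<lambda>_. ?a) us) @ c" "map snd ?ps = concat (map (\<lambda>_. ?b) us) @ c"
        using l2 by (simp_all only: map_fst_zip map_snd_zip length_append)
      moreover have "wf_fm L (sorts M (concat (map (\<lambda>_. ?a) us) @ c)) \<phi>" using c(2) by (simp del: map_concat)
      ultimately show "sat M \<phi> (concat (map (\<lambda>_. ?a) us) @ c) = sat M \<phi> (concat (map (\<lambda>_. ?b) us) @ c)"
        using sat_transfer(2)[of "?a @ c" "?b @ c" ?ps \<phi>] by presburger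
    qed
  qed
  from eqf_Aut[OF assms(1) small_finite this] have "\<exists>h\<in>Aut X. map h ?a = ?b"
    by (simp del: map_concat)
  then obtain h where h: "h \<in> Aut X" "map h ?a = ?b" by (elim bexE)
  have "concat (map (\<lambda>v. map h (e v)) vs) = ?b" using h(2) by (simp add: map_concat o_def)
  then have "\<forall>v\<in>set vs. map h (e v) = e' v"
    using len concat_map_eq_iff[of vs "\<lambda>v. map h (e v)" e'] by simp
  then show ?thesis using h(1) by (intro bexI[of _ h])
qed

lemma eqt_Aut:
  assumes "small X" "eqt X a b" shows "\<exists>h\<in>Aut X. map h a = b"
  using eqt_concat_Aut[of X "\<lambda>_. a" "[()]" "\<lambda>_. b"] assms eqt_sorts[OF assms(2)] by simp

lemma eqf_finite:
  assumes "small X" "eqt X (concat (map e vs)) (concat (map e' vs))"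
    "\<forall>v\<in>set vs. sorts M (e v) = sorts M (e' v)"
  shows "eqf X (set vs) e e'"
proof -
  obtain h where h: "h \<in> Aut X" "\<forall>v\<in>set vs. map h (e v) = e' v"
    using eqt_concat_Aut[OF assms] by (elim bexE)
  show ?thesis by (rule Aut_eqf[OF h(1)]) (use h(2) in simp)
qed

lemma eqt_Un:
  assumes "small X" shows "eqt (X \<union> set d) a b \<longleftrightarrow> eqt X (d @ a) (d @ b)"
proof
  have sm: "small (X \<union> set d)" using assms by (simp add: small_Un small_finite)
  assume "eqt (X \<union> set d) a b"
  from eqt_Aut[OF sm this] obtain h where h: "h \<in> Aut (X \<union> set d)" "map h a = b" by blast
  then have "map h (d @ a) = d @ b" using Aut_fix[OF h(1), of d] by simp
  moreover have "h \<in> Aut X" by (rule Aut_mono[OF h(1)]) simp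
  ultimately show "eqt X (d @ a) (d @ b)" using Aut_eqt[of h X "d @ a"] by (simp only:)
next
  assume "eqt X (d @ a) (d @ b)"
  from eqt_Aut[OF assms this] obtain h where h: "h \<in> Aut X" "map h (d @ a) = d @ b" by blast
  then have m: "map h d = d" "map h a = b" by auto
  have "map h d = map id d" using m(1) by simp
  then have "h x = x" if "x \<in> set d" for x using that unfolding map_eq_conv by simp
  then have "h \<in> Aut (X \<union> set d)" using h(1) by (auto simp: Aut_def)
  from Aut_eqt[OF this, of a] show "eqt (X \<union> set d) a b" unfolding m(2) .
qed

lemma realizes_tp: "realizes M w b (tp L M a X) \<Longrightarrow> sorts M a = w \<Longrightarrow> eqt X a b"
  unfolding eqt_iff
proof (intro conjI allI impI)
  assume r: "realizes M w b (tp L M a X)" and w: "sorts M a = w"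
  then show "sorts M a = sorts M b" by (simp add: realizes_def)
  fix \<phi> c assume c: "set c \<subseteq> X" "wf_fm L (sorts M a @ sorts M c) \<phi>"
  have *: "sat M \<psi> (b @ c)" if "sat M \<psi> (a @ c)" "wf_fm L (sorts M a @ sorts M c) \<psi>" for \<psi>
  proof -
    have "(\<psi>, c) \<in> tp L M a X" using that c(1) by (simp add: tp_def pfms_def)
    then show ?thesis using conjunct2[OF r[unfolded realizes_def]] by (auto dest: bspec)
  qed
  show "sat M \<phi> (a @ c) = sat M \<phi> (b @ c)"
    using *[of \<phi>] *[of "Neg \<phi>"] c(2) by auto
qed

lemma tp_complete: "tp L M a X \<in> complete_types L M (sorts M a) X"
  unfolding complete_types_def
proof (intro CollectI conjI ballI)
  show "tp L M a X \<subseteq> pfms L M (sorts M a) X" by (auto simp: tp_def)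
  show "consistent M (sorts M a) (tp L M a X)"
    by (rule consistentI) (auto simp: realizes_def tp_def intro!: exI[of _ a])
  fix x assume "x \<in> pfms L M (sorts M a) X"
  then show "case x of (\<phi>, c) \<Rightarrow> (\<phi>, c) \<in> tp L M a X \<or> (Neg \<phi>, c) \<in> tp L M a X"
    by (auto simp: tp_def pfms_def)
qed

subsection \<open>Indiscernible sequences and sets\<close>

text \<open>The admissible index lists are a parameter: \<open>sorted_wrt (<)\<close> gives
  indiscernible sequences and \<open>distinct\<close> gives indiscernible sets, so that both are
  treated by the same lemmas.\<close>

definition indis :: "(nat list \<Rightarrow> bool) \<Rightarrow> 'm set \<Rightarrow> (nat \<Rightarrow> 'm list) \<Rightarrow> bool" where
  "indis R X c \<longleftrightarrow> (\<forall>i j. sorts M (c i) = sorts M (c j)) \<and>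
     (\<forall>is js. R is \<and> R js \<and> length is = length js \<longrightarrow>
        eqt X (concat (map c is)) (concat (map c js)))"

lemma indisD: "indis R X c \<Longrightarrow> R is \<Longrightarrow> R js \<Longrightarrow> length is = length js \<Longrightarrow>
    eqt X (concat (map c is)) (concat (map c js))"
  unfolding indis_def by simp

lemma indis_sorts: "indis R X c \<Longrightarrow> sorts M (c i) = sorts M (c j)"
  unfolding indis_def by blast

lemma sorts_concat_const:
  "(\<And>i j. sorts M (c i) = sorts M (c' j)) \<Longrightarrow> length is = length js \<Longrightarrow>
   sorts M (concat (map c is)) = sorts M (concat (map c' js))"
proof (induction "is" js rule: list_induct2')
  case (4 x xs y ys)
  then show ?case by (simp del: map_concat)
qed auto

lemma indiscernible_seq_iff: "indiscernible_seq L M X c \<longleftrightarrow> indis (sorted_wrt (<)) X c"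
  unfolding indiscernible_seq_def indis_def eqt_def using sorts_concat_const[of c c] by blast

lemma indiscernible_set_iff: "indiscernible_set L M X c \<longleftrightarrow> indis distinct X c"
  unfolding indiscernible_set_def indis_def eqt_def using sorts_concat_const[of c c] by blast

lemma indis_mono: "indis R Y c \<Longrightarrow> X \<subseteq> Y \<Longrightarrow> indis R X c"
  unfolding indis_def by (meson eqt_mono)

lemma indis_eqf:
  assumes "small X" "indis R X c" "\<And>is. sorted_wrt (<) is \<Longrightarrow> R is \<and> R (map f is)"
  shows "eqf X UNIV c (c \<circ> f)"
  unfolding eqf_def
proof (intro conjI ballI allI impI)
  show s: "sorts M (c v) = sorts M ((c \<circ> f) v)" for v using assms(2) by (simp add: indis_def)
  fix vs :: "nat list"
  let ?is = "sorted_list_of_set (set vs)"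
  have "R ?is" "R (map f ?is)" using assms(3)[of ?is] by simp_all
  then have "eqt X (concat (map c ?is)) (concat (map c (map f ?is)))"
    by (intro indisD[OF assms(2)]) simp_all
  then have "eqt X (concat (map c ?is)) (concat (map (c \<circ> f) ?is))" by (simp only: map_map)
  then have "eqf X (set ?is) c (c \<circ> f)" using s by (intro eqf_finite[OF assms(1)]) simp_all
  then show "eqt X (concat (map c vs)) (concat (map (c \<circ> f) vs))" unfolding eqf_def by simp
qed

lemma indis_Aut:
  assumes "small X" "indis R X c" "\<And>is. sorted_wrt (<) is \<Longrightarrow> R is \<and> R (map f is)"
  shows "\<exists>h\<in>Aut X. \<forall>i. map h (c i) = c (f i)"
  using eqf_Aut[OF assms(1) small_nat indis_eqf[OF assms]] by simp

lemma sorted_wrt_map_strict_mono: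
  "strict_mono f \<Longrightarrow> sorted_wrt (<) is \<Longrightarrow> sorted_wrt (<) (map f is :: nat list)" for f :: "nat \<Rightarrow> nat"
  by (simp add: sorted_wrt_map strict_mono_less)

lemma indis_seq_Aut:
  assumes "small X" "indis (sorted_wrt (<)) X c" "strict_mono f"
  shows "\<exists>h\<in>Aut X. \<forall>i. map h (c i) = c (f i)"
  by (rule indis_Aut[OF assms(1,2)]) (simp add: sorted_wrt_map_strict_mono[OF assms(3)])

text \<open>If \<open>g\<close> over \<open>X\<close> carries one subtuple to another, its conjugate
  by \<open>h\<close> does the same for the images over \<open>X'\<close>.\<close>

lemma indis_map_Aut:
  assumes "h \<in> Aut A" "small A" "A \<subseteq> X" "h ` X = X'" "indis R X c" "small X"
  shows "indis R X' (\<lambda>i. map h (c i))"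
  unfolding indis_def
proof (intro conjI allI impI)
  have so: "sorts M (c i) = sorts M (c j)" for i j using assms(5) by (simp add: indis_def)
  then show "sorts M (map h (c i)) = sorts M (map h (c j))" for i j
    by (simp only: sorts_map_Aut[OF assms(1)])
  fix "is" js assume "R is \<and> R js \<and> length is = length js"
  then have "eqt X (concat (map c is)) (concat (map c js))" using assms(5) unfolding indis_def by blast
  from eqt_Aut[OF assms(6) this] obtain g where
    g: "g \<in> Aut X" "map g (concat (map c is)) = concat (map c js)" by blast
  let ?k = "h \<circ> g \<circ> inv h"
  have "automorphism L M ?k"
    using Aut_comp[OF Aut_comp[of h "{}" g] Aut_inv[of h "{}"]] assms(1) g(1) by (auto simp: Aut_def)
  moreover have "\<forall>x\<in>X'. ?k x = x"
    using g(1) assms(1,4) by (auto simp: Aut_def automorphism_def bij_is_inj)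
  ultimately have k: "?k \<in> Aut X'" by (simp add: Aut_def)
  have ih: "inv h \<circ> h = id" using assms(1) by (simp add: Aut_def automorphism_def bij_is_inj)
  have c: "concat (map (\<lambda>i. map h (c i)) xs) = map h (concat (map c xs))" for xs
    by (simp add: map_concat o_def)
  have "map ?k (map h (concat (map c is))) = map h (map g (map (inv h \<circ> h) (concat (map c is))))"
    by (simp only: map_map o_assoc)
  also have "\<dots> = map h (concat (map c js))" by (simp only: ih list.map_id g(2))
  finally show "eqt X' (concat (map (\<lambda>i. map h (c i)) is)) (concat (map (\<lambda>i. map h (c i)) js))"
    unfolding c using Aut_eqt[OF k, of "map h (concat (map c is))"] by (simp only:)
qed

subsection \<open>Dependence and extraction of indiscernibles\<close>

text \<open>The form in which dependence is applied throughout: by compactness, cutting out all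
  subsets of all initial segments already gives parameters for every subset of the natural numbers,
  which is the independence property.\<close>

lemma not_shattering:
  assumes "wf_fm L (wx @ wy) \<phi>" "\<And>i :: nat. sorts M (a i) = wx"
    and sh: "\<And>n S. S \<subseteq> {..<n} \<Longrightarrow> \<exists>b. sorts M b = wy \<and> (\<forall>i<n. sat M \<phi> (a i @ b) \<longleftrightarrow> i \<in> S)"
  shows False
proof -
  \<comment> \<open>Here the sought tuple must occupy the leading variables, as
    \<open>realized\<close> looks for it there; \<open>\<psi>\<close> is \<open>\<phi>\<close> with
    the two blocks exchanged.\<close>
  obtain \<psi> where \<psi>: "wf_fm L (wy @ wx) \<psi>"
    "\<And>b c. sorts M b = wy \<Longrightarrow> sorts M c = wx \<Longrightarrow> sat M \<psi> (b @ c) = sat M \<phi> (c @ b)"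
  proof -
    have "wf_fm L (concat (map ((!) [wy, wx]) [1, 0])) \<phi>" using assms(1) by simp
    from sel[OF this, of M] obtain \<psi> where \<psi>: "wf_fm L (concat [wy, wx]) \<psi>"
      "\<forall>es. map (sorts M) es = [wy, wx] \<longrightarrow> sat M \<psi> (concat es) = sat M \<phi> (concat (map ((!) es) [1, 0]))"
      by (auto simp del: concat.simps)
    have "sat M \<psi> (b @ c) = sat M \<phi> (c @ b)" if "sorts M b = wy" "sorts M c = wx" for b c
      using \<psi>(2)[rule_format, of "[b, c]"] that by simp
    moreover have "wf_fm L (wy @ wx) \<psi>" using \<psi>(1) by simp
    ultimately show thesis using that by blast
  qed
  have "\<exists>b. sorts M b = wy \<and> (\<forall>i. sat M \<phi> (a i @ b) \<longleftrightarrow> i \<in> S)" for S :: "nat set"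
  proof -
    let ?f = "\<lambda>i. (if i \<in> S then \<psi> else Neg \<psi>, a i)"
    have "consistent M wy (range ?f)"
    proof (rule consistentI)
      fix F assume "F \<subseteq> range ?f" "finite F"
      then obtain J where J: "finite J" "F = ?f ` J" by (meson finite_subset_image)
      obtain n where n: "J \<subseteq> {..<n}" using J(1) finite_nat_bounded by blast
      obtain b where b: "sorts M b = wy" "\<forall>i<n. sat M \<phi> (a i @ b) \<longleftrightarrow> i \<in> S \<inter> {..<n}"
        using sh[of "S \<inter> {..<n}" n] by auto
      have "realizes M wy b F"
        unfolding realizes_def J(2) using b n \<psi>(2)[OF b(1) assms(2)] by auto
      then show "\<exists>a. realizes M wy a F" by (rule exI)
    qed
    moreover have "range ?f \<subseteq> pfms L M wy (\<Union>i. set (a i))"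
      using \<psi>(1) assms(2) by (auto simp: pfms_def)
    ultimately obtain b where b: "realizes M wy b (range ?f)"
      using realized[of "\<Union>i. set (a i)"] small_tuples[OF small_nat] by blast
    have s: "sorts M b = wy" using b by (simp add: realizes_def)
    have "sat M \<phi> (a i @ b) \<longleftrightarrow> i \<in> S" for i
    proof -
      have "sat M (if i \<in> S then \<psi> else Neg \<psi>) (b @ a i)" using b by (auto simp: realizes_def)
      then show ?thesis using \<psi>(2)[OF s assms(2)] by (simp split: if_splits)
    qed
    then show ?thesis using s by blast
  qed
  then have "\<forall>S :: nat set. \<exists>b. sorts M b = wy \<and> (\<forall>i. sat M \<phi> (a i @ b) \<longleftrightarrow> i \<in> S)" by (rule allI)
  then obtain b where "\<forall>S :: nat set. sorts M (b S) = wy \<and> (\<forall>i. sat M \<phi> (a i @ b S) \<longleftrightarrow> i \<in> S)"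
    by (rule choice[THEN exE])
  then have "has_IP M wx wy \<phi>" unfolding has_IP_def
    by (intro exI[of _ a] exI[of _ b]) (simp add: assms(2))
  then show False using dependent assms(1) unfolding dependent_theory_def by simp
qed

text \<open>Ramsey's theorem with two colours, once for each pair of a predicate and a list length;
  a finite set of indices is coloured by the truth value at its increasing enumeration.\<close>

lemma homogeneous_subset:
  assumes "finite D"
  shows "\<exists>H :: nat set. infinite H \<and> (\<forall>x\<in>D. \<forall>is js. sorted_wrt (<) is \<and> sorted_wrt (<) js \<and>
    set is \<subseteq> H \<and> set js \<subseteq> H \<and> length is = snd x \<and> length js = snd x \<longrightarrow> (fst x is \<longleftrightarrow> fst x js))"
  using assms
proof (induction D rule: finite_induct)
  case empty
  then show ?case by (intro exI[of _ UNIV]) auto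
next
  case (insert x D)
  then obtain H where H: "infinite H" "\<forall>x\<in>D. \<forall>is js. sorted_wrt (<) is \<and> sorted_wrt (<) js \<and>
    set is \<subseteq> H \<and> set js \<subseteq> H \<and> length is = snd x \<and> length js = snd x \<longrightarrow> (fst x is \<longleftrightarrow> fst x js)"
    by (elim exE conjE)
  let ?f = "\<lambda>X. if fst x (sorted_list_of_set X) then 1 else 0 :: nat"
  have "\<forall>X. X \<subseteq> H \<and> finite X \<and> card X = snd x \<longrightarrow> ?f X < 2" by simp
  from Ramsey[OF H(1) this] obtain Y t where Y: "Y \<subseteq> H" "infinite Y"
    "\<forall>X. X \<subseteq> Y \<and> finite X \<and> card X = snd x \<longrightarrow> ?f X = t" by (elim exE conjE)
  have f: "?f (set is) = t \<and> sorted_list_of_set (set is) = is"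
    if "sorted_wrt (<) is" "set is \<subseteq> Y" "length is = snd x" for "is"
    using Y(3)[rule_format, of "set is"] that
    by (simp add: strict_sorted_iff distinct_card sorted_list_of_set.idem_if_sorted_distinct)
  have "fst x is \<longleftrightarrow> fst x js" if "sorted_wrt (<) is" "sorted_wrt (<) js"
    "set is \<subseteq> Y" "set js \<subseteq> Y" "length is = snd x" "length js = snd x" for "is" js
    using f[OF that(1,3,5)] f[OF that(2,4,6)] by (auto split: if_splits)
  moreover have "fst z is \<longleftrightarrow> fst z js" if "z \<in> D" "sorted_wrt (<) is" "sorted_wrt (<) js"
    "set is \<subseteq> Y" "set js \<subseteq> Y" "length is = snd z" "length js = snd z" for z "is" js
    using H(2) that Y(1) by (meson subset_trans)
  ultimately show ?case using Y(2) by (intro exI[of _ Y]) blast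
qed

text \<open>\<open>\<Gamma>1\<close> asks for indiscernibility and \<open>\<Gamma>2\<close> for all
  formulas true on every increasing tuple of \<open>u\<close>. Finitely many conditions hold along a
  subsequence of \<open>u\<close> supplied by Ramsey's theorem. The final clause, the contrapositive
  of \<open>\<Gamma>2\<close>, lets properties of \<open>u\<close> be pulled back from the new
  sequence.\<close>

lemma extract_indiscernible:
  assumes X: "small X" and s: "\<And>i :: nat. sorts M (u i) = w"
  shows "\<exists>u'. indis (sorted_wrt (<)) X u' \<and> (\<forall>i. sorts M (u' i) = w) \<and>
    (\<forall>is \<phi> c. sorted_wrt (<) is \<and> set c \<subseteq> X \<and> wf_fm L (sorts M (concat (map u' is)) @ sorts M c) \<phi> \<and>
       sat M \<phi> (concat (map u' is) @ c) \<longrightarrow>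
       (\<exists>js. sorted_wrt (<) js \<and> length js = length is \<and> sat M \<phi> (concat (map u js) @ c)))"
proof -
  define S where "S = (\<lambda>_::nat. w)"
  define ok where "ok is c \<phi> \<longleftrightarrow> sorted_wrt (<) is \<and> set c \<subseteq> X \<and>
    wf_fm L (concat (map S is) @ sorts M c) \<phi>" for "is" c \<phi>
  define P where "P is c \<phi> E \<longleftrightarrow> sat M \<phi> (concat (map E is) @ c)"
    for "is" c \<phi> and E :: "nat \<Rightarrow> 'm list"
  define \<Gamma>1 where "\<Gamma>1 = {\<lambda>E. P is c \<phi> E \<longleftrightarrow> P js c \<phi> E | is js c \<phi>.
    ok is c \<phi> \<and> ok js c \<phi> \<and> length is = length js}"
  define \<Gamma>2 where "\<Gamma>2 = {P is c \<phi> | is c \<phi>. ok is c \<phi> \<and>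
    (\<forall>js. sorted_wrt (<) js \<and> length js = length is \<longrightarrow> P js c \<phi> u)}"
  have dP: "definable S UNIV X (P is c \<phi>)" if "ok is c \<phi>" for "is" c \<phi>
    unfolding P_def using that by (intro definable_sat) (auto simp: ok_def)
  have "\<exists>E. fam S E \<and> (\<forall>Q\<in>\<Gamma>1 \<union> \<Gamma>2. Q E)"
  proof (rule compactness[OF small_nat X])
    show "definable S UNIV X Q" if "Q \<in> \<Gamma>1 \<union> \<Gamma>2" for Q
      using that unfolding \<Gamma>1_def \<Gamma>2_def by (auto intro!: definable_iff dP)
    fix F assume F: "F \<subseteq> \<Gamma>1 \<union> \<Gamma>2" "finite F"
    \<comment> \<open>For each indiscernibility condition, \<open>t\<close> records the predicate on
      index lists and the length to which \<open>homogeneous_subset\<close> is applied.\<close>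
    have "\<forall>Q\<in>F \<inter> \<Gamma>1. \<exists>t. \<exists>is js c \<phi>. Q = (\<lambda>E. P is c \<phi> E \<longleftrightarrow> P js c \<phi> E) \<and>
       ok is c \<phi> \<and> ok js c \<phi> \<and> length is = length js \<and> t = ((\<lambda>is. P is c \<phi> u), length is)"
      unfolding \<Gamma>1_def by blast
    then obtain t where t: "\<forall>Q\<in>F \<inter> \<Gamma>1. \<exists>is js c \<phi>. Q = (\<lambda>E. P is c \<phi> E \<longleftrightarrow> P js c \<phi> E) \<and>
       ok is c \<phi> \<and> ok js c \<phi> \<and> length is = length js \<and> t Q = ((\<lambda>is. P is c \<phi> u), length is)"
      by (rule bchoice[THEN exE])
    have "finite (t ` (F \<inter> \<Gamma>1))" using F(2) by simp
    from homogeneous_subset[OF this] obtain H where H: "infinite H"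
      "\<forall>x\<in>t ` (F \<inter> \<Gamma>1). \<forall>is js. sorted_wrt (<) is \<and> sorted_wrt (<) js \<and>
        set is \<subseteq> H \<and> set js \<subseteq> H \<and> length is = snd x \<and> length js = snd x \<longrightarrow> (fst x is \<longleftrightarrow> fst x js)"
      by (elim exE conjE)
    let ?g = "enumerate H"
    have g: "strict_mono ?g" using H(1) by (rule strict_mono_enumerate)
    have P: "P is c \<phi> (u \<circ> ?g) = P (map ?g is) c \<phi> u" for "is" c \<phi>
      by (simp add: P_def)
    have gs: "sorted_wrt (<) (map ?g is)" "set (map ?g is) \<subseteq> H" if "sorted_wrt (<) is" for "is"
      using sorted_wrt_map_strict_mono[OF g that] enumerate_in_set[OF H(1)] by auto
    have "Q (u \<circ> ?g)" if "Q \<in> F" for Q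
    proof (cases "Q \<in> \<Gamma>1")
      case True
      have "Q \<in> F \<inter> \<Gamma>1" using True that by simp
      from bspec[OF t this] obtain "is" js c \<phi> where *: "Q = (\<lambda>E. P is c \<phi> E \<longleftrightarrow> P js c \<phi> E)"
        "ok is c \<phi>" "ok js c \<phi>" "length is = length js" "t Q = ((\<lambda>is. P is c \<phi> u), length is)"
        by (elim exE conjE)
      have "t Q \<in> t ` (F \<inter> \<Gamma>1)" using True that by simp
      from bspec[OF H(2) this] have "P (map ?g is) c \<phi> u = P (map ?g js) c \<phi> u"
        using gs[of "is"] gs[of js] *(2,3,4) unfolding *(5) ok_def by simp
      then show ?thesis unfolding *(1) P .
    next
      case False
      then have "Q \<in> \<Gamma>2" using that F(1) by blast
      then obtain "is" c \<phi> where *: "Q = P is c \<phi>" "ok is c \<phi>"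
        "\<forall>js. sorted_wrt (<) js \<and> length js = length is \<longrightarrow> P js c \<phi> u"
        unfolding \<Gamma>2_def by blast
      then show ?thesis unfolding *(1) P using gs(1)[of "is"] by (simp add: ok_def)
    qed
    moreover have "fam S (u \<circ> ?g)" using s by (simp add: fam_def S_def)
    ultimately show "\<exists>E. fam S E \<and> (\<forall>Q\<in>F. Q E)"
      by (intro exI[of _ "u \<circ> ?g"] conjI ballI)
  qed
  then obtain u' where u': "fam S u'" "\<forall>Q\<in>\<Gamma>1 \<union> \<Gamma>2. Q u'" by (elim exE conjE)
  have su': "sorts M (u' i) = w" for i using u'(1) by (simp add: fam_def S_def)
  have sc: "sorts M (concat (map u' is)) = concat (map S is)" for "is"
    by (simp add: map_concat o_def su' S_def)
  have P1: "P is c \<phi> u' \<longleftrightarrow> P js c \<phi> u'" if "ok is c \<phi>" "ok js c \<phi>" "length is = length js" for "is" js c \<phi>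
  proof -
    have "(\<lambda>E. P is c \<phi> E \<longleftrightarrow> P js c \<phi> E) \<in> \<Gamma>1 \<union> \<Gamma>2" using that unfolding \<Gamma>1_def by blast
    from bspec[OF u'(2) this] show ?thesis .
  qed
  have SS: "concat (map S is) = concat (map S js)" if "length is = length js" for "is" js :: "nat list"
    using that by (simp add: S_def map_replicate_const)
  have "indis (sorted_wrt (<)) X u'"
    unfolding indis_def
  proof (intro conjI allI impI)
    show "sorts M (u' i) = sorts M (u' j)" for i j by (simp add: su')
    fix "is" js :: "nat list" assume *: "sorted_wrt (<) is \<and> sorted_wrt (<) js \<and> length is = length js"
    show "eqt X (concat (map u' is)) (concat (map u' js))"
      unfolding eqt_iff sc
    proof (intro conjI allI impI)
      show S: "concat (map S is) = concat (map S js)" using * SS by blast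
      fix \<phi> c assume "set c \<subseteq> X" "wf_fm L (concat (map S is) @ sorts M c) \<phi>"
      then show "sat M \<phi> (concat (map u' is) @ c) = sat M \<phi> (concat (map u' js) @ c)"
        using P1[of "is" c \<phi> js] * S by (simp add: ok_def P_def)
    qed
  qed
  moreover have "\<exists>js. sorted_wrt (<) js \<and> length js = length is \<and> sat M \<phi> (concat (map u js) @ c)"
    if *: "sorted_wrt (<) is" "set c \<subseteq> X" "wf_fm L (sorts M (concat (map u' is)) @ sorts M c) \<phi>"
      "sat M \<phi> (concat (map u' is) @ c)" for "is" \<phi> c
  proof (rule ccontr)
    assume n: "\<not> ?thesis"
    have "ok is c (Neg \<phi>)" using * unfolding ok_def sc by simp
    moreover have "P js c (Neg \<phi>) u" if "sorted_wrt (<) js" "length js = length is" for js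
      using n that by (simp add: P_def)
    ultimately have "P is c (Neg \<phi>) \<in> \<Gamma>1 \<union> \<Gamma>2" unfolding \<Gamma>2_def by blast
    from bspec[OF u'(2) this] show False using *(4) by (simp add: P_def)
  qed
  ultimately show ?thesis using su' by (intro exI[of _ u'] conjI allI impI) simp_all
qed

subsection \<open>Forking\<close>

lemma sat_Aut_app:
  assumes "h \<in> Aut X" "wf_fm L (sorts M a @ sorts M c) \<phi>"
  shows "sat M \<phi> (map h a @ map h c) = sat M \<phi> (a @ c)"
  using sat_Aut[OF assms(1), of "a @ c" \<phi>] assms(2) by simp

lemma inconsistent_Aut:
  assumes h: "h \<in> Aut A" and wf: "\<And>i. wf_fm L (w @ sorts M (cs i)) \<phi>"
    and c: "consistent M w (range (\<lambda>i. (\<phi>, map h (cs i))))"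
  shows "consistent M w (range (\<lambda>i. (\<phi>, cs i)))"
proof (rule consistentI)
  fix F assume "F \<subseteq> range (\<lambda>i. (\<phi>, cs i))" "finite F"
  then obtain J where J: "finite J" "F = (\<lambda>i. (\<phi>, cs i)) ` J" by (meson finite_subset_image)
  have "\<exists>a. realizes M w a ((\<lambda>i. (\<phi>, map h (cs i))) ` J)"
    using c by (rule consistentD) (use J(1) in auto)
  then obtain a where a: "sorts M a = w" "\<And>i. i \<in> J \<Longrightarrow> sat M \<phi> (a @ map h (cs i))"
    by (auto simp: realizes_def)
  have s: "sorts M (map (inv h) a) = w" unfolding sorts_map_Aut[OF Aut_inv[OF h]] by (rule a(1))
  have "sat M \<phi> (map (inv h) a @ cs i)" if "i \<in> J" for i
    using sat_Aut_app[OF Aut_inv[OF h], of a "map h (cs i)" \<phi>] a(2)[OF that] a(1) wf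
    unfolding Aut_inv_map[OF h] sorts_map_Aut[OF h] by simp
  then have "realizes M w (map (inv h) a) F" using s unfolding realizes_def J(2) by auto
  then show "\<exists>a. realizes M w a F" by (rule exI)
qed

lemma divides_Aut:
  assumes h: "h \<in> Aut A" and wf: "wf_fm L (w @ sorts M c) \<phi>" and d: "divides L M A w (\<phi>, c)"
  shows "divides L M A w (\<phi>, map h c)"
proof -
  from d obtain cs where cs: "indis (sorted_wrt (<)) A cs" "cs 0 = c"
    "\<not> consistent M w (range (\<lambda>i. (\<phi>, cs i)))"
    unfolding divides.simps indiscernible_seq_iff by (elim exE conjE)
  have wf': "wf_fm L (w @ sorts M (cs i)) \<phi>" for i using wf indis_sorts[OF cs(1), of i 0] cs(2) by simp
  have "indis (sorted_wrt (<)) A (\<lambda>i. map h (cs i))"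
    unfolding indis_def
  proof (intro conjI allI impI)
    show "sorts M (map h (cs i)) = sorts M (map h (cs j))" for i j
      unfolding sorts_map_Aut[OF h] by (rule indis_sorts[OF cs(1)])
    fix "is" js :: "nat list" assume *: "sorted_wrt (<) is \<and> sorted_wrt (<) js \<and> length is = length js"
    have c: "concat (map (\<lambda>i. map h (cs i)) xs) = map h (concat (map cs xs))" for xs
      by (simp add: map_concat o_def)
    have "eqt A (concat (map cs is)) (concat (map cs js))" using * by (intro indisD[OF cs(1)]) auto
    then show "eqt A (concat (map (\<lambda>i. map h (cs i)) is)) (concat (map (\<lambda>i. map h (cs i)) js))"
      unfolding c using Aut_eqt[OF h] eqt_sym eqt_trans by meson
  qed
  moreover have "\<not> consistent M w (range (\<lambda>i. (\<phi>, map h (cs i))))"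
    using inconsistent_Aut[OF h, of w cs \<phi>, OF wf'] cs(3) by blast
  ultimately show ?thesis unfolding divides.simps indiscernible_seq_iff
    using cs(2) by (intro exI[of _ "\<lambda>i. map h (cs i)"]) simp
qed

lemma forks_Aut:
  assumes h: "h \<in> Aut A" and wf: "wf_fm L (w @ sorts M c) \<phi>" and f: "forks L M A w (\<phi>, c)"
  shows "forks L M A w (\<phi>, map h c)"
proof -
  from f obtain D where D: "finite D" "D \<subseteq> pfms L M w UNIV" "\<forall>d\<in>D. divides L M A w d"
    "\<forall>a. sorts M a = w \<and> sat M \<phi> (a @ c) \<longrightarrow> (\<exists>(\<psi>, d)\<in>D. sat M \<psi> (a @ d))"
    unfolding forks.simps by (elim exE conjE)
  let ?D = "(\<lambda>(\<psi>, d). (\<psi>, map h d)) ` D"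
  have wfD: "wf_fm L (w @ sorts M d) \<psi>" if "(\<psi>, d) \<in> D" for \<psi> d
    using D(2) that by (auto simp: pfms_def)
  have "?D \<subseteq> pfms L M w UNIV"
    using wfD unfolding pfms_def by (auto simp del: map_map simp: sorts_map_Aut[OF h])
  moreover have "\<forall>d\<in>?D. divides L M A w d"
  proof
    fix x assume "x \<in> ?D"
    then obtain \<psi> d where x: "(\<psi>, d) \<in> D" "x = (\<psi>, map h d)" by auto
    show "divides L M A w x" unfolding x(2) using D(3) x(1) by (intro divides_Aut[OF h wfD]) auto
  qed
  moreover have "\<exists>(\<psi>, d)\<in>?D. sat M \<psi> (a @ d)" if a: "sorts M a = w" "sat M \<phi> (a @ map h c)" for a
  proof -
    let ?a = "map (inv h) a"
    have s: "sorts M ?a = w" unfolding sorts_map_Aut[OF Aut_inv[OF h]] by (rule a(1))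
    have "wf_fm L (sorts M a @ sorts M (map h c)) \<phi>" unfolding sorts_map_Aut[OF h] using wf a(1) by simp
    from sat_Aut_app[OF Aut_inv[OF h] this] have "sat M \<phi> (?a @ c)"
      using a(2) Aut_inv_map[OF h] by simp
    from D(4)[rule_format, OF conjI[OF s this]]
    have "\<exists>x\<in>D. sat M (fst x) (?a @ snd x)" by (simp add: split_beta)
    then obtain x where x: "x \<in> D" "sat M (fst x) (?a @ snd x)" by (elim bexE)
    have "wf_fm L (sorts M a @ sorts M (map h (snd x))) (fst x)"
      unfolding sorts_map_Aut[OF h] using wfD[of "fst x" "snd x"] x(1) a(1) by simp
    from sat_Aut_app[OF Aut_inv[OF h] this] have "sat M (fst x) (a @ map h (snd x))"
      using x(2) Aut_inv_map[OF h] by simp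
    then show ?thesis using x(1) by (intro bexI[of _ "(fst x, map h (snd x))"]) force+
  qed
  ultimately show ?thesis unfolding forks.simps using D(1)
    by (intro exI[of _ ?D] conjI allI impI) auto
qed

lemma divides_forks:
  assumes "divides L M A w (\<phi>, c)" "wf_fm L (w @ sorts M c) \<phi>"
  shows "forks L M A w (\<phi>, c)"
  unfolding forks.simps using assms by (intro exI[of _ "{(\<phi>, c)}"]) (simp add: pfms_def)

definition nf :: "'m set \<Rightarrow> 'm list \<Rightarrow> 'm set \<Rightarrow> bool" where
  "nf A a E \<longleftrightarrow> \<not> type_forks L M A (sorts M a) (tp L M a E)"

lemma nf_iff: "nf A a E \<longleftrightarrow> (\<forall>\<phi> c. set c \<subseteq> E \<and> wf_fm L (sorts M a @ sorts M c) \<phi> \<and> sat M \<phi> (a @ c) \<longrightarrow>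
    \<not> forks L M A (sorts M a) (\<phi>, c))"
  unfolding nf_def type_forks_def tp_def pfms_def by (auto simp del: forks.simps)

lemma nfD: "nf A a E \<Longrightarrow> set c \<subseteq> E \<Longrightarrow> wf_fm L (sorts M a @ sorts M c) \<phi> \<Longrightarrow> sat M \<phi> (a @ c) \<Longrightarrow>
    \<not> forks L M A (sorts M a) (\<phi>, c)"
  unfolding nf_iff by blast

lemma nf_mono: "nf A a E \<Longrightarrow> E' \<subseteq> E \<Longrightarrow> nf A a E'"
  unfolding nf_iff by (meson subset_trans)

lemma nf_Aut:
  assumes h: "h \<in> Aut A" and n: "nf A a E"
  shows "nf A (map h a) (h ` E)"
  unfolding nf_iff
proof (intro allI impI, elim conjE)
  fix \<phi> c assume c: "set c \<subseteq> h ` E" "wf_fm L (sorts M (map h a) @ sorts M c) \<phi>" "sat M \<phi> (map h a @ c)"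
  let ?c = "map (inv h) c"
  have ih: "inv h (h x) = x" "h (inv h x) = x" for x
    using h by (simp_all add: Aut_def automorphism_def bij_is_inj bij_is_surj surj_f_inv_f)
  have c': "map h ?c = c" by (simp add: ih o_def)
  have cE: "set ?c \<subseteq> E" using c(1) by (auto simp: ih)
  have wf: "wf_fm L (sorts M a @ sorts M ?c) \<phi>"
    using c(2) unfolding sorts_map_Aut[OF h] sorts_map_Aut[OF Aut_inv[OF h]] .
  have "sat M \<phi> (a @ ?c)" using sat_Aut_app[OF h wf] c(3) unfolding c' by simp
  from nfD[OF n cE wf this] have nfk: "\<not> forks L M A (sorts M a) (\<phi>, ?c)" .
  show "\<not> forks L M A (sorts M (map h a)) (\<phi>, c)"
  proof
    assume "forks L M A (sorts M (map h a)) (\<phi>, c)"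
    then have "forks L M A (sorts M a) (\<phi>, c)" unfolding sorts_map_Aut[OF h] .
    moreover have "wf_fm L (sorts M a @ sorts M c) \<phi>" using c(2) unfolding sorts_map_Aut[OF h] .
    ultimately have "forks L M A (sorts M a) (\<phi>, ?c)" by (intro forks_Aut[OF Aut_inv[OF h]])
    then show False using nfk by contradiction
  qed
qed

lemma forks_mono:
  assumes "forks L M A w (\<phi>, c)" "\<And>a. sorts M a = w \<Longrightarrow> sat M \<psi> (a @ d) \<Longrightarrow> sat M \<phi> (a @ c)"
  shows "forks L M A w (\<psi>, d)"
  using assms(1) unfolding forks.simps by (elim exE conjE) (use assms(2) in blast)

lemma finite_conjunction:
  assumes "finite \<Sigma>" "\<Sigma> \<subseteq> pfms L M w E"
  shows "\<exists>\<phi> c. set c \<subseteq> E \<and> wf_fm L (w @ sorts M c) \<phi> \<and>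
    (\<forall>a. sorts M a = w \<longrightarrow> (sat M \<phi> (a @ c) \<longleftrightarrow> realizes M w a \<Sigma>))"
proof -
  let ?S = "\<lambda>_::unit. w"
  let ?P = "\<lambda>x E. sat M (fst x) (E () @ snd x)"
  obtain a0 where "sorts M a0 = w"
  proof -
    have "\<forall>t. \<exists>m. srt M m = t" using sort_inhabited by (rule allI)
    then obtain d where d: "\<forall>t. srt M (d t) = t" by (rule choice[THEN exE])
    then have "sorts M (map d w) = w" by (simp add: map_idI)
    then show thesis by (rule that)
  qed
  then have f: "fam ?S (\<lambda>_. a0)" by (simp add: fam_def)
  have "definable ?S UNIV E P" if "P \<in> ?P ` \<Sigma>" for P
    using that assms(2) definable_sat[of "[()]" UNIV _ E ?S] by (force simp: pfms_def)
  then have "definable ?S UNIV E (\<lambda>E. \<forall>P\<in>?P ` \<Sigma>. P E)"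
    using assms(1) by (intro definable_Ball) auto
  \<comment> \<open>With an empty \<open>J\<close> the projection merely rewrites the predicate as
    one formula in which the variable block occurs once, followed by the parameters.\<close>
  from definable_projection[OF this f finite.emptyI, of "()"] obtain \<chi> d where \<chi>: "set d \<subseteq> E"
    "wf_fm L (w @ sorts M d) \<chi>"
    "\<And>x. sorts M x = w \<Longrightarrow> sat M \<chi> (x @ d) \<longleftrightarrow> (\<exists>E. fam ?S E \<and> E () = x \<and> (\<forall>P\<in>?P ` \<Sigma>. P E))"
    by auto
  have "sat M \<chi> (x @ d) \<longleftrightarrow> realizes M w x \<Sigma>" if x: "sorts M x = w" for x
  proof -
    have "fam ?S (\<lambda>_. x)" using x by (simp add: fam_def)
    then have "(\<exists>E. fam ?S E \<and> E () = x \<and> (\<forall>P\<in>?P ` \<Sigma>. P E)) \<longleftrightarrow> (\<forall>P\<in>?P ` \<Sigma>. P (\<lambda>_. x))"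
      by auto
    then show ?thesis unfolding \<chi>(3)[OF x] using x by (auto simp: realizes_def)
  qed
  then show ?thesis using \<chi>(1,2) by (intro exI[of _ \<chi>] exI[of _ d]) simp
qed

text \<open>If the formulas of \<open>\<Sigma>\<close> together with the negations of all forking
  formulas over \<open>F\<close> were inconsistent, a finite conjunction from
  \<open>\<Sigma>\<close> would imply a finite disjunction of forking formulas and so fork itself.
  But it is true of a tuple that is nonforking over a set containing its parameters.\<close>

lemma nf_realization:
  assumes "small E" "small F" "\<Sigma> \<subseteq> pfms L M w E"
    and fin: "\<And>\<Sigma>0. finite \<Sigma>0 \<Longrightarrow> \<Sigma>0 \<subseteq> \<Sigma> \<Longrightarrow> \<exists>b E0. realizes M w b \<Sigma>0 \<and> \<Sigma>0 \<subseteq> pfms L M w E0 \<and> nf A b E0"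
  shows "\<exists>a. realizes M w a \<Sigma> \<and> nf A a F"
proof -
  define \<Theta> where "\<Theta> = {x \<in> pfms L M w F. forks L M A w x}"
  let ?N = "\<lambda>x. (Neg (fst x), snd x)"
  have "consistent M w (\<Sigma> \<union> ?N ` \<Theta>)"
  proof (rule consistentI, rule ccontr)
    fix Z assume Z: "Z \<subseteq> \<Sigma> \<union> ?N ` \<Theta>" "finite Z" and no: "\<nexists>a. realizes M w a Z"
    have "Z - \<Sigma> \<subseteq> ?N ` \<Theta>" "finite (Z - \<Sigma>)" using Z by auto
    then obtain T where T: "T \<subseteq> \<Theta>" "finite T" "Z - \<Sigma> = ?N ` T" by (meson finite_subset_image)
    have "finite (Z \<inter> \<Sigma>)" "Z \<inter> \<Sigma> \<subseteq> \<Sigma>" using Z by auto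
    from fin[OF this] obtain b E0 where b: "realizes M w b (Z \<inter> \<Sigma>)" "Z \<inter> \<Sigma> \<subseteq> pfms L M w E0" "nf A b E0"
      by (elim exE conjE)
    obtain \<phi> c where \<phi>: "set c \<subseteq> E0" "wf_fm L (w @ sorts M c) \<phi>"
      "\<And>a. sorts M a = w \<Longrightarrow> sat M \<phi> (a @ c) \<longleftrightarrow> realizes M w a (Z \<inter> \<Sigma>)"
      using finite_conjunction[OF \<open>finite (Z \<inter> \<Sigma>)\<close> b(2)] by auto
    have "\<forall>x\<in>T. \<exists>D. finite D \<and> D \<subseteq> pfms L M w UNIV \<and> (\<forall>d\<in>D. divides L M A w d) \<and>
        (\<forall>a. sorts M a = w \<and> sat M (fst x) (a @ snd x) \<longrightarrow> (\<exists>y\<in>D. sat M (fst y) (a @ snd y)))"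
    proof
      fix x assume "x \<in> T"
      then have "forks L M A w (fst x, snd x)" using T(1) by (auto simp: \<Theta>_def)
      then show "\<exists>D. finite D \<and> D \<subseteq> pfms L M w UNIV \<and> (\<forall>d\<in>D. divides L M A w d) \<and>
        (\<forall>a. sorts M a = w \<and> sat M (fst x) (a @ snd x) \<longrightarrow> (\<exists>y\<in>D. sat M (fst y) (a @ snd y)))"
        unfolding forks.simps by (simp add: split_beta)
    qed
    then obtain D where D: "\<forall>x\<in>T. finite (D x) \<and> D x \<subseteq> pfms L M w UNIV \<and> (\<forall>d\<in>D x. divides L M A w d) \<and>
        (\<forall>a. sorts M a = w \<and> sat M (fst x) (a @ snd x) \<longrightarrow> (\<exists>y\<in>D x. sat M (fst y) (a @ snd y)))"
      by (rule bchoice[THEN exE])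
    have "forks L M A w (\<phi>, c)"
      unfolding forks.simps
    proof (intro exI[of _ "\<Union>x\<in>T. D x"] conjI allI impI)
      show "finite (\<Union>x\<in>T. D x)" "(\<Union>x\<in>T. D x) \<subseteq> pfms L M w UNIV"
        "\<forall>d\<in>\<Union>x\<in>T. D x. divides L M A w d" using D T(2) by auto
      fix a assume a: "sorts M a = w \<and> sat M \<phi> (a @ c)"
      then have r: "realizes M w a (Z \<inter> \<Sigma>)" using \<phi>(3) by blast
      have "\<exists>x\<in>T. sat M (fst x) (a @ snd x)"
      proof (rule ccontr)
        assume n: "\<not> ?thesis"
        have "sat M (fst y) (a @ snd y)" if y: "y \<in> Z" for y
        proof (cases "y \<in> \<Sigma>")
          case True
          then show ?thesis using r y by (auto simp: realizes_def)
        next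
          case False
          then have "y \<in> ?N ` T" using y T(3) by blast
          then show ?thesis using n by auto
        qed
        then have "realizes M w a Z" using a by (auto simp: realizes_def)
        then show False using no by blast
      qed
      then obtain x where x: "x \<in> T" "sat M (fst x) (a @ snd x)" by (elim bexE)
      then have "\<exists>y\<in>D x. sat M (fst y) (a @ snd y)" using D a by blast
      then show "\<exists>(\<psi>, d)\<in>\<Union>x\<in>T. D x. sat M \<psi> (a @ d)" using x(1) by (auto simp: split_beta)
    qed
    moreover have s: "sorts M b = w" using b(1) by (simp add: realizes_def)
    moreover have "\<not> forks L M A (sorts M b) (\<phi>, c)"
      using \<phi> b s by (intro nfD[OF b(3)]) simp_all
    ultimately show False by simp
  qed
  moreover have "\<Sigma> \<union> ?N ` \<Theta> \<subseteq> pfms L M w (E \<union> F)"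
    using assms(3) by (auto simp: \<Theta>_def pfms_def)
  ultimately obtain a where a: "realizes M w a (\<Sigma> \<union> ?N ` \<Theta>)"
    using realized[of "E \<union> F" "\<Sigma> \<union> ?N ` \<Theta>" w] assms(1,2) by (auto simp: small_Un simp del: Un_subset_iff)
  have s: "sorts M a = w" using a by (simp add: realizes_def)
  have "nf A a F" unfolding nf_iff s
  proof (intro allI impI notI, elim conjE)
    fix \<phi> c assume *: "set c \<subseteq> F" "wf_fm L (w @ sorts M c) \<phi>" "sat M \<phi> (a @ c)" "forks L M A w (\<phi>, c)"
    then have "(\<phi>, c) \<in> \<Theta>" by (simp add: \<Theta>_def pfms_def)
    then have "(Neg \<phi>, c) \<in> \<Sigma> \<union> ?N ` \<Theta>" by force
    then have "case (Neg \<phi>, c) of (\<phi>, c) \<Rightarrow> sat M \<phi> (a @ c)"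
      by (rule bspec[OF conjunct2[OF a[unfolded realizes_def]]])
    then have "\<not> sat M \<phi> (a @ c)" by simp
    with *(3) show False by contradiction
  qed
  moreover have "realizes M w a \<Sigma>" using a by (rule realizes_mono) simp
  ultimately show ?thesis by blast
qed

lemma nf_extension:
  assumes "nf A b E" "small E" "small F"
  shows "\<exists>a. eqt E b a \<and> nf A a F"
proof -
  have "\<exists>a. realizes M (sorts M b) a (tp L M b E) \<and> nf A a F"
  proof (rule nf_realization[OF assms(2,3)])
    show "tp L M b E \<subseteq> pfms L M (sorts M b) E" by (auto simp: tp_def)
    fix \<Sigma>0 assume "\<Sigma>0 \<subseteq> tp L M b E"
    then show "\<exists>b' E0. realizes M (sorts M b) b' \<Sigma>0 \<and> \<Sigma>0 \<subseteq> pfms L M (sorts M b) E0 \<and> nf A b' E0"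
      using assms(1) by (intro exI[of _ b] exI[of _ E]) (auto simp: tp_def realizes_def)
  qed
  then obtain a where a: "realizes M (sorts M b) a (tp L M b E)" "nf A a F" by (elim exE conjE)
  show ?thesis using realizes_tp[OF a(1) refl] a(2) by (intro exI[of _ a] conjI)
qed

section \<open>Nonforking tuples and indiscernibility\<close>

lemma indis_AutI:
  assumes "\<And>i. R [i]"
    and h: "\<And>is js. R is \<Longrightarrow> R js \<Longrightarrow> length is = length js \<Longrightarrow>
      \<exists>h\<in>Aut X. \<forall>k<length is. map h (c (is ! k)) = c (js ! k)"
  shows "indis R X c"
  unfolding indis_def
proof (intro conjI allI impI)
  show "sorts M (c i) = sorts M (c j)" for i j
  proof -
    have "\<exists>h\<in>Aut X. \<forall>k<length [i]. map h (c ([i] ! k)) = c ([j] ! k)"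
      using assms(1) by (intro h) simp_all
    then obtain h where h: "h \<in> Aut X" "map h (c i) = c j" by auto
    show ?thesis using sorts_map_Aut[OF h(1), of "c i"] unfolding h(2) by (rule sym)
  qed
  fix "is" js assume *: "R is \<and> R js \<and> length is = length js"
  then have "\<exists>h\<in>Aut X. \<forall>k<length is. map h (c (is ! k)) = c (js ! k)" by (intro h) simp_all
  then obtain h where hh: "h \<in> Aut X" "\<forall>k<length is. map h (c (is ! k)) = c (js ! k)" by (elim bexE)
  have "map (map h) (map c is) = map c js"
    using hh(2) * by (intro nth_equalityI) auto
  then have "map h (concat (map c is)) = concat (map c js)" by (metis map_concat)
  then show "eqt X (concat (map c is)) (concat (map c js))"
    using Aut_eqt[OF hh(1), of "concat (map c is)"] by (simp only:)
qed

lemma indis_AutD: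
  assumes "indis R X c" "small X" "R is" "R js" "length is = length js"
  shows "\<exists>h\<in>Aut X. \<forall>k<length is. map h (c (is ! k)) = c (js ! k)"
proof -
  let ?n = "[0..<length is]"
  have m: "map (\<lambda>k. c (is ! k)) ?n = map c is" "map (\<lambda>k. c (js ! k)) ?n = map c js"
    using assms(5) by (auto intro!: nth_equalityI)
  have "eqt X (concat (map (\<lambda>k. c (is ! k)) ?n)) (concat (map (\<lambda>k. c (js ! k)) ?n))"
    unfolding m using assms by (intro indisD[OF assms(1)])
  from eqt_concat_Aut[OF assms(2) this] indis_sorts[OF assms(1)]
  have "\<exists>h\<in>Aut X. \<forall>v\<in>set ?n. map h (c (is ! v)) = c (js ! v)" by blast
  then show ?thesis unfolding set_upt atLeast0LessThan by (simp only: lessThan_iff Ball_def)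
qed

text \<open>
  A formula of \<open>tp(x/Xu)\<close> true at \<open>u\<^sub>0\<close> and false at \<open>u\<^sub>1\<close> does not divide, so along the consecutive pairs of
  \<open>u\<close> it is realized by a single tuple; by indiscernibility, infinite alternation is the independence property.
\<close>

lemma nf_alternation:
  assumes "A \<subseteq> X" "small X" "indis (sorted_wrt (<)) X u" "nf A x (X \<union> (\<Union>i. set (u i)))"
    and c: "set c \<subseteq> X" and wf: "wf_fm L (sorts M x @ sorts M (u 0) @ sorts M c) \<phi>"
    and "sat M \<phi> (x @ u 0 @ c)"
  shows "sat M \<phi> (x @ u 1 @ c)"
proof (rule ccontr)
  assume n: "\<not> ?thesis"
  let ?x = "sorts M x" and ?u = "sorts M (u 0)" and ?c = "sorts M c"
  have su: "sorts M (u i) = ?u" for i by (rule indis_sorts[OF assms(3)])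
  obtain \<psi> where \<psi>: "wf_fm L (?x @ ?u @ ?u @ ?c) \<psi>"
    "\<And>x' i j. sorts M x' = ?x \<Longrightarrow>
       sat M \<psi> (x' @ u i @ u j @ c) \<longleftrightarrow> sat M \<phi> (x' @ u i @ c) \<and> \<not> sat M \<phi> (x' @ u j @ c)"
  proof -
    let ?ws = "[?x, ?u, ?u, ?c]"
    obtain \<psi>1 where 1: "wf_fm L (concat ?ws) \<psi>1"
      "\<And>es. map (sorts M) es = ?ws \<Longrightarrow> sat M \<psi>1 (concat es) = sat M \<phi> (concat (map ((!) es) [0, 1, 3]))"
      using sel[of L ?ws "[0,1,3]" \<phi> M] wf by auto
    obtain \<psi>2 where 2: "wf_fm L (concat ?ws) \<psi>2"
      "\<And>es. map (sorts M) es = ?ws \<Longrightarrow> sat M \<psi>2 (concat es) = sat M \<phi> (concat (map ((!) es) [0, 2, 3]))"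
      using sel[of L ?ws "[0,2,3]" \<phi> M] wf by auto
    show thesis
    proof
      show "wf_fm L (?x @ ?u @ ?u @ ?c) (And \<psi>1 (Neg \<psi>2))" using 1(1) 2(1) by simp
      fix x' i j assume x': "sorts M x' = ?x"
      have "map (sorts M) [x', u i, u j, c] = ?ws" using x' su[of i] su[of j] by simp
      from 1(2)[OF this] 2(2)[OF this]
      show "sat M (And \<psi>1 (Neg \<psi>2)) (x' @ u i @ u j @ c) \<longleftrightarrow>
        sat M \<phi> (x' @ u i @ c) \<and> \<not> sat M \<phi> (x' @ u j @ c)" by simp
    qed
  qed
  let ?d = "\<lambda>i. u (2 * i) @ u (2 * i + 1) @ c"
  have sd: "sorts M (?d i) = ?u @ ?u @ ?c" for i using su[of "2*i"] su[of "2*i+1"] by simp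
  have "indis (sorted_wrt (<)) X ?d"
  proof (rule indis_AutI)
    fix "is" js :: "nat list" assume *: "sorted_wrt (<) is" "sorted_wrt (<) js" "length is = length js"
    let ?f = "\<lambda>ks. concat (map (\<lambda>i::nat. [2 * i, 2 * i + 1]) ks)"
    have sf: "sorted_wrt (<) (?f ks)" if "sorted_wrt (<) ks" for ks
      using that by (induction ks) fastforce+
    have lf: "length (?f ks) = 2 * length ks" for ks by (induction ks) auto
    have nf: "?f ks ! (2 * k) = 2 * (ks ! k) \<and> ?f ks ! (2 * k + 1) = 2 * (ks ! k) + 1"
      if "k < length ks" for k ks
      using that by (induction ks arbitrary: k) (auto simp: nth_Cons split: nat.split)
    have "\<exists>h\<in>Aut X. \<forall>k<length (?f is). map h (u (?f is ! k)) = u (?f js ! k)"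
      using * by (intro indis_AutD[OF assms(3,2)] sf) (simp_all only: lf)
    then obtain h where h: "h \<in> Aut X" "\<forall>k<length (?f is). map h (u (?f is ! k)) = u (?f js ! k)"
      by (elim bexE)
    have "map h (?d (is ! k)) = ?d (js ! k)" if k: "k < length is" for k
    proof -
      have k': "k < length js" using k *(3) by simp
      have "map h (u (2 * (is ! k))) = u (2 * (js ! k))"
        using h(2)[rule_format, of "2 * k"] k nf[OF k] nf[OF k'] lf[of "is"] by simp
      moreover have "map h (u (2 * (is ! k) + 1)) = u (2 * (js ! k) + 1)"
        using h(2)[rule_format, of "2 * k + 1"] k nf[OF k] nf[OF k'] lf[of "is"] by simp
      ultimately show ?thesis using Aut_fix[OF h(1) c] by simp
    qed
    then show "\<exists>h\<in>Aut X. \<forall>k<length is. map h (?d (is ! k)) = ?d (js ! k)"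
      using h(1) by (intro bexI[of _ h]) blast
  qed simp
  then have ind: "indis (sorted_wrt (<)) A ?d" using assms(1) by (rule indis_mono)
  have "\<not> forks L M A ?x (\<psi>, ?d 0)"
  proof (rule nfD[OF assms(4)])
    show "set (?d 0) \<subseteq> X \<union> (\<Union>i. set (u i))" using c by auto
    show "wf_fm L (?x @ sorts M (?d 0)) \<psi>" using \<psi>(1) sd[of 0] by simp
    show "sat M \<psi> (x @ ?d 0)" using \<psi>(2)[of x 0 1] assms(7) n by simp
  qed
  then have "\<not> divides L M A ?x (\<psi>, ?d 0)"
    using divides_forks[of A ?x \<psi> "?d 0"] \<psi>(1) unfolding sd[of 0] by blast
  then have "consistent M ?x (range (\<lambda>i. (\<psi>, ?d i)))"
    using ind unfolding divides.simps indiscernible_seq_iff by blast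
  moreover have "range (\<lambda>i. (\<psi>, ?d i)) \<subseteq> pfms L M ?x (\<Union>i. set (?d i))"
  proof (rule image_subsetI)
    fix i
    have "wf_fm L (?x @ sorts M (?d i)) \<psi>" unfolding sd by (rule \<psi>(1))
    moreover have "set (?d i) \<subseteq> (\<Union>i. set (?d i))" by (rule UN_upper) simp
    ultimately show "(\<psi>, ?d i) \<in> pfms L M ?x (\<Union>i. set (?d i))" by (simp only: pfms_def mem_Collect_eq case_prod_conv)
  qed
  ultimately have "\<exists>x'. realizes M ?x x' (range (\<lambda>i. (\<psi>, ?d i)))"
    by (intro realized[OF small_tuples[OF small_nat]])
  then obtain x' where x': "realizes M ?x x' (range (\<lambda>i. (\<psi>, ?d i)))" by (elim exE)
  have sx: "sorts M x' = ?x" using x' by (simp add: realizes_def)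
  have "sat M \<psi> (x' @ ?d i)" for i using x' by (auto simp: realizes_def)
  then have alt: "sat M \<phi> (x' @ u (2 * i) @ c)" "\<not> sat M \<phi> (x' @ u (2 * i + 1) @ c)" for i
    using \<psi>(2)[OF sx, of "2 * i" "2 * i + 1"] by simp_all
  obtain \<phi>' where \<phi>': "wf_fm L (concat [?u, ?x @ ?c]) \<phi>'"
    "\<And>x' i. sorts M x' = ?x \<Longrightarrow> sat M \<phi>' (u i @ x' @ c) \<longleftrightarrow> sat M \<phi> (x' @ u i @ c)"
  proof -
    obtain \<phi>' where 1: "wf_fm L (concat [?u, ?x, ?c]) \<phi>'"
      "\<And>es. map (sorts M) es = [?u, ?x, ?c] \<Longrightarrow>
         sat M \<phi>' (concat es) = sat M \<phi> (concat (map ((!) es) [1, 0, 2]))"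
      using sel[of L "[?u, ?x, ?c]" "[1,0,2]" \<phi> M] wf by auto
    show thesis
    proof
      show "wf_fm L (concat [?u, ?x @ ?c]) \<phi>'" using 1(1) by simp
      fix x' i assume "sorts M x' = ?x"
      then have "map (sorts M) [u i, x', c] = [?u, ?x, ?c]" using su by simp
      from 1(2)[OF this] show "sat M \<phi>' (u i @ x' @ c) \<longleftrightarrow> sat M \<phi> (x' @ u i @ c)" by simp
    qed
  qed
  show False
  proof (rule not_shattering[OF _ su])
    show "wf_fm L (?u @ (?x @ ?c)) \<phi>'" using \<phi>'(1) by simp
    fix n and S :: "nat set" assume "S \<subseteq> {..<n}"
    \<comment> \<open>\<open>\<phi>\<close> is true at the even and false at the odd members; from
      the \<open>i\<close>-th pair \<open>f\<close> picks the one with the truth value that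
      membership of \<open>i\<close> in \<open>S\<close> prescribes.\<close>
    define f where "f i = 2 * i + (if i \<in> S then 0 else 1)" for i
    have "strict_mono f" by (rule strict_monoI) (simp add: f_def)
    from indis_seq_Aut[OF assms(2,3) this] obtain h where h: "h \<in> Aut X" "\<forall>i. map h (u i) = u (f i)"
      by (elim bexE)
    let ?x' = "map (inv h) x'"
    have s: "sorts M ?x' = ?x" unfolding sorts_map_Aut[OF Aut_inv[OF h(1)]] by (rule sx)
    have "sat M \<phi>' (u i @ ?x' @ c) \<longleftrightarrow> i \<in> S" for i
    proof -
      have "map (inv h) (x' @ u (f i) @ c) = ?x' @ u i @ c"
        using Aut_fix[OF Aut_inv[OF h(1)] c] Aut_inv_map[OF h(1), of "u i"] h(2) by simp
      moreover have "wf_fm L (sorts M (x' @ u (f i) @ c)) \<phi>" using wf sx su[of "f i"] by simp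
      ultimately have "sat M \<phi> (?x' @ u i @ c) \<longleftrightarrow> sat M \<phi> (x' @ u (f i) @ c)"
        using sat_Aut[OF Aut_inv[OF h(1)], of "x' @ u (f i) @ c" \<phi>] by simp
      then show ?thesis using \<phi>'(2)[OF s] alt[of i] by (simp add: f_def)
    qed
    moreover have "sorts M (?x' @ c) = ?x @ ?c" using s by simp
    ultimately show "\<exists>b. sorts M b = ?x @ ?c \<and> (\<forall>i<n. sat M \<phi>' (u i @ b) \<longleftrightarrow> i \<in> S)"
      by (intro exI[of _ "?x' @ c"] conjI) auto
  qed
qed

lemma nf_indis_pair:
  assumes "A \<subseteq> X" "small X" "indis (sorted_wrt (<)) X u" "nf A x (X \<union> (\<Union>i. set (u i)))"
  shows "eqt (X \<union> set x) (u 0) (u 1)"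
proof (subst eqt_Un[OF assms(2)], subst eqt_iff, intro conjI allI impI)
  have "sorts M (u 1) = sorts M (u 0)" by (rule indis_sorts[OF assms(3)])
  then show "sorts M (x @ u 0) = sorts M (x @ u 1)" by simp
  fix \<phi> c assume c: "set c \<subseteq> X" and "wf_fm L (sorts M (x @ u 0) @ sorts M c) \<phi>"
  then have wf: "wf_fm L (sorts M x @ sorts M (u 0) @ sorts M c) \<phi>" by simp
  have "wf_fm L (sorts M x @ sorts M (u 0) @ sorts M c) (Neg \<phi>)" using wf by simp
  from nf_alternation[OF assms c this] have "\<not> sat M \<phi> (x @ u 0 @ c) \<Longrightarrow> \<not> sat M \<phi> (x @ u 1 @ c)"
    by simp
  moreover from nf_alternation[OF assms c wf] have "sat M \<phi> (x @ u 0 @ c) \<Longrightarrow> sat M \<phi> (x @ u 1 @ c)" .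
  ultimately show "sat M \<phi> ((x @ u 0) @ c) = sat M \<phi> ((x @ u 1) @ c)"
    unfolding append_assoc by blast
qed

text \<open>Put a given list first and let blocks of consecutive indices of the same length follow
  far to the right. These blocks form an indiscernible sequence over \<open>X\<close>, so
  \<open>nf_indis_pair\<close> equates the types of the first two over
  \<open>X \<union> set x\<close>. Two lists of equal length are thus both compared with one far
  block. Only block 0 can be unsorted, so sequences and sets are covered together.\<close>

lemma nf_indis:
  assumes R: "R = sorted_wrt (<) \<or> R = distinct"
    and "A \<subseteq> X" "small X" "indis R X u" "nf A x (X \<union> (\<Union>i. set (u i)))"
  shows "indis R (X \<union> set x) u"
proof -
  have key: "eqt (X \<union> set x) (concat (map u is)) (concat (map u [N..<N + length is]))"
    if "R is" "\<forall>i\<in>set is. i < N" for "is" N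
  proof -
    let ?n = "length is"
    \<comment> \<open>Since all entries of \<open>is\<close> are below \<open>N\<close>, the blocks
      are disjoint, and those after block 0 increase when concatenated.\<close>
    define f where "f i = (case i of 0 \<Rightarrow> is | Suc i \<Rightarrow> [N + i * ?n..<N + i * ?n + ?n])" for i
    have lf: "length (f i) = ?n" for i by (simp add: f_def split: nat.split)
    have lower: "N + (m - 1) * ?n \<le> y" if "0 < m" "\<forall>l\<in>set ls. m \<le> l" "y \<in> set (concat (map f ls))" for m ls y
    proof -
      from that(3) obtain l where l: "l \<in> set ls" "y \<in> set (f l)" by auto
      then have "m \<le> l" using that(2) by blast
      then have "0 < l" using that(1) by linarith
      then obtain k where k: "l = Suc k" by (cases l) auto
      then have "N + k * ?n \<le> y" using l(2) by (simp add: f_def)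
      moreover have "(m - 1) * ?n \<le> k * ?n" using k \<open>m \<le> l\<close> by (intro mult_right_mono) auto
      ultimately show ?thesis by linarith
    qed
    have sorted: "sorted_wrt (<) (concat (map f ls))"
      if "sorted_wrt (<) ls" "\<forall>l\<in>set ls. 0 < l" for ls
      using that
    proof (induction ls)
      case (Cons l ls)
      then obtain k where k: "l = Suc k" by (cases l) auto
      have "x < y" if "x \<in> set (f l)" "y \<in> set (concat (map f ls))" for x y
      proof -
        have "x < N + k * ?n + ?n" using that(1) by (simp add: f_def k)
        also have "\<dots> = N + (Suc l - 1) * ?n" by (simp add: k)
        also have "\<dots> \<le> y" by (rule lower[OF _ _ that(2)]) (use Cons.prems in auto)
        finally show ?thesis .
      qed
      moreover have "sorted_wrt (<) (f l)" by (simp add: f_def k)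
      ultimately show ?case using Cons by (simp add: sorted_wrt_append del: set_concat)
    qed simp
    have Rf: "R (concat (map f ls))" if ls: "sorted_wrt (<) ls" for ls
    proof (cases "\<forall>l\<in>set ls. 0 < l")
      case True
      then show ?thesis using sorted[OF ls] R strict_sorted_iff by blast
    next
      case False
      then obtain ms where ms: "ls = 0 # ms" "sorted_wrt (<) ms" "\<forall>l\<in>set ms. 0 < l"
        using ls by (cases ls) auto
      have lt: "i < y" if "i \<in> set is" "y \<in> set (concat (map f ms))" for i y
        using lower[of 1 ms y] that \<open>\<forall>i\<in>set is. i < N\<close> ms(3) by fastforce
      have c: "concat (map f ls) = is @ concat (map f ms)" unfolding ms(1) by (simp add: f_def)
      have s: "sorted_wrt (<) (concat (map f ms))" using ms by (intro sorted)
      from R show ?thesis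
      proof
        assume R: "R = sorted_wrt (<)"
        show ?thesis unfolding c R sorted_wrt_append
          using \<open>R is\<close>[unfolded R] s lt by (intro conjI ballI)
      next
        assume R: "R = distinct"
        have "set is \<inter> set (concat (map f ms)) = {}" using lt by blast
        moreover have "distinct (concat (map f ms))" using s by (simp only: strict_sorted_iff)
        ultimately show ?thesis unfolding c R distinct_append
          using \<open>R is\<close>[unfolded R] by (intro conjI)
      qed
    qed
    let ?v = "\<lambda>i. concat (map u (f i))"
    have cv: "concat (map ?v ls) = concat (map u (concat (map f ls)))" for ls
      by (induction ls) simp_all
    have ll: "length (concat (map f ls)) = ?n * length ls" for ls
      using lf by (induction ls) simp_all
    have "indis (sorted_wrt (<)) X ?v"
      unfolding indis_def cv
    proof (intro conjI allI impI)
      show "sorts M (?v i) = sorts M (?v j)" for i j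
        using indis_sorts[OF assms(4)] lf by (intro sorts_concat_const) simp_all
      fix ls ms :: "nat list"
      assume "sorted_wrt (<) ls \<and> sorted_wrt (<) ms \<and> length ls = length ms"
      then show "eqt X (concat (map u (concat (map f ls)))) (concat (map u (concat (map f ms))))"
        by (intro indisD[OF assms(4)] Rf) (simp_all only: ll)
    qed
    moreover have "nf A x (X \<union> (\<Union>i. set (?v i)))" by (rule nf_mono[OF assms(5)]) auto
    ultimately have "eqt (X \<union> set x) (?v 0) (?v 1)" by (rule nf_indis_pair[OF assms(2,3)])
    then show ?thesis by (simp add: f_def)
  qed
  show ?thesis unfolding indis_def
  proof (intro conjI allI impI)
    show "sorts M (u i) = sorts M (u j)" for i j by (rule indis_sorts[OF assms(4)])
    fix "is" js assume *: "R is \<and> R js \<and> length is = length js"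
    define N where "N = Suc (sum_list is + sum_list js)"
    have "\<forall>i\<in>set is. i < N" "\<forall>i\<in>set js. i < N"
      unfolding N_def by (auto simp: less_Suc_eq_le dest: member_le_sum_list)
    then show "eqt (X \<union> set x) (concat (map u is)) (concat (map u js))"
      using key[of "is" N] key[of js N] * eqt_sym eqt_trans by metis
  qed
qed

subsection \<open>Generically stable sequences\<close>

text \<open>The sequence witnessing generic stability, without its type: the type over
  \<open>A\<close> is that of any member.\<close>

definition gs :: "'m set \<Rightarrow> (nat \<Rightarrow> 'm list) \<Rightarrow> bool" where
  "gs A B \<longleftrightarrow> indis distinct A B \<and> (\<forall>i. nf A (B i) (A \<union> (\<Union>j<i. set (B j))))"

definition avg :: "(nat \<Rightarrow> 'm list) \<Rightarrow> 'm set \<Rightarrow> 'm list \<Rightarrow> bool" where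
  "avg B F x \<longleftrightarrow> sorts M x = sorts M (B 0) \<and>
     (\<forall>\<phi> c. set c \<subseteq> F \<and> wf_fm L (sorts M (B 0) @ sorts M c) \<phi> \<and> sat M \<phi> (x @ c) \<longrightarrow>
       finite {i. \<not> sat M \<phi> (B i @ c)})"

text \<open>
  \<open>avg B F x\<close>: the tuple \<open>x\<close> realizes over \<open>F\<close> the average type of \<open>B\<close>, the formulas true of almost all \<open>B\<^sub>i\<close>.
\<close>

lemma avg_sorts: "avg B F x \<Longrightarrow> sorts M x = sorts M (B 0)"
  unfolding avg_def by (rule conjunct1)

lemma avgD: "avg B F x \<Longrightarrow> set c \<subseteq> F \<Longrightarrow> wf_fm L (sorts M (B 0) @ sorts M c) \<phi> \<Longrightarrow> sat M \<phi> (x @ c) \<Longrightarrow>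
    finite {i. \<not> sat M \<phi> (B i @ c)}"
  unfolding avg_def by blast

lemma avgD_ex:
  assumes "avg B F x" "set c \<subseteq> F" "wf_fm L (sorts M (B 0) @ sorts M c) \<phi>" "sat M \<phi> (x @ c)" "finite J"
  shows "\<exists>i. i \<notin> J \<and> sat M \<phi> (B i @ c)"
proof -
  have "finite ({i. \<not> sat M \<phi> (B i @ c)} \<union> J)" using avgD[OF assms(1-4)] assms(5) by simp
  then obtain i where "i \<notin> {i. \<not> sat M \<phi> (B i @ c)} \<union> J" using ex_new_if_finite[OF infinite_UNIV_nat] by blast
  then show ?thesis by blast
qed

lemma avg_mono: "avg B F x \<Longrightarrow> F' \<subseteq> F \<Longrightarrow> avg B F' x"
  unfolding avg_def by (meson subset_trans)

lemma avg_eqt: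
  assumes "avg B F x" "eqt F x y" shows "avg B F y"
  unfolding avg_def
proof (intro conjI allI impI)
  have s: "sorts M x = sorts M (B 0)" by (rule avg_sorts[OF assms(1)])
  then show "sorts M y = sorts M (B 0)" using eqt_sorts[OF assms(2)] by simp
  fix \<phi> c assume "set c \<subseteq> F \<and> wf_fm L (sorts M (B 0) @ sorts M c) \<phi> \<and> sat M \<phi> (y @ c)"
  then have *: "set c \<subseteq> F" "wf_fm L (sorts M (B 0) @ sorts M c) \<phi>" "sat M \<phi> (y @ c)" by simp_all
  then have "sat M \<phi> (x @ c)" using eqtD[OF assms(2) *(1), of \<phi>] s by simp
  then show "finite {i. \<not> sat M \<phi> (B i @ c)}" by (rule avgD[OF assms(1) *(1,2)])
qed

lemma Aut_fix_tuples:
  assumes "h \<in> Aut Y" "\<And>j. j \<in> J \<Longrightarrow> map h (B j) = B j"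
  shows "h \<in> Aut (Y \<union> (\<Union>j\<in>J. set (B j)))"
proof -
  have "h x = x" if x: "x \<in> set (B j)" "j \<in> J" for x j
  proof -
    have "map h (B j) = map id (B j)" using assms(2)[OF x(2)] by simp
    then show ?thesis using x(1) unfolding map_eq_conv by simp
  qed
  then show ?thesis using assms(1) by (auto simp: Aut_def)
qed

text \<open>With \<open>js\<close> enumerating \<open>J\<close>, an automorphism taking the members
  of \<open>i # js\<close> to those of \<open>m # js\<close> fixes every member in
  \<open>J\<close>.\<close>

lemma indis_distinct_fresh:
  assumes "indis distinct Y B" "small Y" "finite J" "i \<notin> J" "m \<notin> J"
  shows "eqt (Y \<union> (\<Union>j\<in>J. set (B j))) (B i) (B m)"
proof -
  obtain js where js: "set js = J" "distinct js" using finite_distinct_list[OF assms(3)] by blast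
  have "\<exists>h\<in>Aut Y. \<forall>k<length (i # js). map h (B ((i # js) ! k)) = B ((m # js) ! k)"
    using js assms(4,5) by (intro indis_AutD[OF assms(1,2)]) simp_all
  then obtain h where h: "h \<in> Aut Y" "\<forall>k<length (i # js). map h (B ((i # js) ! k)) = B ((m # js) ! k)"
    by (elim bexE)
  have him: "map h (B i) = B m" using h(2)[rule_format, of 0] by simp
  have "map h (B j) = B j" if "j \<in> J" for j
  proof -
    obtain k where "k < length js" "js ! k = j" using \<open>j \<in> J\<close> js(1) by (auto simp: in_set_conv_nth)
    then show ?thesis using h(2)[rule_format, of "Suc k"] by simp
  qed
  from Aut_eqt[OF Aut_fix_tuples[of h Y J B, OF h(1) this], of "B i"] show ?thesis unfolding him .
qed

text \<open>A formula with parameters from \<open>Y\<close> and the members in \<open>J\<close> that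
  is true of \<open>x\<close> holds at almost all members, hence at one outside \<open>J\<close>,
  and then at all of those by \<open>indis_distinct_fresh\<close>.\<close>

lemma avg_fresh:
  assumes "indis distinct Y B" "small Y" "finite J" "m \<notin> J" "avg B (Y \<union> (\<Union>i. set (B i))) x"
  shows "eqt (Y \<union> (\<Union>j\<in>J. set (B j))) x (B m)"
  unfolding eqt_iff
proof (intro conjI allI impI)
  have sx: "sorts M x = sorts M (B 0)" by (rule avg_sorts[OF assms(5)])
  then show "sorts M x = sorts M (B m)" using indis_sorts[OF assms(1), of 0 m] by simp
  fix \<phi> c assume c: "set c \<subseteq> Y \<union> (\<Union>j\<in>J. set (B j))" "wf_fm L (sorts M x @ sorts M c) \<phi>"
  have *: "sat M \<psi> (B m @ c)" if wf: "wf_fm L (sorts M x @ sorts M c) \<psi>" and sat: "sat M \<psi> (x @ c)" for \<psi>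
  proof -
    have "set c \<subseteq> Y \<union> (\<Union>i. set (B i))" using c(1) by auto
    moreover have "wf_fm L (sorts M (B 0) @ sorts M c) \<psi>" using wf sx by simp
    ultimately have "\<exists>i. i \<notin> J \<and> sat M \<psi> (B i @ c)" using sat assms(3) by (intro avgD_ex[OF assms(5)])
    then obtain i where i: "i \<notin> J" "sat M \<psi> (B i @ c)" by (elim exE conjE)
    have "wf_fm L (sorts M (B i) @ sorts M c) \<psi>" using wf sx indis_sorts[OF assms(1), of 0 i] by simp
    from eqtD[OF indis_distinct_fresh[OF assms(1,2,3) i(1) assms(4)] c(1) this] i(2) show ?thesis by simp
  qed
  show "sat M \<phi> (x @ c) = sat M \<phi> (B m @ c)" using *[of \<phi>] *[of "Neg \<phi>"] c(2) by auto
qed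

text \<open>Any list of distinct members is brought to a standard position in three moves. The tuple
  \<open>x\<close> being nonforking, \<open>e\<close> is indiscernible over
  \<open>Y \<union> set x\<close>, so the members other than \<open>x\<close> can be moved into
  \<open>e \<circ> g\<close> with \<open>x\<close> fixed. Over them \<open>x\<close> looks like a
  fresh member of \<open>e \<circ> g\<close> and is moved to one. Indiscernibility of
  \<open>e\<close> does the rest. The subfamily \<open>g\<close> is there because repeated use
  prepends to ever longer families while the average remains that of the original one.\<close>

lemma indis_distinct_prepend:
  assumes "small Y" "A \<subseteq> Y" "indis distinct Y e" "nf A x (Y \<union> (\<Union>i. set (e i)))" "inj g"
    and avg: "avg (e \<circ> g) (Y \<union> (\<Union>i. set ((e \<circ> g) i))) x"
  shows "indis distinct Y (case_nat x e)"
proof -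
  let ?e = "case_nat x e"
  let ?B = "e \<circ> g"
  have indx: "indis distinct (Y \<union> set x) e" by (rule nf_indis[OF _ assms(2,1,3,4)]) simp
  have smx: "small (Y \<union> set x)" using assms(1) by (simp add: small_Un small_finite)
  have indB: "indis distinct Y ?B" unfolding indis_def
  proof (intro conjI allI impI)
    show "sorts M (?B i) = sorts M (?B j)" for i j using indis_sorts[OF assms(3)] by simp
    fix "is" js :: "nat list" assume "distinct is \<and> distinct js \<and> length is = length js"
    then have "eqt Y (concat (map e (map g is))) (concat (map e (map g js)))"
      using assms(5) by (intro indisD[OF assms(3)]) (auto simp: distinct_map intro: inj_on_subset)
    then show "eqt Y (concat (map ?B is)) (concat (map ?B js))" by simp
  qed
  have key: "\<exists>h\<in>Aut Y. \<forall>k<length is. map h (?e (is ! k)) = e k" if d: "distinct is" for "is"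
  proof -
    define ks where "ks = filter (\<lambda>i. i \<noteq> 0) is"
    obtain m where m: "m \<notin> set is" using ex_new_if_finite[OF infinite_UNIV_nat finite_set] by blast
    have dk: "distinct (map (\<lambda>i. i - 1) ks)" "distinct (map g ks)"
      using d assms(5) by (auto simp: ks_def distinct_map inj_on_def)
    have "\<exists>h\<in>Aut (Y \<union> set x). \<forall>k<length (map (\<lambda>i. i - 1) ks).
        map h (e (map (\<lambda>i. i - 1) ks ! k)) = e (map g ks ! k)"
      by (rule indis_AutD[OF indx smx dk]) simp
    then obtain h1 where h1: "h1 \<in> Aut (Y \<union> set x)"
      "\<forall>k<length (map (\<lambda>i. i - 1) ks). map h1 (e (map (\<lambda>i. i - 1) ks ! k)) = e (map g ks ! k)"
      by (elim bexE)
    have h1k: "map h1 (?e i) = e (g i)" if i: "i \<in> set ks" for i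
    proof -
      from i obtain k where k: "k < length ks" "ks ! k = i" unfolding in_set_conv_nth by blast
      have "i \<noteq> 0" using i by (simp add: ks_def)
      then obtain i' where "i = Suc i'" by (cases i) auto
      then show ?thesis using h1(2)[rule_format, of k] k by simp
    qed
    have smB: "small (Y \<union> (\<Union>i\<in>set ks. set (?B i)))"
      using assms(1) by (simp add: small_Un small_finite)
    have "m \<notin> set ks" using m by (simp add: ks_def)
    then have "eqt (Y \<union> (\<Union>i\<in>set ks. set (?B i))) x (?B m)"
      by (rule avg_fresh[OF indB assms(1) finite_set _ avg])
    from eqt_Aut[OF smB this] obtain h2 where
      h2: "h2 \<in> Aut (Y \<union> (\<Union>i\<in>set ks. set (?B i)))" "map h2 x = ?B m" by (elim bexE)
    \<comment> \<open>The fresh index \<open>m\<close> stands in for index 0, the place of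
      \<open>x\<close>; as \<open>m\<close> does not occur in \<open>is\<close>, no two entries are
      identified.\<close>
    define r where "r i = (if i = 0 then m else i)" for i :: nat
    have dr: "distinct (map (g \<circ> r) is)"
    proof -
      have "inj_on r (set is)"
      proof (rule inj_onI)
        fix i j assume "i \<in> set is" "j \<in> set is" "r i = r j"
        then show "i = j" using m by (auto simp: r_def split: if_splits)
      qed
      then have "inj_on (g \<circ> r) (set is)" by (rule comp_inj_on) (rule inj_on_subset[OF assms(5) subset_UNIV])
      then show ?thesis unfolding distinct_map using d by (rule conjI[rotated])
    qed
    have "\<exists>h\<in>Aut Y. \<forall>k<length (map (g \<circ> r) is). map h (e (map (g \<circ> r) is ! k)) = e ([0..<length is] ! k)"
      using dr by (intro indis_AutD[OF assms(3,1)]) simp_all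
    then obtain h3 where h3: "h3 \<in> Aut Y"
      "\<forall>k<length (map (g \<circ> r) is). map h3 (e (map (g \<circ> r) is ! k)) = e ([0..<length is] ! k)" by (elim bexE)
    have r: "map h2 (map h1 (?e i)) = e (g (r i))" if i: "i \<in> set is" for i
    proof (cases "i = 0")
      case True
      have "map h1 x = x" by (rule Aut_fix[OF h1(1)]) simp
      then show ?thesis using h2(2) True by (simp add: r_def)
    next
      case False
      then have "i \<in> set ks" using i by (simp add: ks_def)
      then have "set (?B i) \<subseteq> Y \<union> (\<Union>i\<in>set ks. set (?B i))" by blast
      from Aut_fix[OF h2(1) this] show ?thesis using h1k[OF \<open>i \<in> set ks\<close>] False by (simp add: r_def)
    qed
    have "map (h3 \<circ> (h2 \<circ> h1)) (?e (is ! k)) = e k" if k: "k < length is" for k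
    proof -
      have "map h3 (map h2 (map h1 (?e (is ! k)))) = map h3 (e (g (r (is ! k))))" using r k by simp
      also have "\<dots> = e k" using h3(2)[rule_format, of k] k by simp
      finally show ?thesis by simp
    qed
    moreover have "h3 \<circ> (h2 \<circ> h1) \<in> Aut Y"
      by (intro Aut_comp h3(1) Aut_mono[OF h2(1)] Aut_mono[OF h1(1)]) auto
    ultimately show ?thesis by (intro bexI[of _ "h3 \<circ> (h2 \<circ> h1)"]) auto
  qed
  show ?thesis
  proof (rule indis_AutI)
    fix "is" js :: "nat list" assume *: "distinct is" "distinct js" "length is = length js"
    obtain h where h: "h \<in> Aut Y" "\<forall>k<length is. map h (?e (is ! k)) = e k" using key[OF *(1)] by (elim bexE)
    obtain h' where h': "h' \<in> Aut Y" "\<forall>k<length js. map h' (?e (js ! k)) = e k" using key[OF *(2)] by (elim bexE)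
    have "map (inv h' \<circ> h) (?e (is ! k)) = ?e (js ! k)" if k: "k < length is" for k
    proof -
      have "map h (?e (is ! k)) = map h' (?e (js ! k))"
        using h(2)[rule_format, OF k] h'(2)[rule_format, of k] k *(3) by simp
      then have "map (inv h') (map h (?e (is ! k))) = ?e (js ! k)" using Aut_inv_map[OF h'(1)] by simp
      then show ?thesis by simp
    qed
    then show "\<exists>h\<in>Aut Y. \<forall>k<length is. map h (?e (is ! k)) = ?e (js ! k)"
      using Aut_comp[OF Aut_inv[OF h'(1)] h(1)] by (intro bexI[of _ "inv h' \<circ> h"]) blast
  qed simp
qed

lemma finite_support:
  assumes "finite C" "C \<subseteq> A \<union> (\<Union>i. set (B i))"
  shows "\<exists>N :: nat. C \<subseteq> A \<union> (\<Union>i<N. set (B i))"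
  using assms
proof (induction C rule: finite_induct)
  case (insert x C)
  then obtain N where N: "C \<subseteq> A \<union> (\<Union>i<N. set (B i))" by auto
  obtain i where i: "x \<in> A \<or> x \<in> set (B i)" using insert.prems by auto
  have "(\<Union>i<N. set (B i)) \<subseteq> (\<Union>j<max N (Suc i). set (B j))" by force
  moreover have "x \<in> A \<union> (\<Union>j<max N (Suc i). set (B j))" using i by force
  moreover have "C \<subseteq> A \<union> (\<Union>i<max N (Suc i). set (B i))"
    by (rule subset_trans[OF N Un_mono[OF subset_refl calculation(1)]])
  ultimately show ?case by (intro exI[of _ "max N (Suc i)"]) (simp only: insert_subset)
qed simp

text \<open>Finitely many formulas of the average are satisfied by some late \<open>B m\<close>,
  which is nonforking over \<open>A\<close> and its predecessors, and these contain the parameters;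
  so \<open>nf_realization\<close> applies. Over \<open>A\<close> and the row itself the average is
  complete by indiscernibility: beyond the members used as parameters, the truth value of a formula
  is constant.\<close>

lemma average_exists_local:
  assumes "gs A B" "small A" "small F"
  shows "\<exists>x. avg B (A \<union> (\<Union>i. set (B i))) x \<and> nf A x F"
proof -
  let ?E = "A \<union> (\<Union>i. set (B i))" and ?w = "sorts M (B 0)"
  have ind: "indis distinct A B" and nfB: "\<And>i. nf A (B i) (A \<union> (\<Union>j<i. set (B j)))"
    using assms(1) by (simp_all add: gs_def)
  have smE: "small ?E" using assms(2) small_tuples[OF small_nat] by (simp add: small_Un)
  define \<Sigma> where "\<Sigma> = {x \<in> pfms L M ?w ?E. finite {i. \<not> sat M (fst x) (B i @ snd x)}}"
  have "\<exists>x. realizes M ?w x \<Sigma> \<and> nf A x F"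
  proof (rule nf_realization[OF smE assms(3)])
    show "\<Sigma> \<subseteq> pfms L M ?w ?E" by (simp add: \<Sigma>_def)
    fix Z assume Z: "finite Z" "Z \<subseteq> \<Sigma>"
    have "finite (\<Union>x\<in>Z. set (snd x))" using Z(1) by simp
    moreover have "(\<Union>x\<in>Z. set (snd x)) \<subseteq> ?E"
    proof (rule UN_least)
      fix x assume "x \<in> Z"
      then have "x \<in> \<Sigma>" by (rule subsetD[OF Z(2)])
      then have "x \<in> pfms L M ?w ?E" by (simp add: \<Sigma>_def)
      then show "set (snd x) \<subseteq> ?E" by (simp add: pfms_def split_beta)
    qed
    ultimately have "\<exists>N. (\<Union>x\<in>Z. set (snd x)) \<subseteq> A \<union> (\<Union>i<N. set (B i))" by (rule finite_support)
    then obtain N where N: "(\<Union>x\<in>Z. set (snd x)) \<subseteq> A \<union> (\<Union>i<N. set (B i))"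
      by (elim exE)
    have "finite ({..<N} \<union> (\<Union>x\<in>Z. {i. \<not> sat M (fst x) (B i @ snd x)}))"
      using Z by (auto simp: \<Sigma>_def)
    then obtain m where m: "m \<notin> {..<N} \<union> (\<Union>x\<in>Z. {i. \<not> sat M (fst x) (B i @ snd x)})"
      using ex_new_if_finite[OF infinite_UNIV_nat] by blast
    have "realizes M ?w (B m) Z"
      using m indis_sorts[OF ind] unfolding realizes_def by auto
    moreover have "Z \<subseteq> pfms L M ?w (A \<union> (\<Union>i<m. set (B i)))"
    proof
      fix x assume x: "x \<in> Z"
      have "(\<Union>i<N. set (B i)) \<subseteq> (\<Union>i<m. set (B i))" using m by force
      then have "A \<union> (\<Union>i<N. set (B i)) \<subseteq> A \<union> (\<Union>i<m. set (B i))" by (rule Un_mono[OF subset_refl])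
      moreover have "set (snd x) \<subseteq> (\<Union>x\<in>Z. set (snd x))" using x by (rule UN_upper)
      ultimately have "set (snd x) \<subseteq> A \<union> (\<Union>i<m. set (B i))" using N by (meson subset_trans)
      moreover have "x \<in> pfms L M ?w ?E" using subsetD[OF Z(2) x] by (simp add: \<Sigma>_def)
      ultimately show "x \<in> pfms L M ?w (A \<union> (\<Union>i<m. set (B i)))" by (simp add: pfms_def split_beta)
    qed
    ultimately show "\<exists>b E0. realizes M ?w b Z \<and> Z \<subseteq> pfms L M ?w E0 \<and> nf A b E0"
      using nfB by (intro exI conjI)
  qed
  then obtain x where x: "realizes M ?w x \<Sigma>" "nf A x F" by (elim exE conjE)
  have "avg B ?E x" unfolding avg_def
  proof (intro conjI allI impI, goal_cases)
    case 1
    show ?case using x(1) by (simp add: realizes_def)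
  next
    case (2 \<phi> c)
    then have *: "set c \<subseteq> ?E" "wf_fm L (?w @ sorts M c) \<phi>" "sat M \<phi> (x @ c)" by simp_all
    show ?case
    proof (rule ccontr)
      assume inf: "infinite {i. \<not> sat M \<phi> (B i @ c)}"
      obtain N where N: "set c \<subseteq> A \<union> (\<Union>i<N. set (B i))" using finite_support[OF finite_set *(1)] by (elim exE)
      obtain m where m: "m \<notin> {..<N}" "\<not> sat M \<phi> (B m @ c)"
      proof -
        have "infinite ({i. \<not> sat M \<phi> (B i @ c)} - {..<N})" using inf by simp
        then obtain m where "m \<in> {i. \<not> sat M \<phi> (B i @ c)} - {..<N}" using infinite_imp_nonempty by blast
        then show thesis using that by blast
      qed
      have "\<not> sat M \<phi> (B i @ c)" if i: "i \<notin> {..<N}" for i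
      proof -
        have "wf_fm L (sorts M (B i) @ sorts M c) \<phi>" using *(2) indis_sorts[OF ind, of 0 i] by simp
        from eqtD[OF indis_distinct_fresh[OF ind assms(2) finite_lessThan i m(1)] N this] m(2)
        show ?thesis by simp
      qed
      then have "{i. \<not> sat M (Neg \<phi>) (B i @ c)} \<subseteq> {..<N}" by auto
      then have "finite {i. \<not> sat M (Neg \<phi>) (B i @ c)}" using finite_subset by blast
      then have "(Neg \<phi>, c) \<in> \<Sigma>" using *(1,2) by (simp add: \<Sigma>_def pfms_def)
      then have "case (Neg \<phi>, c) of (\<phi>, c) \<Rightarrow> sat M \<phi> (x @ c)"
        by (rule bspec[OF conjunct2[OF x(1)[unfolded realizes_def]]])
      then show False using *(3) by simp
    qed
  qed
  then show ?thesis using x(2) by (intro exI conjI)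
qed

lemma nf_sequence:
  assumes "nf A d E" "small E" "small G"
  shows "\<exists>y :: nat \<Rightarrow> _. \<forall>k. eqt E d (y k) \<and> nf A (y k) (G \<union> (\<Union>j<k. set (y j)))"
proof (rule dependent_wellorder_choice)
  fix r :: "'m list" and f g :: "nat \<Rightarrow> 'm list" and x assume "\<And>y. y < x \<Longrightarrow> f y = g y"
  then have "(\<Union>j<x. set (f j)) = (\<Union>j<x. set (g j))" by simp
  then show "(eqt E d r \<and> nf A r (G \<union> (\<Union>j<x. set (f j)))) = (eqt E d r \<and> nf A r (G \<union> (\<Union>j<x. set (g j))))"
    by (simp only:)
next
  fix x :: nat and f :: "nat \<Rightarrow> 'm list"
  have "small (G \<union> (\<Union>j<x. set (f j)))" using assms(3) by (simp add: small_Un small_finite)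
  then show "\<exists>r. eqt E d r \<and> nf A r (G \<union> (\<Union>j<x. set (f j)))" by (rule nf_extension[OF assms(1,2)])
qed

text \<open>
  A nonforking realization \<open>x\<close> of the average type over \<open>AB\<close> realizes the average type over \<open>F\<close> as well: otherwise
  nonforking copies of \<open>x\<close> placed in front of \<open>B\<close> give an indiscernible set on which a formula over \<open>F\<close> is infinitely
  often true and infinitely often false.
\<close>

lemma average_exists:
  assumes gs: "gs A B" and A: "small A" "A \<subseteq> F" and F: "small F" "(\<Union>i. set (B i)) \<subseteq> F"
  shows "\<exists>x. avg B F x \<and> nf A x F"
proof -
  have ind: "indis distinct A B" using gs by (simp add: gs_def)
  obtain x where x: "avg B (A \<union> (\<Union>i. set (B i))) x" "nf A x F"
    using average_exists_local[OF gs A(1) F(1)] by (elim exE conjE)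
  \<comment> \<open>The \<open>k\<close> copies of \<open>x\<close> occupy the first positions, so
    \<open>B\<close> reappears shifted by \<open>k\<close>.\<close>
  have ex: "\<exists>e. indis distinct A e \<and> (\<forall>i. e (k + i) = B i) \<and> (\<forall>l<k. eqt F x (e l))" for k
  proof (induction k)
    case 0
    show ?case using ind by (intro exI[of _ B]) simp
  next
    case (Suc k)
    then obtain e where e: "indis distinct A e" "\<forall>i. e (k + i) = B i" "\<forall>l<k. eqt F x (e l)"
      by (elim exE conjE)
    have "small (F \<union> (\<Union>i. set (e i)))" using F(1) small_tuples[OF small_nat] by (simp add: small_Un)
    from nf_extension[OF x(2) F(1) this] obtain y where
      y: "eqt F x y" "nf A y (F \<union> (\<Union>i. set (e i)))" by (elim exE conjE)
    have eg: "e \<circ> (\<lambda>i. k + i) = B" using e(2) by (simp add: fun_eq_iff)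
    have "(A \<union> (\<Union>i. set (B i))) \<subseteq> F" using A(2) F(2) by (rule Un_least)
    then have av: "avg B (A \<union> (\<Union>i. set (B i))) y" by (intro avg_eqt[OF x(1)] eqt_mono[OF y(1)])
    have "indis distinct A (case_nat y e)"
    proof (rule indis_distinct_prepend[OF A(1) subset_refl e(1)])
      show "nf A y (A \<union> (\<Union>i. set (e i)))" by (rule nf_mono[OF y(2)]) (rule Un_mono[OF A(2) subset_refl])
      show "inj (\<lambda>i. k + i)" by simp
      show "avg (e \<circ> (\<lambda>i. k + i)) (A \<union> (\<Union>i. set ((e \<circ> (\<lambda>i. k + i)) i))) y" unfolding eg by (rule av)
    qed
    moreover have "\<forall>i. case_nat y e (Suc k + i) = B i" using e(2) by simp
    moreover have "\<forall>l<Suc k. eqt F x (case_nat y e l)" using y(1) e(3) by (auto split: nat.split)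
    ultimately show ?case by (intro exI[of _ "case_nat y e"] conjI)
  qed
  have "avg B F x" unfolding avg_def
  proof (intro conjI allI impI, goal_cases)
    case 1
    show ?case by (rule avg_sorts[OF x(1)])
  next
    case (2 \<phi> c)
    then have c: "set c \<subseteq> F" "wf_fm L (sorts M (B 0) @ sorts M c) \<phi>" "sat M \<phi> (x @ c)" by simp_all
    show ?case
    proof (rule ccontr)
      assume inf: "infinite {i. \<not> sat M \<phi> (B i @ c)}"
      show False
      proof (rule not_shattering[OF c(2), of B])
        show "sorts M (B i) = sorts M (B 0)" for i by (rule indis_sorts[OF ind])
        fix n and S :: "nat set"
        obtain e where e: "indis distinct A e" "\<forall>i. e (n + i) = B i" "\<forall>l<n. eqt F x (e l)"
          using ex[of n] by (elim exE conjE)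
        let ?g = "enumerate {i. \<not> sat M \<phi> (B i @ c)}"
        have g: "\<not> sat M \<phi> (B (?g i) @ c)" for i using enumerate_in_set[OF inf] by simp
        \<comment> \<open>For \<open>l\<close> in \<open>S\<close> a copy of \<open>x\<close> is
          chosen, where the formula is true; otherwise a member of \<open>B\<close> where it is
          false. Moving the chosen members onto the first \<open>n\<close> members of
          \<open>B\<close> turns \<open>c\<close> into a parameter that cuts out exactly
          \<open>S\<close>.\<close>
        define f where "f l = (if l \<in> S then l else n + ?g l)" for l
        have ge: "?g i = ?g j \<longleftrightarrow> i = j" for i j using strict_mono_enumerate[OF inf] strict_mono_eq by blast
        have "distinct (map f [0..<n])"
          unfolding distinct_map by (auto simp: f_def inj_on_def ge)
        moreover have "distinct (map (\<lambda>l. n + l) [0..<n])" by (simp add: distinct_map)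
        ultimately have "\<exists>h\<in>Aut A. \<forall>k<length (map f [0..<n]). map h (e (map f [0..<n] ! k)) = e (map (\<lambda>l. n + l) [0..<n] ! k)"
          by (intro indis_AutD[OF e(1) A(1)]) simp_all
        then obtain h where h: "h \<in> Aut A" "\<forall>k<n. map h (e (f k)) = B k"
          using e(2) by (elim bexE) simp
        have "sat M \<phi> (B l @ map h c) \<longleftrightarrow> l \<in> S" if l: "l < n" for l
        proof -
          have s: "sorts M (e (f l)) = sorts M (B 0)"
            using indis_sorts[OF e(1), of "f l" "n + 0"] e(2)[rule_format, of 0] by simp
          have "sat M \<phi> (map h (e (f l) @ c)) = sat M \<phi> (e (f l) @ c)"
            by (rule sat_Aut[OF h(1)]) (use c(2) s in simp)
          then have 1: "sat M \<phi> (B l @ map h c) = sat M \<phi> (e (f l) @ c)" using h(2) l by simp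
          show ?thesis
          proof (cases "l \<in> S")
            case True
            have "eqt F x (e l)" using e(3) l by blast
            from eqtD[OF this c(1), of \<phi>] have "sat M \<phi> (e l @ c)" using c avg_sorts[OF x(1)] by simp
            then show ?thesis using 1 True by (simp add: f_def)
          next
            case False
            then show ?thesis using 1 g[of l] e(2) by (simp add: f_def)
          qed
        qed
        moreover have "sorts M (map h c) = sorts M c" by (rule sorts_map_Aut[OF h(1)])
        ultimately show "\<exists>b. sorts M b = sorts M c \<and> (\<forall>i<n. sat M \<phi> (B i @ b) \<longleftrightarrow> i \<in> S)"
          by (intro exI[of _ "map h c"] conjI) blast+
      qed
    qed
  qed
  then show ?thesis using x(2) by (intro exI conjI)
qed

section \<open>Forking along generically stable sequences over an extension base\<close>

lemma extension_base_nf: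
  assumes "extension_base L M A" shows "nf A d A"
  using assms tp_complete unfolding extension_base_def nf_def by blast

text \<open>All of \<open>b\<close> is made to occur as one block, separate from the parameters in
  \<open>A\<close>. Replacing \<open>b\<close> by another member of its row is then a replacement of
  that block alone.\<close>

lemma normalize_parameters:
  assumes "set c \<subseteq> A \<union> set b" "wf_fm L (w @ sorts M c) \<phi>"
  shows "\<exists>\<psi> a. set a \<subseteq> A \<and> wf_fm L (w @ sorts M b @ sorts M a) \<psi> \<and>
    (\<forall>x. sorts M x = w \<longrightarrow> sat M \<psi> (x @ b @ a) = sat M \<phi> (x @ c))"
proof -
  let ?a = "filter (\<lambda>x. x \<in> A) c"
  let ?d = "b @ ?a"
  have "\<forall>x\<in>set c. \<exists>j. j < length ?d \<and> ?d ! j = x"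
  proof
    fix x assume "x \<in> set c"
    then have "x \<in> set ?d" using assms(1) by auto
    then show "\<exists>j. j < length ?d \<and> ?d ! j = x" unfolding in_set_conv_nth .
  qed
  then obtain j where j: "\<forall>x\<in>set c. j x < length ?d \<and> ?d ! j x = x" by (rule bchoice[THEN exE])
  then have c: "map ((!) ?d) (map j c) = c" by (simp add: map_idI)
  let ?js = "[0..<length w] @ map (\<lambda>i. length w + i) (map j c)"
  have v: "map ((!) (p @ q)) ?js = p @ map ((!) q) (map j c)" if "length p = length w" for p q :: "'z list"
    using that by (auto intro!: nth_equalityI simp: nth_append)
  have "map ((!) (sorts M ?d)) (map j c) = sorts M (map ((!) ?d) (map j c))"
    using j by (simp only: map_map) (auto simp del: map_append)
  then have "map ((!) (sorts M ?d)) (map j c) = sorts M c" unfolding c .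
  then have "wf_fm L (map ((!) (w @ sorts M ?d)) ?js) \<phi>" using assms(2) unfolding v[OF refl] by (simp only:)
  moreover have "\<forall>j\<in>set ?js. j < length (w @ sorts M ?d)" using j by auto
  ultimately obtain \<psi> where \<psi>: "wf_fm L (w @ sorts M ?d) \<psi>"
    "\<forall>e. sat M \<psi> e = sat M \<phi> (map ((!) e) ?js)" using fm_select[of L "w @ sorts M ?d" ?js \<phi> M] by blast
  have "sat M \<psi> (x @ ?d) = sat M \<phi> (x @ c)" if "sorts M x = w" for x
  proof -
    have "length x = length w" using that by auto
    from v[OF this, of ?d] show ?thesis using \<psi>(2) unfolding c by (simp only:)
  qed
  then show ?thesis using \<psi>(1) by (intro exI[of _ \<psi>] exI[of _ ?a]) auto
qed

text \<open>Over an extension base \<open>d\<close> has copies each nonforking over \<open>A\<close>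
  and its predecessors. The extracted indiscernible sequence keeps this for its first two terms: a
  forking formula true of them would be true of some two copies, the later one being nonforking over
  the earlier. It remains to move the first term to \<open>d\<close>.\<close>

lemma nonforking_indis_pair:
  assumes ext: "extension_base L M A" and A: "small A" and G: "small G"
  shows "\<exists>D. indis (sorted_wrt (<)) A D \<and> D 0 = d \<and> nf A (D 1) (A \<union> set d \<union> G)"
proof -
  from nf_sequence[OF extension_base_nf[OF ext, of d] A A] obtain y :: "nat \<Rightarrow> 'm list" where
    y: "\<And>k. eqt A d (y k)" "\<And>k. nf A (y k) (A \<union> (\<Union>j<k. set (y j)))" by blast
  have sy: "sorts M (y k) = sorts M d" for k using eqt_sorts[OF y(1)[of k]] by simp
  from extract_indiscernible[OF A, of y, OF sy] obtain y' where y': "indis (sorted_wrt (<)) A y'"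
    "\<forall>i. sorts M (y' i) = sorts M d"
    "\<forall>is \<phi> c. sorted_wrt (<) is \<and> set c \<subseteq> A \<and> wf_fm L (sorts M (concat (map y' is)) @ sorts M c) \<phi> \<and>
       sat M \<phi> (concat (map y' is) @ c) \<longrightarrow>
       (\<exists>js. sorted_wrt (<) js \<and> length js = length is \<and> sat M \<phi> (concat (map y js) @ c))"
    by (elim exE conjE)
  have eq: "eqt A d (y' 0)"
    unfolding eqt_iff
  proof (intro conjI allI impI)
    show "sorts M d = sorts M (y' 0)" using y'(2) by simp
    fix \<phi> c assume c: "set c \<subseteq> A" "wf_fm L (sorts M d @ sorts M c) \<phi>"
    have *: "sat M \<psi> (d @ c)" if "wf_fm L (sorts M d @ sorts M c) \<psi>" "sat M \<psi> (y' 0 @ c)" for \<psi>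
    proof -
      have "\<exists>js. sorted_wrt (<) js \<and> length js = length [0::nat] \<and> sat M \<psi> (concat (map y js) @ c)"
        using that c(1) y'(2) by (intro y'(3)[rule_format]) simp
      then obtain js where js: "length js = Suc 0" "sat M \<psi> (concat (map y js) @ c)" by auto
      then obtain j where "js = [j]" by (metis length_0_conv length_Suc_conv)
      then have "sat M \<psi> (y j @ c)" using js(2) by simp
      then show ?thesis using eqtD[OF y(1)[of j] c(1) that(1)] by simp
    qed
    show "sat M \<phi> (d @ c) = sat M \<phi> (y' 0 @ c)" using *[of \<phi>] *[of "Neg \<phi>"] c(2) by auto
  qed
  have nf': "nf A (y' 1) (A \<union> set (y' 0))"
    unfolding nf_iff
  proof (intro allI impI notI, elim conjE)
    let ?s = "sorts M d"
    fix \<phi> c assume *: "set c \<subseteq> A \<union> set (y' 0)" "wf_fm L (sorts M (y' 1) @ sorts M c) \<phi>"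
      "sat M \<phi> (y' 1 @ c)" "forks L M A (sorts M (y' 1)) (\<phi>, c)"
    have s1: "sorts M (y' 1) = ?s" "sorts M (y' 0) = ?s" using y'(2) by simp_all
    obtain \<psi> a where a: "set a \<subseteq> A" and \<psi>: "wf_fm L (?s @ sorts M (y' 0) @ sorts M a) \<psi>"
      and \<psi>1: "\<forall>x. sorts M x = ?s \<longrightarrow> sat M \<psi> (x @ y' 0 @ a) = sat M \<phi> (x @ c)"
      using normalize_parameters[OF *(1,2)] unfolding s1(1) by (elim exE conjE)
    have \<psi>': "sat M \<psi> (x @ y' 0 @ a) = sat M \<phi> (x @ c)" if "sorts M x = ?s" for x
      using \<psi>1 that by blast
    have "forks L M A ?s (\<psi>, y' 0 @ a)"
      by (rule forks_mono[of A ?s \<phi> c]) (use *(4) \<psi>' s1 in auto)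
    \<comment> \<open>Extraction speaks of terms in increasing order, but in \<open>\<psi>\<close>
      the later term comes first; \<open>\<theta>\<close> exchanges the two.\<close>
    obtain \<theta> where \<theta>: "wf_fm L (concat [?s, ?s, sorts M a]) \<theta>"
      "\<And>es. map (sorts M) es = [?s, ?s, sorts M a] \<Longrightarrow> sat M \<theta> (concat es) = sat M \<psi> (concat (map ((!) es) [1, 0, 2]))"
      using sel[of L "[?s, ?s, sorts M a]" "[1, 0, 2]" \<psi> M] \<psi> s1 by auto
    have \<theta>': "sat M \<theta> (p @ q @ a) = sat M \<psi> (q @ p @ a)" if "sorts M p = ?s" "sorts M q = ?s" for p q
      using \<theta>(2)[of "[p, q, a]"] that by simp
    have "\<exists>js. sorted_wrt (<) js \<and> length js = length [0::nat, 1] \<and> sat M \<theta> (concat (map y js) @ a)"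
      using y'(2) a \<theta>(1) *(3) \<theta>'[of "y' 0" "y' 1"] \<psi>'[of "y' 1"] by (intro y'(3)[rule_format]) simp
    then obtain js where js: "sorted_wrt (<) js" "length js = Suc (Suc 0)" "sat M \<theta> (concat (map y js) @ a)" by auto
    then obtain i k where ik: "js = [i, k]" by (metis length_0_conv length_Suc_conv)
    then have lt: "i < k" and "sat M \<psi> (y k @ y i @ a)" using js \<theta>'[of "y i" "y k"] sy by simp_all
    moreover have "set (y i @ a) \<subseteq> A \<union> (\<Union>j<k. set (y j))" using a lt by auto
    ultimately have "\<not> forks L M A ?s (\<psi>, y i @ a)"
      using nfD[OF y(2)[of k], of "y i @ a" \<psi>] \<psi> s1 sy by (simp del: forks.simps)
    moreover from eqt_Aut[OF A eqt_trans[OF eqt_sym[OF eq] y(1)[of i]]]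
    obtain h where h: "h \<in> Aut A" "map h (y' 0) = y i" by (elim bexE)
    have "forks L M A ?s (\<psi>, map h (y' 0 @ a))"
      by (rule forks_Aut[OF h(1)]) (use \<psi> s1 \<open>forks L M A ?s (\<psi>, y' 0 @ a)\<close> in simp_all)
    then have "forks L M A ?s (\<psi>, y i @ a)" using h(2) Aut_fix[OF h(1) a] by (simp del: forks.simps)
    ultimately show False by contradiction
  qed
  from eqt_Aut[OF A eqt_sym[OF eq]] obtain h where h: "h \<in> Aut A" "map h (y' 0) = d" by (elim bexE)
  let ?D = "\<lambda>i. map h (y' i)"
  have hA: "h ` A = A" using h(1) by (auto simp: Aut_def)
  have indD: "indis (sorted_wrt (<)) A ?D" by (rule indis_map_Aut[OF h(1) A subset_refl hA y'(1) A])
  have "h ` (A \<union> set (y' 0)) = A \<union> set d" using hA arg_cong[OF h(2), of set] by (simp add: image_Un)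
  then have "nf A (?D 1) (A \<union> set d)" using nf_Aut[OF h(1) nf'] by simp
  moreover have smd: "small (A \<union> set d)" using A by (simp add: small_Un small_finite)
  \<comment> \<open>So far the second term is nonforking over \<open>A \<union> set d\<close> only.
    An automorphism over that set replaces it by a copy nonforking over \<open>G\<close> as well and
    carries the whole sequence along.\<close>
  ultimately obtain z where z: "eqt (A \<union> set d) (?D 1) z" "nf A z (A \<union> set d \<union> G)"
    using nf_extension[of A "?D 1" "A \<union> set d" "A \<union> set d \<union> G"] G by (auto simp: small_Un)
  from eqt_Aut[OF smd z(1)] obtain k where k: "k \<in> Aut (A \<union> set d)" "map k (?D 1) = z" by (elim bexE)
  have kA: "k \<in> Aut A" by (rule Aut_mono[OF k(1)]) simp
  have "k ` A = A" using kA by (auto simp: Aut_def)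
  then have "indis (sorted_wrt (<)) A (\<lambda>i. map k (?D i))" by (rule indis_map_Aut[OF kA A subset_refl _ indD A])
  moreover have "map k (?D 0) = d" unfolding h(2) by (rule Aut_fix[OF k(1)]) simp
  ultimately show ?thesis using k(2) z(2) by (intro exI[of _ "\<lambda>i. map k (?D i)"]) (simp only:)
qed

text \<open>
  Let \<open>D\<^sub>0 = d\<close>, \<open>D\<^sub>1\<close> start an \<open>A\<close>-indiscernible sequence with \<open>D\<^sub>1\<close> nonforking over \<open>AdB\<close>.  A nonforking
  realization \<open>x\<close> of the average of \<open>B\<close> does not distinguish \<open>D\<^sub>0\<close> from \<open>D\<^sub>1\<close>, so \<open>\<psi>(D\<^sub>1, x)\<close> holds, and then
  \<open>\<psi>(D\<^sub>1, B\<^sub>i)\<close> for almost all \<open>i\<close>.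
\<close>

lemma not_forks_if_indis:
  assumes ext: "extension_base L M A" and A: "small A" and gs: "gs A B"
    and ind: "indis (sorted_wrt (<)) (A \<union> set d) B"
    and a: "set a \<subseteq> A" and wf: "wf_fm L (sorts M d @ sorts M (B 0) @ sorts M a) \<psi>"
    and sat: "sat M \<psi> (d @ B 0 @ a)"
  shows "\<not> forks L M A (sorts M d) (\<psi>, B 0 @ a)"
proof
  assume fk: "forks L M A (sorts M d) (\<psi>, B 0 @ a)"
  let ?B = "\<Union>i. set (B i)" and ?s = "sorts M d" and ?b = "sorts M (B 0)"
  have smB: "small ?B" by (rule small_tuples[OF small_nat])
  obtain D where D: "indis (sorted_wrt (<)) A D" "D 0 = d" "nf A (D 1) (A \<union> set d \<union> ?B)"
    using nonforking_indis_pair[OF ext A smB, of d] by (elim exE conjE)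
  let ?F = "A \<union> ?B \<union> (\<Union>i. set (D i))"
  have "small ?F" using A smB small_tuples[OF small_nat, of D] by (simp only: small_Un)
  then have "\<exists>x. avg B ?F x \<and> nf A x ?F"
    by (intro average_exists[OF gs A le_supI1[OF sup_ge1] _ le_supI1[OF sup_ge2]])
  then obtain x where x: "avg B ?F x" "nf A x ?F" by (elim exE conjE)
  have sx: "sorts M x = ?b" by (rule avg_sorts[OF x(1)])
  have sB: "sorts M (B i) = ?b" for i by (rule indis_sorts[OF ind])
  have sD: "sorts M (D i) = ?s" for i using indis_sorts[OF D(1), of i 0] D(2) by simp
  \<comment> \<open>The roles change here: \<open>D\<close> is now the indiscernible sequence and
    the realization \<open>x\<close> of the average is the nonforking tuple.\<close>
  have "nf A x (A \<union> (\<Union>i. set (D i)))" by (rule nf_mono[OF x(2) Un_mono[OF sup_ge1 subset_refl]])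
  then have eD: "eqt (A \<union> set x) (D 0) (D 1)" by (rule nf_indis_pair[OF subset_refl A D(1)])
  obtain \<psi>' where \<psi>': "wf_fm L (concat [?b, ?s, sorts M a]) \<psi>'"
    "\<And>es. map (sorts M) es = [?b, ?s, sorts M a] \<Longrightarrow> sat M \<psi>' (concat es) = sat M \<psi> (concat (map ((!) es) [1, 0, 2]))"
    using sel[of L "[?b, ?s, sorts M a]" "[1, 0, 2]" \<psi> M] wf by auto
  have sw: "sat M \<psi>' (p @ q @ a) = sat M \<psi> (q @ p @ a)" if "sorts M p = ?b" "sorts M q = ?s" for p q
    using \<psi>'(2)[of "[p, q, a]"] that by simp
  have wf': "wf_fm L (?b @ sorts M (q @ a)) \<psi>'" if "sorts M q = ?s" for q
    using \<psi>'(1) that by simp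
  have satB: "sat M \<psi>' (B i @ d @ a)" for i
  proof -
    have "eqt (A \<union> set d) (concat (map B [0])) (concat (map B [i]))" by (rule indisD[OF ind]) simp_all
    then have e: "eqt (A \<union> set d) (B 0) (B i)" by simp
    have "sat M \<psi>' (B 0 @ d @ a)" using sat sw by simp
    then show ?thesis using eqtD[OF e, of "d @ a" \<psi>'] a wf'[OF refl] by auto
  qed
  have sub: "set (D i @ a) \<subseteq> ?F" for i using a by auto
  have "sat M \<psi>' (x @ D 0 @ a)"
  proof (rule ccontr)
    assume "\<not> ?thesis"
    then have "finite {i. \<not> sat M (Neg \<psi>') (B i @ D 0 @ a)}"
      using wf'[OF sD[of 0]] by (intro avgD[OF x(1) sub]) simp_all
    then show False using satB D(2) infinite_UNIV_nat by simp
  qed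
  then have "sat M \<psi> (D 0 @ x @ a)" using sw[OF sx sD] by simp
  moreover have "wf_fm L (sorts M (D 0) @ sorts M (x @ a)) \<psi>" using wf sx sD[of 0] by simp
  moreover have "set (x @ a) \<subseteq> A \<union> set x" using a by auto
  ultimately have "sat M \<psi> (D 1 @ x @ a)" using eqtD[OF eD, of "x @ a" \<psi>] by simp
  then have "sat M \<psi>' (x @ D 1 @ a)" using sw[OF sx sD[of 1]] by simp
  then have "\<exists>i. i \<notin> {} \<and> sat M \<psi>' (B i @ D 1 @ a)"
    using wf'[OF sD[of 1]] by (intro avgD_ex[OF x(1) sub]) simp_all
  then obtain i where "sat M \<psi>' (B i @ D 1 @ a)" by (elim exE conjE)
  then have i: "sat M \<psi> (D 1 @ B i @ a)" using sw[OF sB sD] by simp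
  have "\<not> forks L M A (sorts M (D 1)) (\<psi>, B i @ a)"
    using a i wf sB[of i] sD[of 1] by (intro nfD[OF D(3)]) auto
  then have nfk: "\<not> forks L M A ?s (\<psi>, B i @ a)" unfolding sD .
  have "indis distinct A B" using gs by (simp only: gs_def)
  then have "eqt A (concat (map B [0])) (concat (map B [i]))" by (rule indisD) simp_all
  then have "eqt A (B 0) (B i)" by simp
  from eqt_Aut[OF A this] obtain h where h: "h \<in> Aut A" "map h (B 0) = B i" by (elim bexE)
  have "forks L M A ?s (\<psi>, map h (B 0 @ a))" by (rule forks_Aut[OF h(1) _ fk]) (use wf in simp)
  moreover have "map h (B 0 @ a) = B i @ a" using h(2) Aut_fix[OF h(1) a] by simp
  ultimately have "forks L M A ?s (\<psi>, B i @ a)" by (simp only:)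
  then show False using nfk by contradiction
qed

lemma gs_subseq:
  assumes "gs A B" "strict_mono f" shows "gs A (B \<circ> f)"
  unfolding gs_def
proof (intro conjI allI)
  have ind: "indis distinct A B" and nfB: "\<And>i. nf A (B i) (A \<union> (\<Union>j<i. set (B j)))"
    using assms(1) by (simp_all only: gs_def)
  show "indis distinct A (B \<circ> f)" unfolding indis_def
  proof (intro conjI allI impI)
    show "sorts M ((B \<circ> f) i) = sorts M ((B \<circ> f) j)" for i j using indis_sorts[OF ind] by simp
    fix "is" js :: "nat list" assume *: "distinct is \<and> distinct js \<and> length is = length js"
    have "inj f" using assms(2) by (rule strict_mono_imp_inj_on)
    then have "distinct (map f is)" "distinct (map f js)"
      using * by (simp_all add: distinct_map inj_on_subset[OF _ subset_UNIV])
    then have "eqt A (concat (map B (map f is))) (concat (map B (map f js)))"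
      using * by (intro indisD[OF ind]) simp_all
    then show "eqt A (concat (map (B \<circ> f) is)) (concat (map (B \<circ> f) js))" by simp
  qed
  show "nf A ((B \<circ> f) i) (A \<union> (\<Union>j<i. set ((B \<circ> f) j)))" for i
    unfolding o_def
  proof (rule nf_mono[OF nfB Un_mono[OF subset_refl]], rule UN_least)
    fix j assume "j \<in> {..<i}"
    then have "f j \<in> {..<f i}" using assms(2) by (simp add: strict_mono_less)
    then show "set (B (f j)) \<subseteq> (\<Union>j<f i. set (B j))" by (rule UN_upper)
  qed
qed

lemma gs_Aut:
  assumes "gs A B" "h \<in> Aut A" "small A" shows "gs A (\<lambda>i. map h (B i))"
  unfolding gs_def
proof (intro conjI allI)
  have hA: "h ` A = A" using assms(2) by (auto simp: Aut_def)
  have ind: "indis distinct A B" and nfB: "\<And>i. nf A (B i) (A \<union> (\<Union>j<i. set (B j)))"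
    using assms(1) by (simp_all only: gs_def)
  show "indis distinct A (\<lambda>i. map h (B i))" by (rule indis_map_Aut[OF assms(2,3) subset_refl hA ind assms(3)])
  fix i
  have "h ` (A \<union> (\<Union>j<i. set (B j))) = A \<union> (\<Union>j<i. set (map h (B j)))"
    unfolding image_Un hA by (simp add: image_UN)
  then show "nf A (map h (B i)) (A \<union> (\<Union>j<i. set (map h (B j))))"
    using nf_Aut[OF assms(2) nfB[of i]] by (simp only:)
qed

text \<open>Otherwise \<open>B\<close> can be thinned out to a row on which the formula holds
  throughout. A sequence extracted from it over \<open>A \<union> set d\<close> has the type of the
  row over \<open>A\<close>; moving it back onto the row changes \<open>d\<close> into a tuple over
  which the row is indiscernible, contrary to \<open>not_forks_if_indis\<close>.\<close>

lemma forks_finite: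
  assumes ext: "extension_base L M A" and A: "small A" and gs: "gs A B"
    and a: "set a \<subseteq> A" and wf: "wf_fm L (sorts M d @ sorts M (B 0) @ sorts M a) \<psi>"
    and fk: "forks L M A (sorts M d) (\<psi>, B 0 @ a)"
  shows "finite {k. sat M \<psi> (d @ B k @ a)}"
proof (rule ccontr)
  assume inf: "infinite {k. sat M \<psi> (d @ B k @ a)}"
  let ?f = "enumerate {k. sat M \<psi> (d @ B k @ a)}"
  let ?s = "sorts M d" and ?b = "sorts M (B 0)"
  define B' where "B' = B \<circ> ?f"
  have f: "strict_mono ?f" using inf by (rule strict_mono_enumerate)
  have gs': "gs A B'" unfolding B'_def by (rule gs_subseq[OF gs f])
  have ind0: "indis distinct A B" using gs by (simp only: gs_def)
  have ind: "indis distinct A B'" using gs' by (simp only: gs_def)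
  have sB: "sorts M (B' i) = ?b" for i unfolding B'_def o_def by (rule indis_sorts[OF ind0])
  have satB: "sat M \<psi> (d @ B' i @ a)" for i unfolding B'_def o_def using enumerate_in_set[OF inf] by simp
  have "small (A \<union> set d)" using A by (simp add: small_Un small_finite)
  from extract_indiscernible[OF this, of B', OF sB] obtain u where u: "indis (sorted_wrt (<)) (A \<union> set d) u"
    "\<forall>i. sorts M (u i) = ?b"
    "\<forall>is \<phi> c. sorted_wrt (<) is \<and> set c \<subseteq> A \<union> set d \<and> wf_fm L (sorts M (concat (map u is)) @ sorts M c) \<phi> \<and>
       sat M \<phi> (concat (map u is) @ c) \<longrightarrow>
       (\<exists>js. sorted_wrt (<) js \<and> length js = length is \<and> sat M \<phi> (concat (map B' js) @ c))"
    by (elim exE conjE)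
  have su: "sorts M (concat (map u is)) = sorts M (concat (map B' js))" if "length is = length js" for "is" js
    by (rule sorts_concat_const[OF _ that]) (use u(2) sB in simp)
  \<comment> \<open>A formula over \<open>A\<close> true in \<open>u\<close> holds on some
    increasing tuple of \<open>B'\<close>, hence on all by indiscernibility of \<open>B'\<close>. So
    \<open>u\<close> and \<open>B'\<close> have the same type over \<open>A\<close>, although the
    extraction was done over \<open>d\<close> too.\<close>
  have eqs: "eqt A (concat (map u is)) (concat (map B' is))" if sis: "sorted_wrt (<) is" for "is"
    unfolding eqt_iff
  proof (intro conjI allI impI)
    show s: "sorts M (concat (map u is)) = sorts M (concat (map B' is))" by (rule su) simp
    fix \<phi> c assume c: "set c \<subseteq> A" "wf_fm L (sorts M (concat (map u is)) @ sorts M c) \<phi>"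
    have *: "sat M \<theta> (concat (map B' is) @ c)"
      if \<theta>: "wf_fm L (sorts M (concat (map u is)) @ sorts M c) \<theta>" "sat M \<theta> (concat (map u is) @ c)" for \<theta>
    proof -
      have "\<exists>js. sorted_wrt (<) js \<and> length js = length is \<and> sat M \<theta> (concat (map B' js) @ c)"
        by (intro u(3)[rule_format] conjI sis \<theta>) (use c(1) in blast)
      then obtain js where js: "sorted_wrt (<) js" "length js = length is" "sat M \<theta> (concat (map B' js) @ c)"
        by (elim exE conjE)
      have "eqt A (concat (map B' js)) (concat (map B' is))"
        using js(1,2) sis by (intro indisD[OF ind]) (simp_all only: strict_sorted_iff)
      from eqtD[OF this c(1)] show ?thesis using js(2,3) \<theta>(1) su[of "is" js] by simp
    qed
    show "sat M \<phi> (concat (map u is) @ c) = sat M \<phi> (concat (map B' is) @ c)"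
      using *[OF c(2)] *[of "Neg \<phi>"] c(2) by (metis (no_types) sat.simps(3) wf_fm.simps(3))
  qed
  have "eqf A UNIV u B'"
    unfolding eqf_def
  proof (intro conjI ballI allI impI)
    show s: "sorts M (u v) = sorts M (B' v)" for v using u(2) sB by simp
    fix vs :: "nat list"
    let ?is = "sorted_list_of_set (set vs)"
    have "eqf A (set ?is) u B'" using s by (intro eqf_finite[OF A eqs]) simp_all
    then show "eqt A (concat (map u vs)) (concat (map B' vs))" unfolding eqf_def by simp
  qed
  from eqf_Aut[OF A small_nat this] obtain h where h: "h \<in> Aut A" "\<forall>v. map h (u v) = B' v" by auto
  have hA: "h ` A = A" using h(1) by (auto simp: Aut_def)
  have "h ` (A \<union> set d) = A \<union> set (map h d)" using hA by (simp add: image_Un)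
  from indis_map_Aut[OF h(1) A _ this u(1) \<open>small (A \<union> set d)\<close>]
  have "indis (sorted_wrt (<)) (A \<union> set (map h d)) (\<lambda>i. map h (u i))" by simp
  moreover have "(\<lambda>i. map h (u i)) = B'" using h(2) by (simp add: fun_eq_iff)
  ultimately have indd: "indis (sorted_wrt (<)) (A \<union> set (map h d)) B'" by (simp only:)
  obtain \<psi>' where \<psi>': "wf_fm L (concat [?b, ?s, sorts M a]) \<psi>'"
    "\<And>es. map (sorts M) es = [?b, ?s, sorts M a] \<Longrightarrow> sat M \<psi>' (concat es) = sat M \<psi> (concat (map ((!) es) [1, 0, 2]))"
    using sel[of L "[?b, ?s, sorts M a]" "[1, 0, 2]" \<psi> M] wf by auto
  have sw: "sat M \<psi>' (p @ d @ a) = sat M \<psi> (d @ p @ a)" if "sorts M p = ?b" for p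
    using \<psi>'(2)[of "[p, d, a]"] that by simp
  have "sat M \<psi> (d @ u 0 @ a)"
  proof (rule ccontr)
    assume n: "\<not> ?thesis"
    have "\<exists>js. sorted_wrt (<) js \<and> length js = length [0::nat] \<and> sat M (Neg \<psi>') (concat (map B' js) @ d @ a)"
      using u(2) a \<psi>'(1) n sw[of "u 0"] by (intro u(3)[rule_format]) auto
    then obtain js where js: "length js = Suc 0" "sat M (Neg \<psi>') (concat (map B' js) @ d @ a)" by auto
    then obtain j where "js = [j]" by (metis length_0_conv length_Suc_conv)
    then show False using js(2) sw[OF sB[of j]] satB[of j] by simp
  qed
  moreover have "wf_fm L (sorts M d @ sorts M (u 0 @ a)) \<psi>" using wf u(2) by simp
  ultimately have "sat M \<psi> (map h d @ map h (u 0 @ a))" using sat_Aut_app[OF h(1), of d "u 0 @ a" \<psi>] by (simp only:)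
  then have sat': "sat M \<psi> (map h d @ B' 0 @ a)" using h(2) Aut_fix[OF h(1) a] by simp
  have sh: "sorts M (map h d) = ?s" by (rule sorts_map_Aut[OF h(1)])
  have "wf_fm L (sorts M (map h d) @ sorts M (B' 0) @ sorts M a) \<psi>" unfolding sh sB by (rule wf)
  from not_forks_if_indis[OF ext A gs' indd a this sat'] have nfk: "\<not> forks L M A ?s (\<psi>, B' 0 @ a)" unfolding sh .
  have "eqt A (concat (map B [0])) (concat (map B [?f 0]))" by (rule indisD[OF ind0]) simp_all
  then have "eqt A (B 0) (B' 0)" by (simp add: B'_def)
  from eqt_Aut[OF A this] obtain g where g: "g \<in> Aut A" "map g (B 0) = B' 0" by (elim bexE)
  have "forks L M A ?s (\<psi>, map g (B 0 @ a))" by (rule forks_Aut[OF g(1) _ fk]) (use wf in simp)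
  moreover have "map g (B 0 @ a) = B' 0 @ a" using g(2) Aut_fix[OF g(1) a] by simp
  ultimately have "forks L M A ?s (\<psi>, B' 0 @ a)" by (simp only:)
  then show False using nfk by contradiction
qed

subsection \<open>Mutually indiscernible rows\<close>

text \<open>A copy of \<open>x\<close> over \<open>A \<union> set (B 0)\<close> that is nonforking
  over \<open>A\<close> and the row keeps the row indiscernible. Moving the copy back to
  \<open>x\<close> fixes the first member of the row, which is all that must be preserved.\<close>

lemma indis_over_nf:
  assumes gs: "gs A B" and A: "small A" and nf: "nf A x (A \<union> set (B 0))"
  shows "\<exists>Z. gs A Z \<and> Z 0 = B 0 \<and> indis distinct (A \<union> set x) Z"
proof -
  have ind: "indis distinct A B" using gs by (simp only: gs_def)
  have sm: "small (A \<union> set (B 0))" "small (A \<union> (\<Union>i. set (B i)))"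
    using A small_tuples[OF small_nat] by (simp_all add: small_Un small_finite)
  from nf_extension[OF nf sm] obtain x' where x': "eqt (A \<union> set (B 0)) x x'" "nf A x' (A \<union> (\<Union>i. set (B i)))"
    by (elim exE conjE)
  have indx: "indis distinct (A \<union> set x') B" by (rule nf_indis[OF _ subset_refl A ind x'(2)]) simp
  from eqt_Aut[OF sm(1) eqt_sym[OF x'(1)]] obtain h where h: "h \<in> Aut (A \<union> set (B 0))" "map h x' = x" by (elim bexE)
  have hA: "h \<in> Aut A" by (rule Aut_mono[OF h(1)]) simp
  have "h ` A = A" using hA by (auto simp: Aut_def)
  then have "h ` (A \<union> set x') = A \<union> set x" using arg_cong[OF h(2), of set] by (simp add: image_Un)
  from indis_map_Aut[OF hA A _ this indx] have "indis distinct (A \<union> set x) (\<lambda>i. map h (B i))"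
    using A by (simp add: small_Un small_finite)
  moreover have "map h (B 0) = B 0" by (rule Aut_fix[OF h(1)]) simp
  ultimately show ?thesis using gs_Aut[OF gs hA A] by (intro exI[of _ "\<lambda>i. map h (B i)"] conjI)
qed

lemma indis_UN:
  assumes "\<And>N :: nat. indis R (X \<union> (\<Union>i<N. set (Z i))) u"
  shows "indis R (X \<union> (\<Union>i. set (Z i))) u"
  unfolding indis_def
proof (intro conjI allI impI)
  show "sorts M (u i) = sorts M (u j)" for i j by (rule indis_sorts[OF assms[of 0]])
  fix "is" js assume *: "R is \<and> R js \<and> length is = length js"
  show "eqt (X \<union> (\<Union>i. set (Z i))) (concat (map u is)) (concat (map u js))"
  proof (rule eqt_finite_base)
    fix d assume "set d \<subseteq> X \<union> (\<Union>i. set (Z i))"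
    from finite_support[OF finite_set this] obtain N where N: "set d \<subseteq> X \<union> (\<Union>i<N. set (Z i))" by (elim exE)
    have "eqt (X \<union> (\<Union>i<N. set (Z i))) (concat (map u is)) (concat (map u js))"
      using * by (intro indisD[OF assms]) simp_all
    then show "eqt (set d) (concat (map u is)) (concat (map u js))" by (rule eqt_mono[OF _ N])
  qed
qed

text \<open>All members but the first are replaced by successive realizations \<open>y k\<close> of
  the average that are nonforking over everything in sight. Adding them to the base one by one
  preserves by \<open>nf_indis\<close> the indiscernibility of every row inside \<open>G\<close>.
  Thus indiscernibility over the first member of a row is upgraded to indiscernibility over a full
  row.\<close>

lemma extend_row:
  assumes gs: "gs A Z" and A: "small A" and Y: "A \<subseteq> Y" "small Y" "indis distinct Y Z" and G: "small G"
  shows "\<exists>Z'. gs A Z' \<and> Z' 0 = Z 0 \<and> indis distinct Y Z' \<and>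
    (\<forall>X u. A \<subseteq> X \<and> small X \<and> X \<union> (\<Union>i. set (u i)) \<subseteq> G \<and> indis distinct (X \<union> set (Z 0)) u \<longrightarrow>
       indis distinct (X \<union> (\<Union>i. set (Z' i))) u)"
proof -
  let ?Z = "\<Union>i. set (Z i)"
  define F where "F = Y \<union> ?Z \<union> G"
  have smF: "small F" using Y(2) G small_tuples[OF small_nat] by (simp add: F_def small_Un)
  have subF: "A \<subseteq> F" "Y \<subseteq> F" "?Z \<subseteq> F" "G \<subseteq> F" "set (Z 0) \<subseteq> F" using Y(1) unfolding F_def by blast+
  from average_exists[OF gs A subF(1) smF subF(3)] obtain x where x: "avg Z F x" "nf A x F" by (elim exE conjE)
  from nf_sequence[OF x(2) smF smF] obtain y :: "nat \<Rightarrow> 'm list" where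
    y: "\<forall>k. eqt F x (y k) \<and> nf A (y k) (F \<union> (\<Union>j<k. set (y j)))" by (elim exE)
  then have y1: "eqt F x (y k)" and y2: "nf A (y k) (F \<union> (\<Union>j<k. set (y j)))" for k by simp_all
  let ?Z' = "case_nat (Z 0) y"
  have UZ': "(\<Union>j<Suc k. set (?Z' j)) = set (Z 0) \<union> (\<Union>j<k. set (y j))" for k
    unfolding lessThan_Suc_eq_insert_0 by simp
  have gsZ: "nf A (Z 0) A" using gs unfolding gs_def by (elim conjE allE[of _ 0]) simp
  have nfZ': "nf A (?Z' k) (A \<union> (\<Union>j<k. set (?Z' j)))" for k
  proof (cases k)
    case 0
    then show ?thesis using gsZ by simp
  next
    case (Suc k')
    have "A \<union> (\<Union>j<k. set (?Z' j)) \<subseteq> F \<union> (\<Union>j<k'. set (y j))"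
      unfolding Suc UZ' using subF(1,5) by blast
    then show ?thesis using nf_mono[OF y2[of k']] Suc by simp
  qed
  \<comment> \<open>Each \<open>y k\<close> is nonforking over the earlier ones and so has to be put
    in front of them: the new members appear in reverse order, followed by the old row.\<close>
  have ex: "\<exists>e. indis distinct Y e \<and> (\<forall>i. e (k + i) = Z i) \<and> (\<forall>l<k. e l = y (k - 1 - l)) \<and>
      (\<Union>i. set (e i)) \<subseteq> F \<union> (\<Union>j<k. set (y j))" for k
  proof (induction k)
    case 0
    show ?case using Y(3) subF(3) by (intro exI[of _ Z]) simp
  next
    case (Suc k)
    then obtain e where e: "indis distinct Y e" "\<forall>i. e (k + i) = Z i" "\<forall>l<k. e l = y (k - 1 - l)"
      "(\<Union>i. set (e i)) \<subseteq> F \<union> (\<Union>j<k. set (y j))" by (elim exE conjE)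
    have eg: "e \<circ> (\<lambda>i. k + i) = Z" using e(2) by (simp add: fun_eq_iff)
    have "indis distinct Y (case_nat (y k) e)"
    proof (rule indis_distinct_prepend[OF Y(2,1) e(1)])
      show "nf A (y k) (Y \<union> (\<Union>i. set (e i)))"
        by (rule nf_mono[OF y2]) (intro Un_least e(4) le_supI1[OF subF(2)])
      show "inj (\<lambda>i. k + i)" by simp
      have "avg Z F (y k)" by (rule avg_eqt[OF x(1) y1])
      then show "avg (e \<circ> (\<lambda>i. k + i)) (Y \<union> (\<Union>i. set ((e \<circ> (\<lambda>i. k + i)) i))) (y k)"
        unfolding eg by (rule avg_mono) (intro Un_least subF(2,3))
    qed
    moreover have "\<forall>i. case_nat (y k) e (Suc k + i) = Z i" using e(2) by simp
    moreover have "\<forall>l<Suc k. case_nat (y k) e l = y (Suc k - 1 - l)" using e(3) by (auto split: nat.split)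
    moreover have "(\<Union>i. set (case_nat (y k) e i)) \<subseteq> F \<union> (\<Union>j<Suc k. set (y j))"
    proof (rule UN_least)
      fix i
      show "set (case_nat (y k) e i) \<subseteq> F \<union> (\<Union>j<Suc k. set (y j))"
      proof (cases i)
        case 0
        then show ?thesis by auto
      next
        case (Suc i')
        have "set (e i') \<subseteq> F \<union> (\<Union>j<k. set (y j))" using e(4) by (rule subset_trans[rotated]) auto
        also have "\<dots> \<subseteq> F \<union> (\<Union>j<Suc k. set (y j))" by (rule Un_mono[OF subset_refl UN_mono]) auto
        finally show ?thesis using Suc by simp
      qed
    qed
    ultimately show ?case by (intro exI[of _ "case_nat (y k) e"] conjI)
  qed
  have indZ': "indis distinct Y ?Z'"
    unfolding indis_def
  proof (intro conjI allI impI)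
    have "sorts M (?Z' k) = sorts M (Z 0)" for k
      using eqt_sorts[OF y1] avg_sorts[OF x(1)] by (cases k) simp_all
    then show "sorts M (?Z' i) = sorts M (?Z' j)" for i j by simp
    fix "is" js :: "nat list" assume *: "distinct is \<and> distinct js \<and> length is = length js"
    \<comment> \<open>All indices in the two lists are at most \<open>k\<close>, so the part of the
      new row that they use is, read backwards from position \<open>k\<close>, the start of one of
      the families \<open>e\<close>.\<close>
    define k where "k = sum_list is + sum_list js"
    have k: "i \<le> k" if "i \<in> set is \<union> set js" for i
      using that member_le_sum_list[of i "is"] member_le_sum_list[of i js] by (auto simp: k_def)
    obtain e where e: "indis distinct Y e" "\<forall>i. e (k + i) = Z i" "\<forall>l<k. e l = y (k - 1 - l)"
      using ex[of k] by (elim exE conjE)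
    have eq: "?Z' i = e (k - i)" if "i \<le> k" for i
    proof (cases i)
      case 0
      then show ?thesis using e(2)[rule_format, of 0] by simp
    next
      case (Suc j)
      then have "k - Suc j < k" "k - 1 - (k - Suc j) = j" using that by simp_all
      then show ?thesis using e(3) Suc by simp
    qed
    have m: "map ?Z' ks = map e (map (\<lambda>i. k - i) ks)" if "set ks \<subseteq> set is \<union> set js" for ks
      unfolding map_map o_def
    proof (rule map_cong[OF refl])
      fix i assume "i \<in> set ks"
      then show "?Z' i = e (k - i)" by (intro eq k subsetD[OF that])
    qed
    have "distinct (map (\<lambda>i. k - i) ks)" if "set ks \<subseteq> set is \<union> set js" "distinct ks" for ks
    proof -
      have "inj_on (\<lambda>i. k - i) (set ks)"
      proof (rule inj_onI)
        fix i j assume ij: "i \<in> set ks" "j \<in> set ks" "k - i = k - j"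
        have "i \<le> k" "j \<le> k" by (rule k[OF subsetD[OF that(1) ij(1)]], rule k[OF subsetD[OF that(1) ij(2)]])
        then show "i = j" using ij(3) by linarith
      qed
      then show ?thesis using that(2) by (simp add: distinct_map)
    qed
    then have "eqt Y (concat (map e (map (\<lambda>i. k - i) is))) (concat (map e (map (\<lambda>i. k - i) js)))"
      using * by (intro indisD[OF e(1)]) simp_all
    then show "eqt Y (concat (map ?Z' is)) (concat (map ?Z' js))" unfolding m[OF Un_upper1] m[OF Un_upper2] .
  qed
  have "indis distinct (X \<union> (\<Union>i. set (?Z' i))) u"
    if X: "A \<subseteq> X" "small X" "X \<union> (\<Union>i. set (u i)) \<subseteq> G" "indis distinct (X \<union> set (Z 0)) u" for X u
  proof (rule indis_UN)
    have *: "indis distinct (X \<union> set (Z 0) \<union> (\<Union>j<N. set (y j))) u" for N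
    proof (induction N)
      case 0
      show ?case using X(4) by simp
    next
      case (Suc N)
      let ?X = "X \<union> set (Z 0) \<union> (\<Union>j<N. set (y j))"
      have "indis distinct (?X \<union> set (y N)) u"
      proof (rule nf_indis[OF _ _ _ Suc])
        show "A \<subseteq> ?X" using X(1) by blast
        show "small ?X" using X(2) by (simp add: small_Un small_finite)
        have "X \<subseteq> F" "(\<Union>i. set (u i)) \<subseteq> F" using X(3) subF(4) by blast+
        then show "nf A (y N) (?X \<union> (\<Union>i. set (u i)))"
          using subF(5) by (intro nf_mono[OF y2]) (intro Un_least; blast)
      qed simp
      moreover have "X \<union> set (Z 0) \<union> (\<Union>j<Suc N. set (y j)) = ?X \<union> set (y N)" by (auto simp: lessThan_Suc)
      ultimately show ?case by (simp only:)
    qed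
    show "indis distinct (X \<union> (\<Union>i<N. set (?Z' i))) u" for N
    proof (cases N)
      case 0
      then show ?thesis using indis_mono[OF X(4)] by simp
    next
      case (Suc N')
      show ?thesis unfolding Suc UZ' using *[of N'] by (simp only: Un_assoc)
    qed
  qed
  then show ?thesis using indZ' nfZ' indis_mono[OF indZ' Y(1)]
    by (intro exI[of _ ?Z'] conjI allI impI) (simp_all add: gs_def)
qed

text \<open>The rows are completed one at a time. At an intermediate stage each row is indiscernible
  over the full rows with index in \<open>D\<close> and over the first members of the others, which
  is the set described by \<open>U\<close>.\<close>

lemma mutually_indiscernible_rows:
  fixes b :: "'i \<Rightarrow> 'm list"
  assumes A: "small A" and I: "finite I"
    and rows: "\<forall>i\<in>I. gs A (Z0 i) \<and> Z0 i 0 = b i \<and> indis distinct (A \<union> (\<Union>j\<in>I - {i}. set (b j))) (Z0 i)"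
  shows "\<exists>Z. \<forall>i\<in>I. gs A (Z i) \<and> Z i 0 = b i \<and>
    indis distinct (A \<union> (\<Union>j\<in>I - {i}. \<Union>k. set (Z j k))) (Z i)"
proof -
  define U where "U D Z j = (if j \<in> D then \<Union>k. set (Z j k) else set (b j))"
    for D :: "'i set" and Z :: "'i \<Rightarrow> nat \<Rightarrow> 'm list" and j
  have smU: "small (U D Z j)" for D Z j
    unfolding U_def by (simp add: small_tuples[OF small_nat] small_finite)
  have smUU: "small (A \<union> (\<Union>j\<in>J. U D Z j))" if "finite J" for J D Z
    using that by (induction J rule: finite_induct) (use A smU in \<open>simp_all add: small_Un\<close>)
  have "\<exists>Z. \<forall>i\<in>I. gs A (Z i) \<and> Z i 0 = b i \<and> indis distinct (A \<union> (\<Union>j\<in>I - {i}. U D Z j)) (Z i)"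
    if D: "D \<subseteq> I" for D
    using finite_subset[OF D I] D
  proof (induction D rule: finite_induct)
    case empty
    show ?case using rows by (intro exI[of _ Z0]) (simp add: U_def)
  next
    case (insert i0 D)
    then obtain Z where Z: "\<forall>i\<in>I. gs A (Z i) \<and> Z i 0 = b i \<and> indis distinct (A \<union> (\<Union>j\<in>I - {i}. U D Z j)) (Z i)"
      by auto
    have i0: "i0 \<in> I" "i0 \<notin> D" using insert by auto
    then have Zi0: "gs A (Z i0)" "Z i0 0 = b i0" "indis distinct (A \<union> (\<Union>j\<in>I - {i0}. U D Z j)) (Z i0)"
      using Z by auto
    \<comment> \<open>\<open>G\<close> contains every full row, so \<open>extend_row\<close>
      preserves the indiscernibility of all other rows when row \<open>i0\<close> is
      completed.\<close>
    define G where "G = A \<union> (\<Union>j\<in>I. U I Z j)"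
    have "small G" unfolding G_def by (rule smUU[OF I])
    have UG: "U D Z j \<subseteq> U I Z j" if "j \<in> I" for j
    proof -
      have "b j = Z j 0" using Z that by simp
      then show ?thesis using that by (auto simp: U_def)
    qed
    have "small (A \<union> (\<Union>j\<in>I - {i0}. U D Z j))" using I by (intro smUU) simp
    from extend_row[OF Zi0(1) A Un_upper1 this Zi0(3) \<open>small G\<close>] obtain z where
      z: "gs A z" "z 0 = Z i0 0" "indis distinct (A \<union> (\<Union>j\<in>I - {i0}. U D Z j)) z"
        "\<forall>X u. A \<subseteq> X \<and> small X \<and> X \<union> (\<Union>i. set (u i)) \<subseteq> G \<and> indis distinct (X \<union> set (Z i0 0)) u \<longrightarrow>
          indis distinct (X \<union> (\<Union>i. set (z i))) u" by (elim exE conjE)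
    let ?Z = "Z(i0 := z)"
    have U0: "U (insert i0 D) ?Z j = U D Z j" if "j \<noteq> i0" for j using that by (simp add: U_def)
    have "gs A (?Z i) \<and> ?Z i 0 = b i \<and> indis distinct (A \<union> (\<Union>j\<in>I - {i}. U (insert i0 D) ?Z j)) (?Z i)"
      if i: "i \<in> I" for i
    proof (cases "i = i0")
      case True
      have "(\<Union>j\<in>I - {i0}. U (insert i0 D) ?Z j) = (\<Union>j\<in>I - {i0}. U D Z j)" using U0 by simp
      then show ?thesis using z Zi0(2) True by simp
    next
      case False
      let ?X = "A \<union> (\<Union>j\<in>I - {i} - {i0}. U D Z j)"
      have split: "I - {i} = insert i0 (I - {i} - {i0})" using i0(1) False by auto
      have 1: "A \<union> (\<Union>j\<in>I - {i}. U D Z j) = ?X \<union> set (Z i0 0)"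
        by (subst split) (use i0(2) Zi0(2) in \<open>auto simp: U_def\<close>)
      have 2: "A \<union> (\<Union>j\<in>I - {i}. U (insert i0 D) ?Z j) = ?X \<union> (\<Union>k. set (z k))"
      proof -
        have "(\<Union>j\<in>I - {i} - {i0}. U (insert i0 D) ?Z j) = (\<Union>j\<in>I - {i} - {i0}. U D Z j)" using U0 by simp
        moreover have "U (insert i0 D) ?Z i0 = (\<Union>k. set (z k))" by (simp add: U_def)
        moreover have "(\<Union>j\<in>I - {i}. U (insert i0 D) ?Z j) =
            U (insert i0 D) ?Z i0 \<union> (\<Union>j\<in>I - {i} - {i0}. U (insert i0 D) ?Z j)"
          by (subst split) (rule UN_insert)
        ultimately show ?thesis by (simp only: Un_ac)
      qed
      have "?X \<union> (\<Union>k. set (Z i k)) \<subseteq> G"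
      proof (intro Un_least)
        show "A \<subseteq> G" by (simp add: G_def)
        show "(\<Union>j\<in>I - {i} - {i0}. U D Z j) \<subseteq> G"
          unfolding G_def by (rule le_supI2, rule UN_mono) (use UG in auto)
        have "U I Z i = (\<Union>k. set (Z i k))" using i by (simp add: U_def)
        then show "(\<Union>k. set (Z i k)) \<subseteq> G" unfolding G_def using i by auto
      qed
      moreover have "indis distinct (?X \<union> set (Z i0 0)) (Z i)" using Z i unfolding 1[symmetric] by simp
      moreover have "small ?X" using I by (intro smUU) simp
      ultimately have "indis distinct (?X \<union> (\<Union>k. set (z k))) (Z i)"
        by (intro z(4)[rule_format] conjI Un_upper1)
      then show ?thesis unfolding 2 using Z i False by simp
    qed
    then show ?case by (intro exI[of _ ?Z] ballI)
  qed
  from this[OF subset_refl] obtain Z where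
    Z: "\<forall>i\<in>I. gs A (Z i) \<and> Z i 0 = b i \<and> indis distinct (A \<union> (\<Union>j\<in>I - {i}. U I Z j)) (Z i)" by (elim exE)
  have "(\<Union>j\<in>I - {i}. U I Z j) = (\<Union>j\<in>I - {i}. \<Union>k. set (Z j k))" for i
    by (rule SUP_cong[OF refl]) (simp add: U_def)
  then show ?thesis using Z by (intro exI[of _ Z]) simp
qed

text \<open>An automorphism fixing all other rows pointwise moves the chosen members of one row;
  composing such automorphisms treats the rows independently.\<close>

lemma mutual_Aut:
  assumes A: "small A" and I: "finite I"
    and ind: "\<And>i. i \<in> I \<Longrightarrow> indis distinct (A \<union> (\<Union>j\<in>I - {i}. \<Union>k. set (Z j k))) (Z i)"
    and f: "\<And>i. i \<in> I \<Longrightarrow> inj_on (f i) {..<N}"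
  shows "\<exists>h\<in>Aut A. \<forall>i\<in>I. \<forall>k<N. map h (Z i k) = Z i (f i k)"
proof -
  have sm: "small (\<Union>j\<in>J. \<Union>k. set (Z j k))" if "finite J" for J
    using that by (induction J rule: finite_induct) (simp_all add: small_Un small_tuples[OF small_nat] small_finite)
  have "\<exists>h\<in>Aut A. \<forall>i\<in>I. \<forall>k<N. map h (Z i k) = Z i (if i \<in> D then f i k else k)" if D: "D \<subseteq> I" for D
    using finite_subset[OF D I] D
  proof (induction D rule: finite_induct)
    case empty
    show ?case using Aut_id by (intro bexI[of _ id]) simp_all
  next
    case (insert i0 D)
    then obtain h where h: "h \<in> Aut A" "\<forall>i\<in>I. \<forall>k<N. map h (Z i k) = Z i (if i \<in> D then f i k else k)" by auto
    have i0: "i0 \<in> I" "i0 \<notin> D" using insert by auto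
    let ?X = "A \<union> (\<Union>j\<in>I - {i0}. \<Union>k. set (Z j k))"
    have "small ?X" using A sm I by (simp add: small_Un)
    moreover have "distinct (map (f i0) [0..<N])"
      using f[OF i0(1)] by (simp add: distinct_map atLeast0LessThan)
    ultimately have "\<exists>h\<in>Aut ?X. \<forall>k<length [0..<N]. map h (Z i0 ([0..<N] ! k)) = Z i0 (map (f i0) [0..<N] ! k)"
      by (intro indis_AutD[OF ind[OF i0(1)]]) simp_all
    then obtain g where g: "g \<in> Aut ?X" "\<forall>k<N. map g (Z i0 k) = Z i0 (f i0 k)" by (elim bexE) simp
    have "map (g \<circ> h) (Z i k) = Z i (if i \<in> insert i0 D then f i k else k)" if i: "i \<in> I" "k < N" for i k
    proof -
      have "map h (Z i k) = Z i (if i \<in> D then f i k else k)" by (rule h(2)[rule_format, OF i])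
      then have 1: "map (g \<circ> h) (Z i k) = map g (Z i (if i \<in> D then f i k else k))"
        unfolding map_map[symmetric] by (rule arg_cong)
      show ?thesis
      proof (cases "i = i0")
        case True
        show ?thesis unfolding 1 unfolding True using g(2)[rule_format, OF i(2)] i0(2) by (simp only: if_False if_True insertI1)
      next
        case False
        have "set (Z i m) \<subseteq> ?X" for m
          by (rule le_supI2, rule subset_trans[OF UN_upper[of m] UN_upper[of i]]) (use i(1) False in auto)
        from Aut_fix[OF g(1) this] show ?thesis unfolding 1 using False by (simp only: insert_iff simp_thms)
      qed
    qed
    moreover have "g \<circ> h \<in> Aut A" by (intro Aut_comp h(1) Aut_mono[OF g(1)]) simp
    ultimately show ?case by (intro bexI[of _ "g \<circ> h"]) blast+
  qed
  from this[OF subset_refl] show ?thesis by simp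
qed

section \<open>Rows above an independent family\<close>

lemma gs_start:
  assumes "generically_stable L M A v q" "realizes M v b q" "small A"
  shows "\<exists>B. gs A B \<and> B 0 = b"
proof -
  obtain B where q: "q \<in> complete_types L M v A" and "nonforking_seq L M A v q B" and ind: "indis distinct A B"
    using assms(1) unfolding generically_stable_def indiscernible_set_iff by (elim exE conjE)
  then have r: "\<And>i. realizes M v (B i) q"
    and nfB: "\<And>i. \<not> type_forks L M A v (tp L M (B i) (A \<union> (\<Union>j<i. set (B j))))"
    unfolding nonforking_seq_def by simp_all
  have s: "sorts M (B i) = v" for i using r[of i] by (simp add: realizes_def)
  have gs: "gs A B" unfolding gs_def nf_def s using ind nfB by (intro conjI allI)
  have "eqt A (B 0) b"
  proof (rule realizes_tp[OF _ s])
    have "tp L M (B 0) A \<subseteq> q"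
    proof
      fix x assume x: "x \<in> tp L M (B 0) A"
      obtain \<phi> c where \<phi>: "x = (\<phi>, c)" by (cases x)
      have pf: "(\<phi>, c) \<in> pfms L M v A" and sat: "sat M \<phi> (B 0 @ c)" using x s[of 0] by (simp_all add: \<phi> tp_def)
      have "\<forall>x\<in>pfms L M v A. case x of (\<phi>, c) \<Rightarrow> (\<phi>, c) \<in> q \<or> (Neg \<phi>, c) \<in> q"
        using q by (simp add: complete_types_def)
      from bspec[OF this pf] have "(\<phi>, c) \<in> q \<or> (Neg \<phi>, c) \<in> q" by simp
      moreover have "(Neg \<phi>, c) \<notin> q"
      proof
        assume "(Neg \<phi>, c) \<in> q"
        from bspec[OF conjunct2[OF r[of 0, unfolded realizes_def]] this] sat show False by simp
      qed
      ultimately show "x \<in> q" unfolding \<phi> by blast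
    qed
    then show "realizes M v b (tp L M (B 0) A)" by (rule realizes_mono[OF assms(2)])
  qed
  from eqt_Aut[OF assms(3) this] obtain h where h: "h \<in> Aut A" "map h (B 0) = b" by (elim bexE)
  show ?thesis using gs_Aut[OF gs h(1) assms(3)] h(2) by (intro exI[of _ "\<lambda>i. map h (B i)"] conjI)
qed

text \<open>Independence is applied to the index set \<open>J - {i}\<close>: the tuple of the other
  \<open>b j\<close> is nonforking over \<open>A \<union> set (b i)\<close>, so
  \<open>indis_over_nf\<close> gives a row starting at \<open>b i\<close> that is indiscernible over
  that tuple.\<close>

lemma independent_rows:
  fixes b :: "'i \<Rightarrow> 'm list"
  assumes A: "small A" and B: "\<And>i. i \<in> I \<Longrightarrow> \<exists>B. gs A B \<and> B 0 = b i"
    and indep: "indep_family L M A I b" and J: "finite J" "J \<subseteq> I"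
  shows "\<exists>Z. \<forall>i\<in>J. gs A (Z i) \<and> Z i 0 = b i \<and>
    indis distinct (A \<union> (\<Union>j\<in>J - {i}. \<Union>k. set (Z j k))) (Z i)"
proof -
  have "\<forall>i\<in>J. \<exists>Z. gs A Z \<and> Z 0 = b i \<and> indis distinct (A \<union> (\<Union>j\<in>J - {i}. set (b j))) Z"
  proof
    fix i assume i: "i \<in> J"
    then obtain B where B: "gs A B" "B 0 = b i" using B[of i] J(2) by blast
    obtain js where js: "set js = J - {i}" "distinct js" using finite_distinct_list[of "J - {i}"] J(1) by auto
    have "J - {i} \<subseteq> I" using J(2) by blast
    then have "nf A (concat (map b js)) (A \<union> (\<Union>j\<in>I - (J - {i}). set (b j)))"
      using indep js unfolding indep_family_def nf_def by blast
    moreover have "set (b i) \<subseteq> (\<Union>j\<in>I - (J - {i}). set (b j))" using i J(2) by (intro UN_upper) auto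
    ultimately have "nf A (concat (map b js)) (A \<union> set (B 0))" unfolding B(2) by (blast intro: nf_mono)
    from indis_over_nf[OF B(1) A this]
    show "\<exists>Z. gs A Z \<and> Z 0 = b i \<and> indis distinct (A \<union> (\<Union>j\<in>J - {i}. set (b j))) Z"
      using B(2) js(1) by simp
  qed
  then obtain Z0 where "\<forall>i\<in>J. gs A (Z0 i) \<and> Z0 i 0 = b i \<and>
      indis distinct (A \<union> (\<Union>j\<in>J - {i}. set (b j))) (Z0 i)" by (rule bchoice[THEN exE])
  then show ?thesis by (rule mutually_indiscernible_rows[OF A J(1)])
qed

section \<open>Finite patterns and the size of the index set\<close>

lemma small_finite_fibers:
  assumes "small (c ` I)" "\<And>y. finite {i \<in> I. c i = y}" shows "small I"
proof -
  let ?f = "\<lambda>i. (c i, to_nat_on {j \<in> I. c j = c i} i)"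
  have "inj_on ?f I"
  proof (rule inj_onI)
    fix i j assume ij: "i \<in> I" "j \<in> I" "?f i = ?f j"
    then have c: "c i = c j" and t: "to_nat_on {k \<in> I. c k = c j} i = to_nat_on {k \<in> I. c k = c j} j" by auto
    have "countable {k \<in> I. c k = c j}" using assms(2) by (rule countable_finite)
    from inj_on_to_nat_on[OF this] t show "i = j" by (rule inj_onD) (use ij c in auto)
  qed
  then have "|I| =o |?f ` I|" by (intro card_of_ordIsoI[of ?f]) (simp add: bij_betw_def)
  moreover have "small (?f ` I)" by (rule small_mono[OF small_Times[OF assms(1)]]) auto
  ultimately show ?thesis unfolding small_def using ordIso_ordLess_trans by blast
qed

end

text \<open>The negation marks the end of the quantifier prefix, so a list of sorts can be read off
  from the formula. This is how \<open>code\<close> stores sorts.\<close>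

lemma foldr_Forall_inj:
  "foldr Forall u (Neg \<chi>) = foldr Forall v (Neg \<chi>) \<Longrightarrow> u = v"
proof (induction u arbitrary: v)
  case Nil
  then show ?case by (cases v) auto
next
  case (Cons s u)
  then show ?case by (cases v) auto
qed

lemma wf_foldr_Forall:
  "wf_fm L w (foldr Forall u (Neg (Forall s (Eq (Var 0) (Var 0)))))"
proof (induction u arbitrary: w)
  case Nil
  have "wf_tm L (s # w) (Var 0) s" using wf_tm.intros(1)[of 0 "s # w" L] by simp
  then show ?case by auto
qed simp

text \<open>The formulas are assumed to fork rather than divide because forking passes along
  implication by \<open>forks_mono\<close>, which allows the parameters to be put into the form
  \<open>b i @ \<alpha> i\<close>.\<close>

locale forking_witness = monster L \<kappa> M
  for L :: "('s, 'f, 'r) lang" and \<kappa> :: "'k rel" and M :: "('s, 'f, 'r, 'm) struct" +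
  fixes A :: "'m set" and I :: "'i set" and b :: "'i \<Rightarrow> 'm list" and a :: "'m list"
    and \<psi> :: "'i \<Rightarrow> ('s, 'f, 'r) fm" and \<alpha> :: "'i \<Rightarrow> 'm list"
  assumes ext: "extension_base L M A" and A: "small A"
    and rows: "\<And>i. i \<in> I \<Longrightarrow> \<exists>B. gs A B \<and> B 0 = b i"
    and indep: "indep_family L M A I b"
    and params: "\<And>i. i \<in> I \<Longrightarrow> set (\<alpha> i) \<subseteq> A"
    and wf: "\<And>i. i \<in> I \<Longrightarrow> wf_fm L (sorts M a @ sorts M (b i) @ sorts M (\<alpha> i)) (\<psi> i)"
    and sat: "\<And>i. i \<in> I \<Longrightarrow> sat M (\<psi> i) (a @ b i @ \<alpha> i)"
    and fork: "\<And>i. i \<in> I \<Longrightarrow> forks L M A (sorts M a) (\<psi> i, b i @ \<alpha> i)"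
begin

text \<open>One choice of rows serves all paths: only the tuple \<open>x\<close>, the preimage of
  \<open>a\<close> under an automorphism moving the rows, depends on \<open>\<eta>\<close> and
  \<open>N\<close>.\<close>

lemma finite_pattern:
  assumes J: "finite J" "J \<subseteq> I"
  shows "\<exists>Z. (\<forall>i\<in>J. Z i 0 = b i \<and> (\<forall>k. sorts M (Z i k) = sorts M (b i)) \<and>
      indis distinct (A \<union> (\<Union>j\<in>J - {i}. \<Union>k. set (Z j k))) (Z i)) \<and>
    (\<forall>\<eta> N. \<exists>x. eqt A a x \<and> (\<forall>i\<in>J. \<forall>k<N. sat M (\<psi> i) (x @ Z i k @ \<alpha> i) \<longleftrightarrow> k = \<eta> i))"
proof -
  obtain Z where Z: "\<forall>i\<in>J. gs A (Z i) \<and> Z i 0 = b i \<and>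
    indis distinct (A \<union> (\<Union>j\<in>J - {i}. \<Union>k. set (Z j k))) (Z i)"
    using independent_rows[of A I b J, OF A rows indep J] by blast
  then have gsZ: "\<And>i. i \<in> J \<Longrightarrow> gs A (Z i)" and Z0: "\<And>i. i \<in> J \<Longrightarrow> Z i 0 = b i"
    and ind: "\<And>i. i \<in> J \<Longrightarrow> indis distinct (A \<union> (\<Union>j\<in>J - {i}. \<Union>k. set (Z j k))) (Z i)" by simp_all
  have sZ: "sorts M (Z i k) = sorts M (b i)" if "i \<in> J" for i k
    using indis_sorts[OF ind[OF that], of k 0] Z0[OF that] by simp
  have "\<exists>x. eqt A a x \<and> (\<forall>i\<in>J. \<forall>k<N. sat M (\<psi> i) (x @ Z i k @ \<alpha> i) \<longleftrightarrow> k = \<eta> i)" for \<eta> N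
  proof -
    have fin: "finite {k. sat M (\<psi> i) (a @ Z i k @ \<alpha> i)}" if i: "i \<in> J" for i
    proof -
      have iI: "i \<in> I" using i J(2) by blast
      show ?thesis
        by (rule forks_finite[OF ext A gsZ[OF i] params[OF iI]]) (use wf[OF iI] fork[OF iI] Z0[OF i] in \<open>simp_all del: forks.simps\<close>)
    qed
    have "finite (\<Union>i\<in>J. {k. sat M (\<psi> i) (a @ Z i k @ \<alpha> i)})" using J(1) fin by (rule finite_UN_I)
    then obtain m where m: "(\<Union>i\<in>J. {k. sat M (\<psi> i) (a @ Z i k @ \<alpha> i)}) \<subseteq> {..<m}"
      using finite_nat_bounded by blast
    \<comment> \<open>The place prescribed by \<open>\<eta>\<close> is sent to 0, where
      \<open>\<psi> i\<close> holds of \<open>a\<close>; all other places are sent beyond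
      \<open>m\<close>, past the finitely many members where it holds.\<close>
    define f where "f i k = (if k = \<eta> i then 0 else Suc (m + k))" for i k
    have "\<exists>h\<in>Aut A. \<forall>i\<in>J. \<forall>k<N. map h (Z i k) = Z i (f i k)"
      by (rule mutual_Aut[OF A J(1) ind]) (auto simp: inj_on_def f_def)
    then obtain h where h: "h \<in> Aut A" "\<forall>i\<in>J. \<forall>k<N. map h (Z i k) = Z i (f i k)" by (elim bexE)
    let ?x = "map (inv h) a"
    have "sat M (\<psi> i) (?x @ Z i k @ \<alpha> i) \<longleftrightarrow> k = \<eta> i" if i: "i \<in> J" and k: "k < N" for i k
    proof -
      have iI: "i \<in> I" using i J(2) by blast
      have "map (inv h) (Z i (f i k)) = Z i k"
        using Aut_inv_map[OF h(1), of "Z i k"] h(2) i k by simp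
      then have "map (inv h) (a @ Z i (f i k) @ \<alpha> i) = ?x @ Z i k @ \<alpha> i"
        using Aut_fix[OF Aut_inv[OF h(1)] params[OF iI]] by simp
      moreover have "wf_fm L (sorts M (a @ Z i (f i k) @ \<alpha> i)) (\<psi> i)" using wf[OF iI] sZ[OF i] by simp
      ultimately have "sat M (\<psi> i) (?x @ Z i k @ \<alpha> i) \<longleftrightarrow> sat M (\<psi> i) (a @ Z i (f i k) @ \<alpha> i)"
        using sat_Aut[OF Aut_inv[OF h(1)]] by metis
      also have "\<dots> \<longleftrightarrow> k = \<eta> i"
      proof (cases "k = \<eta> i")
        case True
        then show ?thesis using sat[OF iI] Z0[OF i] by (simp add: f_def)
      next
        case False
        have "f i k \<notin> {..<m}" using False by (simp add: f_def)
        then have "f i k \<notin> {k. sat M (\<psi> i) (a @ Z i k @ \<alpha> i)}" using m i by blast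
        then show ?thesis using False by simp
      qed
      finally show ?thesis .
    qed
    then show ?thesis using Aut_eqt[OF Aut_inv[OF h(1)], of a] by (intro exI[of _ ?x]) blast
  qed
  then show ?thesis using Z0 sZ ind by (intro exI[of _ Z]) simp
qed

text \<open>
  The data of the index \<open>i\<close> are coded by a formula, as only the number of formulas is known to be small.
\<close>

definition code :: "'i \<Rightarrow> ('s, 'f, 'r) fm" where
  "code i = (let t = Neg (Forall undefined (Eq (Var 0) (Var 0))) in
     And (foldr Forall (sorts M (b i)) t) (And (foldr Forall (sorts M (\<alpha> i)) t) (\<psi> i)))"

lemma code_eq: "code i = code j \<Longrightarrow>
    sorts M (b i) = sorts M (b j) \<and> sorts M (\<alpha> i) = sorts M (\<alpha> j) \<and> \<psi> i = \<psi> j"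
  unfolding code_def Let_def fm.inject by (elim conjE) (intro conjI foldr_Forall_inj; assumption)

text \<open>Infinitely many indices with the same code would share one formula \<open>\<psi>\<close>
  and the sorts of its parameters. The finite patterns make it hold at any prescribed finite
  selection of the \<open>b i\<close>, so it would have the independence property.\<close>

lemma finite_code_fiber: "finite {i \<in> I. code i = y}"
proof (rule ccontr)
  assume inf: "infinite {i \<in> I. code i = y}"
  then obtain g :: "nat \<Rightarrow> 'i" where g: "inj g" "range g \<subseteq> {i \<in> I. code i = y}"
    using infinite_countable_subset by blast
  have gI: "g l \<in> I" for l using g(2) by auto
  have "code (g l) = y" for l using g(2) by blast
  then have gc: "code (g l) = code (g 0)" for l by simp
  let ?v = "sorts M (b (g 0)) @ sorts M (\<alpha> (g 0))" and ?\<psi> = "\<psi> (g 0)" and ?w = "sorts M a"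
  let ?u = "\<lambda>l. b (g l) @ \<alpha> (g l)"
  have su: "sorts M (?u l) = ?v" and \<psi>g: "\<psi> (g l) = ?\<psi>" for l using code_eq[OF gc[of l]] by simp_all
  obtain \<theta> where \<theta>: "wf_fm L (concat [?v, ?w]) \<theta>"
    "\<And>es. map (sorts M) es = [?v, ?w] \<Longrightarrow> sat M \<theta> (concat es) = sat M ?\<psi> (concat (map ((!) es) [1, 0]))"
    using sel[of L "[?v, ?w]" "[1, 0]" ?\<psi> M] wf[OF gI[of 0]] by auto
  have sw: "sat M \<theta> (?u l @ x) = sat M (\<psi> (g l)) (x @ b (g l) @ \<alpha> (g l))" if "sorts M x = ?w" for x l
    using \<theta>(2)[of "[?u l, x]"] that su[of l] \<psi>g[of l] by simp
  show False
  proof (rule not_shattering[of ?v ?w \<theta> ?u])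
    show "wf_fm L (?v @ ?w) \<theta>" using \<theta>(1) by simp
    show "sorts M (?u l) = ?v" for l by (rule su)
    fix n and S :: "nat set"
    have "finite (g ` {..<n})" "g ` {..<n} \<subseteq> I" using gI by auto
    from finite_pattern[OF this] obtain Z where Zi: "\<forall>i\<in>g ` {..<n}. Z i 0 = b i \<and>
        (\<forall>k. sorts M (Z i k) = sorts M (b i)) \<and>
        indis distinct (A \<union> (\<Union>j\<in>g ` {..<n} - {i}. \<Union>k. set (Z j k))) (Z i)"
      and Z: "\<forall>\<eta> N. \<exists>x. eqt A a x \<and> (\<forall>i\<in>g ` {..<n}. \<forall>k<N. sat M (\<psi> i) (x @ Z i k @ \<alpha> i) \<longleftrightarrow> k = \<eta> i)"
      by (elim exE conjE)
    \<comment> \<open>Only column 0, which consists of the \<open>b i\<close> themselves, matters: a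
      path passes through it for the indices selected by \<open>S\<close> and avoids it
      elsewhere.\<close>
    define \<eta> where "\<eta> i = (if i \<in> g ` S then 0 else 1 :: nat)" for i
    obtain x where x: "eqt A a x" "\<forall>i\<in>g ` {..<n}. \<forall>k<1. sat M (\<psi> i) (x @ Z i k @ \<alpha> i) \<longleftrightarrow> k = \<eta> i"
      using Z[rule_format, of 1 \<eta>] by (elim exE conjE)
    have sx: "sorts M x = ?w" using eqt_sorts[OF x(1)] by simp
    have "sat M \<theta> (?u l @ x) \<longleftrightarrow> l \<in> S" if "l < n" for l
    proof -
      have gl: "g l \<in> g ` {..<n}" using that by simp
      have "Z (g l) 0 = b (g l)" using Zi[rule_format, OF gl] by (elim conjE)
      moreover have "sat M (\<psi> (g l)) (x @ Z (g l) 0 @ \<alpha> (g l)) \<longleftrightarrow> 0 = \<eta> (g l)"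
        by (rule x(2)[rule_format, OF gl]) simp
      moreover have "0 = \<eta> (g l) \<longleftrightarrow> l \<in> S" using g(1) by (simp add: \<eta>_def inj_image_mem_iff)
      ultimately show ?thesis using sw[OF sx, of l] by (simp only:)
    qed
    then show "\<exists>b. sorts M b = ?w \<and> (\<forall>i<n. sat M \<theta> (?u i @ b) \<longleftrightarrow> i \<in> S)" using sx by (intro exI[of _ x] conjI allI impI)
  qed
qed

lemma small_index: "small I"
proof (rule small_finite_fibers[OF _ finite_code_fiber])
  have "wf_fm L (sorts M a @ sorts M (b i) @ sorts M (\<alpha> i)) (code i)" if "i \<in> I" for i
    unfolding code_def Let_def wf_fm.simps(4) by (intro conjI wf_foldr_Forall wf that)
  then have "code ` I \<subseteq> {\<phi>. \<exists>w. wf_fm L w \<phi>}" by blast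
  moreover have "small {\<phi>. \<exists>w. wf_fm L w \<phi>}" unfolding small_def by (rule card_formulas)
  ultimately show "small (code ` I)" by (rule small_mono[rotated])
qed

subsection \<open>Randomness patterns\<close>

text \<open>The variable \<open>None\<close> stands for the tuple realizing \<open>p\<close> and
  \<open>Some (i, k)\<close> for the \<open>k\<close>-th member of row \<open>i\<close>.\<close>

definition var_sorts :: "('i \<times> nat) option \<Rightarrow> 's list" where
  "var_sorts = case_option (sorts M a) (\<lambda>(i, k). sorts M (b i))"

lemma var_sorts_simps [simp]: "var_sorts None = sorts M a" "var_sorts (Some (i, k)) = sorts M (b i)"
  unfolding var_sorts_def by simp_all

abbreviation vars :: "('i \<times> nat) option set" where
  "vars \<equiv> insert None (Some ` (I \<times> UNIV))"

abbreviation move :: "('i \<Rightarrow> nat \<Rightarrow> nat) \<Rightarrow> ('i \<times> nat) option \<Rightarrow> ('i \<times> nat) option" where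
  "move f \<equiv> map_option (\<lambda>(i, k). (i, f i k))"

lemma var_sorts_move [simp]: "var_sorts (move f v) = var_sorts v"
  by (cases v; cases "the v") auto

definition on_path :: "'i \<Rightarrow> nat \<Rightarrow> (('i \<times> nat) option \<Rightarrow> 'm list) \<Rightarrow> bool" where
  "on_path i k E \<longleftrightarrow> (sat M (\<psi> i) (E None @ E (Some (i, k)) @ \<alpha> i) \<longleftrightarrow> k = 0)"

text \<open>Only the path through column 0 is demanded. The third group makes the type of the array
  of rows over \<open>A\<close> invariant under every injective move within the rows; it excludes
  the variable \<open>None\<close>, whose image under such a move lies on a different path.\<close>

definition conditions :: "((('i \<times> nat) option \<Rightarrow> 'm list) \<Rightarrow> bool) set" where
  "conditions = {\<lambda>E. sat M \<phi> (E None @ c) | \<phi> c. (\<phi>, c) \<in> tp L M a A} \<union>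
     {on_path i k | i k. i \<in> I} \<union>
     {\<lambda>E. P E \<longleftrightarrow> P (E \<circ> move f) | P f. definable var_sorts (Some ` (I \<times> UNIV)) A P \<and> (\<forall>i. inj (f i))}"

definition approx :: "'i set \<Rightarrow> nat \<Rightarrow> (('i \<times> nat) option \<Rightarrow> 'm list) \<Rightarrow> bool" where
  "approx J N E \<longleftrightarrow> fam var_sorts E \<and> eqt A a (E None) \<and> (\<forall>i\<in>J. \<forall>k<N. on_path i k E) \<and>
     (\<forall>i\<in>J. indis distinct (A \<union> (\<Union>j\<in>J - {i}. \<Union>k. set (E (Some (j, k))))) (\<lambda>k. E (Some (i, k))))"

lemma approx_exists:
  assumes "finite J" "J \<subseteq> I"
  shows "\<exists>E. approx J N E"
proof -
  from finite_pattern[OF assms] obtain Z where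
    Z: "\<forall>i\<in>J. Z i 0 = b i \<and> (\<forall>k. sorts M (Z i k) = sorts M (b i)) \<and>
      indis distinct (A \<union> (\<Union>j\<in>J - {i}. \<Union>k. set (Z j k))) (Z i)"
    and path: "\<forall>\<eta> N. \<exists>x. eqt A a x \<and> (\<forall>i\<in>J. \<forall>k<N. sat M (\<psi> i) (x @ Z i k @ \<alpha> i) \<longleftrightarrow> k = \<eta> i)"
    by (elim exE conjE)
  obtain x where x: "eqt A a x" "\<forall>i\<in>J. \<forall>k<N. sat M (\<psi> i) (x @ Z i k @ \<alpha> i) \<longleftrightarrow> k = 0"
    using path[rule_format, of N "\<lambda>_. 0"] by (elim exE conjE)
  \<comment> \<open>The rows outside \<open>J\<close> are filled with \<open>b i\<close> just to
    have the right sorts.\<close>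
  define E where "E = case_option x (\<lambda>(i, k). if i \<in> J then Z i k else b i)"
  have E: "E None = x" "i \<in> J \<Longrightarrow> E (Some (i, k)) = Z i k" "i \<notin> J \<Longrightarrow> E (Some (i, k)) = b i" for i k
    by (simp_all add: E_def)
  have "fam var_sorts E" unfolding fam_def
  proof
    fix v
    show "sorts M (E v) = var_sorts v"
    proof (cases v)
      case None
      then show ?thesis using eqt_sorts[OF x(1)] E(1) by simp
    next
      case (Some z)
      obtain i k where z: "z = (i, k)" by (cases z)
      show ?thesis
      proof (cases "i \<in> J")
        case True
        have "sorts M (Z i k) = sorts M (b i)" using bspec[OF Z True] by (elim conjE) (erule spec)
        then show ?thesis unfolding Some z using E(2)[OF True] by simp
      next
        case False
        then show ?thesis unfolding Some z using E(3)[OF False] by simp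
      qed
    qed
  qed
  moreover have "on_path i k E" if "i \<in> J" "k < N" for i k
    unfolding on_path_def E(1) E(2)[OF that(1)] by (rule x(2)[rule_format, OF that])
  moreover have "indis distinct (A \<union> (\<Union>j\<in>J - {i}. \<Union>k. set (E (Some (j, k))))) (\<lambda>k. E (Some (i, k)))"
    if i: "i \<in> J" for i
  proof -
    have "(\<Union>j\<in>J - {i}. \<Union>k. set (E (Some (j, k)))) = (\<Union>j\<in>J - {i}. \<Union>k. set (Z j k))"
      by (rule SUP_cong[OF refl]) (simp add: E(2))
    moreover have "(\<lambda>k. E (Some (i, k))) = Z i" using E(2)[OF i] by (simp add: fun_eq_iff)
    ultimately show ?thesis using bspec[OF Z i] by (simp only:)
  qed
  ultimately show ?thesis using x(1) unfolding approx_def E(1) by (intro exI[of _ E] conjI ballI allI impI) (simp_all add: E)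
qed

text \<open>Each condition holds in every sufficiently large approximation. The bound rather than a
  single approximation is stated so that finitely many conditions can be met simultaneously.\<close>

lemma approx_conditions:
  assumes Q: "Q \<in> conditions"
  shows "\<exists>J N. finite J \<and> J \<subseteq> I \<and>
    (\<forall>J' N' E. finite J' \<and> J \<subseteq> J' \<and> J' \<subseteq> I \<and> N \<le> N' \<and> approx J' N' E \<longrightarrow> Q E)"
  using Q unfolding conditions_def Un_iff
proof (elim disjE)
  assume "Q \<in> {\<lambda>E. sat M \<phi> (E None @ c) | \<phi> c. (\<phi>, c) \<in> tp L M a A}"
  then obtain \<phi> c where Q: "Q = (\<lambda>E. sat M \<phi> (E None @ c))" "(\<phi>, c) \<in> tp L M a A" by blast
  have QE: "Q E" if "finite J' \<and> {} \<subseteq> J' \<and> J' \<subseteq> I \<and> 0 \<le> N' \<and> approx J' N' E" for J' N' E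
  proof -
    have "eqt A a (E None)" using that unfolding approx_def by (elim conjE)
    then have "sat M \<phi> (a @ c) = sat M \<phi> (E None @ c)"
      by (rule eqtD) (use Q(2) in \<open>simp_all add: tp_def pfms_def\<close>)
    then show ?thesis unfolding Q(1) using Q(2) by (simp add: tp_def)
  qed
  show ?thesis
    by (rule exI[of _ "{}"], rule exI[of _ 0], intro conjI allI impI finite.emptyI empty_subsetI) (rule QE)
next
  assume "Q \<in> {on_path i k | i k. i \<in> I}"
  then obtain i k where Q: "Q = on_path i k" "i \<in> I" by blast
  have QE: "Q E" if "finite J' \<and> {i} \<subseteq> J' \<and> J' \<subseteq> I \<and> Suc k \<le> N' \<and> approx J' N' E" for J' N' E
  proof -
    have "\<forall>i\<in>J'. \<forall>k<N'. on_path i k E" using that unfolding approx_def by (elim conjE)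
    moreover have "i \<in> J'" "k < N'" using that by auto
    ultimately show ?thesis unfolding Q(1) by blast
  qed
  have "\<forall>J' N' E. finite J' \<and> {i} \<subseteq> J' \<and> J' \<subseteq> I \<and> Suc k \<le> N' \<and> approx J' N' E \<longrightarrow> Q E"
    by (intro allI impI) (rule QE)
  moreover have "finite {i}" "{i} \<subseteq> I" using Q(2) by simp_all
  ultimately show ?thesis by (intro exI[of _ "{i}"] exI[of _ "Suc k"] conjI)
next
  assume "Q \<in> {\<lambda>E. P E \<longleftrightarrow> P (E \<circ> move f) | P f. definable var_sorts (Some ` (I \<times> UNIV)) A P \<and> (\<forall>i. inj (f i))}"
  then obtain P f where Q: "Q = (\<lambda>E. P E \<longleftrightarrow> P (E \<circ> move f))"
    and P: "definable var_sorts (Some ` (I \<times> UNIV)) A P" and f: "\<forall>i. inj (f i)"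
    unfolding mem_Collect_eq by (elim exE conjE)
  from P obtain vs \<phi> c where P: "set vs \<subseteq> Some ` (I \<times> UNIV)" "set c \<subseteq> A"
    "wf_fm L (concat (map var_sorts vs) @ sorts M c) \<phi>"
    "\<forall>E. fam var_sorts E \<longrightarrow> P E \<longleftrightarrow> sat M \<phi> (concat (map E vs) @ c)"
    unfolding definable_def by (elim exE conjE)
  define J where "J = (fst \<circ> the) ` set vs"
  \<comment> \<open>The summation makes \<open>N\<close> exceed every column occurring in
    \<open>vs\<close>, so an automorphism that is correct on the first \<open>N\<close> columns
    suffices.\<close>
  define N where "N = Suc (sum_list (map (snd \<circ> the) vs))"
  have v: "\<exists>i k. v = Some (i, k) \<and> i \<in> J \<and> k < N" if v: "v \<in> set vs" for v
  proof -
    obtain i k where ik: "v = Some (i, k)" using subsetD[OF P(1) v] by (elim imageE SigmaE) blast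
    moreover have "i \<in> J" unfolding J_def by (rule image_eqI[OF _ v]) (simp add: ik)
    moreover have "k \<in> set (map (snd \<circ> the) vs)"
      unfolding set_map by (rule image_eqI[OF _ v]) (simp add: ik)
    then have "k \<le> sum_list (map (snd \<circ> the) vs)" by (intro member_le_sum_list zero_le)
    ultimately show ?thesis by (auto simp: N_def)
  qed
  have "finite J" "J \<subseteq> I" using P(1) by (auto simp: J_def)
  moreover have "\<forall>J' N' E. finite J' \<and> J \<subseteq> J' \<and> J' \<subseteq> I \<and> N \<le> N' \<and> approx J' N' E \<longrightarrow> Q E"
  proof (intro allI impI)
    fix J' N' E assume "finite J' \<and> J \<subseteq> J' \<and> J' \<subseteq> I \<and> N \<le> N' \<and> approx J' N' E"
    then have *: "finite J'" "J \<subseteq> J'" "N \<le> N'" "approx J' N' E" by blast+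
    have fE: "fam var_sorts E"
      and ind: "\<And>i. i \<in> J' \<Longrightarrow> indis distinct (A \<union> (\<Union>j\<in>J' - {i}. \<Union>k. set (E (Some (j, k))))) (\<lambda>k. E (Some (i, k)))"
      using *(4) unfolding approx_def by simp_all
    have "\<exists>h\<in>Aut A. \<forall>i\<in>J'. \<forall>k<N. map h (E (Some (i, k))) = E (Some (i, f i k))"
      by (rule mutual_Aut[OF A *(1) ind]) (use f in \<open>auto intro: inj_on_subset\<close>)
    then obtain h where h: "h \<in> Aut A" "\<forall>i\<in>J'. \<forall>k<N. map h (E (Some (i, k))) = E (Some (i, f i k))"
      by (elim bexE)
    have hv: "map h (E u) = (E \<circ> move f) u" if u: "u \<in> set vs" for u
    proof -
      obtain i k where ik: "u = Some (i, k)" "i \<in> J" "k < N" using v[OF u] by (elim exE conjE)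
      have "i \<in> J'" using ik(2) *(2) by blast
      from h(2)[rule_format, OF this ik(3)] show ?thesis unfolding ik(1) by simp
    qed
    have "map (map h) (map E vs) = map (E \<circ> move f) vs"
      unfolding map_map by (rule map_cong[OF refl]) (use hv in simp)
    then have m: "map h (concat (map E vs) @ c) = concat (map (E \<circ> move f) vs) @ c"
      unfolding map_append Aut_fix[OF h(1) P(2)] map_concat by (simp only:)
    have fEm: "fam var_sorts (E \<circ> move f)" unfolding fam_def
    proof
      fix v show "sorts M ((E \<circ> move f) v) = var_sorts v"
        using fE unfolding fam_def by simp
    qed
    have "sorts M (concat (map E vs) @ c) = concat (map var_sorts vs) @ sorts M c"
      using fE unfolding fam_def by (simp add: map_concat o_def)
    then have "sat M \<phi> (map h (concat (map E vs) @ c)) = sat M \<phi> (concat (map E vs) @ c)"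
      using P(3) by (intro sat_Aut[OF h(1)]) (simp only:)
    then show "Q E" unfolding Q m using P(4) fE fEm by simp
  qed
  ultimately show ?thesis by (intro exI[of _ J] exI[of _ N] conjI)
qed

lemma conditions_definable:
  assumes "Q \<in> conditions" shows "definable var_sorts vars A Q"
  using assms unfolding conditions_def Un_iff
proof (elim disjE)
  assume "Q \<in> {\<lambda>E. sat M \<phi> (E None @ c) | \<phi> c. (\<phi>, c) \<in> tp L M a A}"
  then obtain \<phi> c where Q: "Q = (\<lambda>E. sat M \<phi> (E None @ c))" "(\<phi>, c) \<in> tp L M a A" by blast
  have "definable var_sorts vars A (\<lambda>E. sat M \<phi> (concat (map E [None]) @ c))"
    by (rule definable_sat) (use Q(2) in \<open>simp_all add: tp_def pfms_def\<close>)
  then show ?thesis unfolding Q(1) by simp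
next
  assume "Q \<in> {on_path i k | i k. i \<in> I}"
  then obtain i k where Q: "Q = on_path i k" "i \<in> I" by blast
  let ?P = "\<lambda>E. sat M (\<psi> i) (concat (map E [None, Some (i, k)]) @ \<alpha> i)"
  have d: "definable var_sorts vars A ?P"
    by (rule definable_sat) (use Q(2) params wf in simp_all)
  show ?thesis
  proof (cases "k = 0")
    case True
    then have "Q = ?P" unfolding Q(1) on_path_def by (simp add: fun_eq_iff on_path_def)
    then show ?thesis using d by (simp only:)
  next
    case False
    then have "Q = (\<lambda>E. \<not> ?P E)" unfolding Q(1) by (simp add: fun_eq_iff on_path_def)
    then show ?thesis using definable_neg[OF d] by (simp only:)
  qed
next
  assume "Q \<in> {\<lambda>E. P E \<longleftrightarrow> P (E \<circ> move f) | P f. definable var_sorts (Some ` (I \<times> UNIV)) A P \<and> (\<forall>i. inj (f i))}"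
  then obtain P f where Q: "Q = (\<lambda>E. P E \<longleftrightarrow> P (E \<circ> move f))"
    and d: "definable var_sorts (Some ` (I \<times> UNIV)) A P" by blast
  have "definable var_sorts vars A (\<lambda>E. P (E \<circ> move f))"
  proof (rule definable_comp[OF d])
    show "var_sorts (move f v) = var_sorts v" for v by (rule var_sorts_move)
    show "move f ` Some ` (I \<times> UNIV) \<subseteq> vars" by auto
  qed
  then show ?thesis unfolding Q by (intro definable_iff definable_mono[OF d]) auto
qed

lemma full_pattern:
  "\<exists>E. fam var_sorts E \<and> (\<forall>Q\<in>conditions. Q E)"
proof (rule compactness[OF _ A conditions_definable])
  show "small vars"
    using small_Un[of "{None}" "Some ` (I \<times> (UNIV :: nat set))"] small_image[OF small_Times[OF small_index]]
    by (simp add: small_finite)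
  fix \<Phi> assume \<Phi>: "\<Phi> \<subseteq> conditions" "finite \<Phi>"
  have "\<forall>Q\<in>\<Phi>. \<exists>z. finite (fst z) \<and> fst z \<subseteq> I \<and>
    (\<forall>J' N' E. finite J' \<and> fst z \<subseteq> J' \<and> J' \<subseteq> I \<and> snd z \<le> N' \<and> approx J' N' E \<longrightarrow> Q E)"
  proof
    fix Q assume "Q \<in> \<Phi>"
    then have "Q \<in> conditions" using \<Phi>(1) by blast
    from approx_conditions[OF this] obtain J N where "finite J \<and> J \<subseteq> I \<and>
      (\<forall>J' N' E. finite J' \<and> J \<subseteq> J' \<and> J' \<subseteq> I \<and> N \<le> N' \<and> approx J' N' E \<longrightarrow> Q E)" by (elim exE)
    then show "\<exists>z. finite (fst z) \<and> fst z \<subseteq> I \<and>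
      (\<forall>J' N' E. finite J' \<and> fst z \<subseteq> J' \<and> J' \<subseteq> I \<and> snd z \<le> N' \<and> approx J' N' E \<longrightarrow> Q E)"
      by (intro exI[of _ "(J, N)"]) (unfold fst_conv snd_conv)
  qed
  then obtain z where z: "\<forall>Q\<in>\<Phi>. finite (fst (z Q)) \<and> fst (z Q) \<subseteq> I \<and>
    (\<forall>J' N' E. finite J' \<and> fst (z Q) \<subseteq> J' \<and> J' \<subseteq> I \<and> snd (z Q) \<le> N' \<and> approx J' N' E \<longrightarrow> Q E)"
    by (rule bchoice[THEN exE])
  let ?J = "\<Union>Q\<in>\<Phi>. fst (z Q)" and ?N = "\<Sum>Q\<in>\<Phi>. snd (z Q)"
  have J: "finite ?J" "?J \<subseteq> I" using z \<Phi>(2) by auto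
  from approx_exists[OF J, of ?N] obtain E where E: "approx ?J ?N E" by (elim exE)
  have "Q E" if Q: "Q \<in> \<Phi>" for Q
  proof -
    have "fst (z Q) \<subseteq> ?J" using Q by (rule UN_upper)
    moreover have "snd (z Q) \<le> ?N" using member_le_sum[OF Q, of "snd \<circ> z"] \<Phi>(2) by simp
    ultimately show ?thesis using bspec[OF z Q] J E by blast
  qed
  moreover have "fam var_sorts E" using E by (simp only: approx_def)
  ultimately show "\<exists>E. fam var_sorts E \<and> (\<forall>Q\<in>\<Phi>. Q E)" by (intro exI[of _ E] conjI ballI)
qed

lemma randomness_pattern_exists:
  assumes p: "realizes M (sorts M a) a p" "p \<subseteq> pfms L M (sorts M a) A"
  shows "\<exists>c. randomness_pattern L M A (sorts M a) p I \<psi> c"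
proof -
  obtain E where E: "fam var_sorts E" "\<forall>Q\<in>conditions. Q E" using full_pattern by (elim exE conjE)
  let ?w = "sorts M a"
  define c where "c i k = E (Some (i, k))" for i k
  have sc: "sorts M (c i k) = sorts M (b i)" for i k
    using E(1) unfolding fam_def c_def by (metis var_sorts_simps(2))
  have "realizes M ?w (E None) (tp L M a A)"
    unfolding realizes_def
  proof (intro conjI ballI)
    show "sorts M (E None) = ?w" using E(1) unfolding fam_def by (metis var_sorts_simps(1))
    fix x assume x: "x \<in> tp L M a A"
    obtain \<phi> d where \<phi>: "x = (\<phi>, d)" by (cases x)
    have "(\<lambda>E. sat M \<phi> (E None @ d)) \<in> conditions" using x unfolding \<phi> conditions_def by blast
    from bspec[OF E(2) this] show "case x of (\<phi>, c) \<Rightarrow> sat M \<phi> (E None @ c)" unfolding \<phi> by simp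
  qed
  then have eqa: "eqt A a (E None)" by (rule realizes_tp[OF _ refl])
  have path: "sat M (\<psi> i) (E None @ c i k @ \<alpha> i) \<longleftrightarrow> k = 0" if "i \<in> I" for i k
  proof -
    have "on_path i k \<in> conditions" using that unfolding conditions_def by blast
    from bspec[OF E(2) this] show ?thesis unfolding on_path_def c_def .
  qed
  \<comment> \<open>Invariance of all definable predicates says that the array and its moved copy
    have the same type over \<open>A\<close>; as the index set is small, one automorphism realizes
    the move on all rows and columns at once.\<close>
  have mv: "\<exists>h\<in>Aut A. \<forall>i\<in>I. \<forall>k. map h (c i k) = c i (f i k)" if f: "\<forall>i. inj (f i)" for f
  proof -
    have "eqf A (Some ` (I \<times> UNIV)) E (E \<circ> move f)"
      unfolding eqf_def eqt_iff
    proof (intro conjI ballI allI impI)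
      have s: "sorts M (E v) = var_sorts v" "sorts M ((E \<circ> move f) v) = var_sorts v" for v
        using E(1) unfolding fam_def by simp_all
      show "sorts M (E v) = sorts M ((E \<circ> move f) v)" for v unfolding s ..
      fix vs assume vs: "set vs \<subseteq> Some ` (I \<times> (UNIV :: nat set))"
      have sv: "sorts M (concat (map E vs)) = concat (map var_sorts vs)"
        "sorts M (concat (map (E \<circ> move f) vs)) = concat (map var_sorts vs)"
        unfolding map_concat map_map by (simp_all only: o_def s[unfolded o_def] var_sorts_move)
      show "sorts M (concat (map E vs)) = sorts M (concat (map (E \<circ> move f) vs))" unfolding sv ..
      fix \<phi> d assume d: "set d \<subseteq> A" "wf_fm L (sorts M (concat (map E vs)) @ sorts M d) \<phi>"
      let ?P = "\<lambda>E. sat M \<phi> (concat (map E vs) @ d)"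
      have "definable var_sorts (Some ` (I \<times> UNIV)) A ?P"
        by (rule definable_sat[OF vs d(1)]) (use d(2) in \<open>simp only: sv\<close>)
      then have "(\<lambda>E. ?P E \<longleftrightarrow> ?P (E \<circ> move f)) \<in> conditions"
        unfolding conditions_def Un_iff mem_Collect_eq
        by (intro disjI2 exI[of _ ?P] exI[of _ f] conjI refl f)
      from bspec[OF E(2) this] show "?P E = ?P (E \<circ> move f)" .
    qed
    from eqf_Aut[OF A small_image[OF small_Times[OF small_index]] this] obtain h where
      h: "h \<in> Aut A" "\<forall>v\<in>Some ` (I \<times> UNIV). map h (E v) = (E \<circ> move f) v" by (elim bexE)
    have "map h (c i k) = c i (f i k)" if "i \<in> I" for i k
    proof -
      have "Some (i, k) \<in> Some ` (I \<times> UNIV)" using that by blast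
      from bspec[OF h(2) this] show ?thesis unfolding c_def by simp
    qed
    then show ?thesis using h(1) by (intro bexI[of _ h]) blast
  qed
  \<comment> \<open>The formula \<open>\<psi> i\<close> also takes the parameters
    \<open>\<alpha> i\<close>. They lie in \<open>A\<close>, so appending them to every member does
    not affect indiscernibility.\<close>
  define r where "r i k = c i k @ \<alpha> i" for i k
  have mvr: "map h (r i k) = r i (f i k)" if "h \<in> Aut A" "\<forall>i\<in>I. \<forall>k. map h (c i k) = c i (f i k)" "i \<in> I" for h f i k
    using that(2,3) Aut_fix[OF that(1) params[OF that(3)]] unfolding r_def by simp
  have ind: "indiscernible_seq L M (A \<union> (\<Union>\<beta>\<in>I - {i}. \<Union>k. set (r \<beta> k))) (r i)" if i: "i \<in> I" for i
    unfolding indiscernible_seq_iff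
  proof (rule indis_AutI)
    let ?X = "A \<union> (\<Union>\<beta>\<in>I - {i}. \<Union>k. set (r \<beta> k))"
    have key: "\<exists>h\<in>Aut ?X. \<forall>k<length is. map h (r i k) = r i (is ! k)" if "sorted_wrt (<) is" for "is" :: "nat list"
    proof -
      \<comment> \<open>A move has to be injective on all columns: beyond the length of
        \<open>is\<close> its values exceed every entry of \<open>is\<close>.\<close>
      define g where "g k = (if k < length is then is ! k else Suc (sum_list is + k))" for k
      have le: "is ! k \<le> sum_list is" if "k < length is" for k
        by (intro member_le_sum_list zero_le nth_mem that)
      have "inj g"
      proof (rule injI)
        fix k l assume kl: "g k = g l"
        show "k = l"
        proof (cases "k < length is \<longleftrightarrow> l < length is")
          case True
          then show ?thesis using kl \<open>sorted_wrt (<) is\<close>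
            by (auto simp: g_def strict_sorted_iff nth_eq_iff_index_eq split: if_splits)
        next
          case False
          then show ?thesis using kl le[of k] le[of l] by (auto simp: g_def split: if_splits)
        qed
      qed
      then have "\<forall>j. inj ((\<lambda>j. if j = i then g else id) j)" by simp
      from mv[OF this] obtain h where
        h: "h \<in> Aut A" "\<forall>j\<in>I. \<forall>k. map h (c j k) = c j ((if j = i then g else id) k)" by (elim bexE)
      have "h \<in> Aut (A \<union> (\<Union>z\<in>(I - {i}) \<times> UNIV. set (r (fst z) (snd z))))"
      proof (rule Aut_fix_tuples[OF h(1)])
        fix z :: "'i \<times> nat" assume "z \<in> (I - {i}) \<times> UNIV"
        then have "fst z \<in> I" "fst z \<noteq> i" by auto
        then show "map h (r (fst z) (snd z)) = r (fst z) (snd z)" using mvr[OF h] by simp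
      qed
      then have "h \<in> Aut ?X"
      proof (rule Aut_mono[OF _ Un_mono[OF subset_refl]], intro UN_least)
        fix \<beta> k assume "\<beta> \<in> I - {i}"
        then have "(\<beta>, k) \<in> (I - {i}) \<times> (UNIV :: nat set)" by simp
        from UN_upper[OF this, of "\<lambda>z. set (r (fst z) (snd z))"]
        show "set (r \<beta> k) \<subseteq> (\<Union>z\<in>(I - {i}) \<times> UNIV. set (r (fst z) (snd z)))" by simp
      qed
      moreover have "map h (r i k) = r i (is ! k)" if "k < length is" for k
        using mvr[OF h i, of k] that by (simp add: g_def)
      ultimately show ?thesis by (intro bexI[of _ h]) simp_all
    qed
    fix "is" js :: "nat list" assume *: "sorted_wrt (<) is" "sorted_wrt (<) js" "length is = length js"
    obtain h where h: "h \<in> Aut ?X" "\<forall>k<length is. map h (r i k) = r i (is ! k)" using key[OF *(1)] by (elim bexE)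
    obtain h' where h': "h' \<in> Aut ?X" "\<forall>k<length js. map h' (r i k) = r i (js ! k)" using key[OF *(2)] by (elim bexE)
    have "map (h' \<circ> inv h) (r i (is ! k)) = r i (js ! k)" if k: "k < length is" for k
    proof -
      have "map (inv h) (r i (is ! k)) = r i k" using Aut_inv_map[OF h(1), of "r i k"] h(2) k by simp
      then have "map h' (map (inv h) (r i (is ! k))) = r i (js ! k)" using h'(2) k *(3) by simp
      then show ?thesis by simp
    qed
    then show "\<exists>h\<in>Aut ?X. \<forall>k<length is. map h (r i (is ! k)) = r i (js ! k)"
      using Aut_comp[OF h'(1) Aut_inv[OF h(1)]] by (intro bexI[of _ "h' \<circ> inv h"]) blast
  qed simp
  have cons: "consistent M ?w (p \<union> {(\<psi> i, r i (\<eta> i)) | i. i \<in> I} \<union> {(Neg (\<psi> i), r i k) | i k. i \<in> I \<and> k \<noteq> \<eta> i})"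
    (is "consistent M ?w ?\<Sigma>") for \<eta> :: "'i \<Rightarrow> nat"
  proof -
    \<comment> \<open>This move takes place \<open>\<eta> i\<close> to column 0 and all other places
      away from it, so pulling back the tuple for the column-0 path gives the tuple for
      \<open>\<eta>\<close>.\<close>
    define f where "f i k = (if k = \<eta> i then 0 else Suc k)" for i k
    have f0: "f i k = 0 \<longleftrightarrow> k = \<eta> i" for i k by (simp add: f_def)
    have "\<forall>i. inj (f i)" by (auto simp: inj_def f_def)
    from mv[OF this] obtain h where h: "h \<in> Aut A" "\<forall>i\<in>I. \<forall>k. map h (c i k) = c i (f i k)" by (elim bexE)
    let ?x = "map (inv h) (E None)"
    have sE: "sorts M (E None) = ?w" using eqt_sorts[OF eqa] by simp
    have sx: "sorts M ?x = ?w" unfolding sorts_map_Aut[OF Aut_inv[OF h(1)]] by (rule sE)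
    have eqx: "eqt A a ?x" by (rule eqt_trans[OF eqa Aut_eqt[OF Aut_inv[OF h(1)]]])
    have sat: "sat M (\<psi> i) (?x @ r i k) \<longleftrightarrow> k = \<eta> i" if i: "i \<in> I" for i k
    proof -
      have "map (inv h) (E None @ r i (f i k)) = ?x @ r i k"
        using mvr[OF h i, of k] Aut_inv_map[OF h(1), of "r i k"] by simp
      moreover have "wf_fm L (sorts M (E None @ r i (f i k))) (\<psi> i)" using wf[OF i] sE sc by (simp add: r_def)
      ultimately have "sat M (\<psi> i) (?x @ r i k) \<longleftrightarrow> sat M (\<psi> i) (E None @ r i (f i k))"
        using sat_Aut[OF Aut_inv[OF h(1)]] by metis
      then show ?thesis using path[OF i] by (simp add: r_def f0)
    qed
    have "realizes M ?w ?x ?\<Sigma>"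
      unfolding realizes_def
    proof (intro conjI ballI sx)
      fix y assume "y \<in> ?\<Sigma>"
      then consider "y \<in> p" | i where "y = (\<psi> i, r i (\<eta> i))" "i \<in> I"
        | i k where "y = (Neg (\<psi> i), r i k)" "i \<in> I" "k \<noteq> \<eta> i" by blast
      then show "case y of (\<phi>, c) \<Rightarrow> sat M \<phi> (?x @ c)"
      proof cases
        case 1
        obtain \<phi> d where \<phi>: "y = (\<phi>, d)" by (cases y)
        have "set d \<subseteq> A" "wf_fm L (?w @ sorts M d) \<phi>" using subsetD[OF p(2) 1] by (simp_all add: \<phi> pfms_def)
        moreover have "sat M \<phi> (a @ d)" using bspec[OF conjunct2[OF p(1)[unfolded realizes_def]] 1] by (simp add: \<phi>)
        ultimately show ?thesis using eqtD[OF eqx] by (simp add: \<phi>)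
      qed (simp_all add: sat)
    qed
    then show ?thesis by (intro consistentI) (meson realizes_mono)
  qed
  have "randomness_pattern L M A ?w p I \<psi> r"
    unfolding randomness_pattern_def
    using ind cons wf sc by (intro conjI ballI allI) (simp_all add: r_def)
  then show ?thesis by (intro exI[of _ r])
qed

end

section \<open>Stable pre-weight witnesses and the comparison of the suprema\<close>

context monster
begin

lemma spwt_witness_pattern:
  assumes ext: "extension_base L M A" and A: "small A" and p: "p \<in> complete_types L M w A"
    and W: "spwt_witness L M A w p I a v q b"
  shows "\<exists>\<phi> c. randomness_pattern L M A w p I \<phi> c"
proof -
  have r: "realizes M w a p" and indep: "indep_family L M A I b"
    and gen: "\<And>i. i \<in> I \<Longrightarrow> generically_stable L M A (v i) (q i)" "\<And>i. i \<in> I \<Longrightarrow> realizes M (v i) (b i) (q i)"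
    and div: "\<And>i. i \<in> I \<Longrightarrow> type_divides L M A w (tp L M a (A \<union> set (b i)))"
    using W unfolding spwt_witness_def by simp_all
  have w: "sorts M a = w" using r by (simp add: realizes_def)
  have "\<forall>i\<in>I. \<exists>z. set (snd z) \<subseteq> A \<and> wf_fm L (w @ sorts M (b i) @ sorts M (snd z)) (fst z) \<and>
    sat M (fst z) (a @ b i @ snd z) \<and> forks L M A w (fst z, b i @ snd z)"
  proof
    fix i assume i: "i \<in> I"
    obtain \<phi> c where \<phi>: "(\<phi>, c) \<in> tp L M a (A \<union> set (b i))" "divides L M A w (\<phi>, c)"
      using div[OF i] unfolding type_divides_def by (elim bexE) (metis prod.exhaust)
    then have c: "set c \<subseteq> A \<union> set (b i)" "wf_fm L (w @ sorts M c) \<phi>" "sat M \<phi> (a @ c)"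
      using w by (simp_all add: tp_def pfms_def)
    from normalize_parameters[OF c(1,2)] obtain \<psi> \<alpha> where \<psi>: "set \<alpha> \<subseteq> A"
      "wf_fm L (w @ sorts M (b i) @ sorts M \<alpha>) \<psi>"
      "\<forall>x. sorts M x = w \<longrightarrow> sat M \<psi> (x @ b i @ \<alpha>) = sat M \<phi> (x @ c)" by (elim exE conjE)
    have "forks L M A w (\<psi>, b i @ \<alpha>)"
      by (rule forks_mono[OF divides_forks[OF \<phi>(2) c(2)]]) (use \<psi>(3) in blast)
    then show "\<exists>z. set (snd z) \<subseteq> A \<and> wf_fm L (w @ sorts M (b i) @ sorts M (snd z)) (fst z) \<and>
      sat M (fst z) (a @ b i @ snd z) \<and> forks L M A w (fst z, b i @ snd z)"
      using \<psi> c(3) w by (intro exI[of _ "(\<psi>, \<alpha>)"]) (simp del: forks.simps)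
  qed
  then obtain z where z: "\<forall>i\<in>I. set (snd (z i)) \<subseteq> A \<and>
    wf_fm L (w @ sorts M (b i) @ sorts M (snd (z i))) (fst (z i)) \<and>
    sat M (fst (z i)) (a @ b i @ snd (z i)) \<and> forks L M A w (fst (z i), b i @ snd (z i))"
    by (rule bchoice[THEN exE])
  interpret forking_witness L \<kappa> M A I b a "\<lambda>i. fst (z i)" "\<lambda>i. snd (z i)"
  proof
    show "\<exists>B. gs A B \<and> B 0 = b i" if "i \<in> I" for i by (rule gs_start[OF gen(1)[OF that] gen(2)[OF that] A])
  qed (use ext A indep z w in \<open>simp_all del: forks.simps\<close>)
  have "p \<subseteq> pfms L M w A" using p unfolding complete_types_def by blast
  with r have "\<exists>c. randomness_pattern L M A (sorts M a) p I (\<lambda>i. fst (z i)) c"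
    by (intro randomness_pattern_exists) (simp_all only: w)
  then show ?thesis unfolding w by blast
qed

end

text \<open>The cardinality of the whole type is an upper bound and \<open>ordLess\<close> is
  well-founded, so a least upper bound exists and the choice in \<open>card_sup\<close> is a genuine
  one.\<close>

lemma is_card_sup_card_sup:
  fixes X :: "'i rel set"
  assumes "\<forall>\<kappa>\<in>X. Card_order \<kappa>"
  shows "is_card_sup X (card_sup X)"
proof -
  let ?U = "{\<mu> :: 'i rel. Card_order \<mu> \<and> (\<forall>\<kappa>\<in>X. \<kappa> \<le>o \<mu>)}"
  have "\<kappa> \<le>o |UNIV :: 'i set|" if "\<kappa> \<in> X" for \<kappa>
  proof -
    have "Card_order \<kappa>" using assms that by blast
    then have "\<kappa> =o |Field \<kappa>|" using card_of_Field_ordIso ordIso_symmetric by blast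
    moreover have "|Field \<kappa>| \<le>o |UNIV :: 'i set|" by (rule card_of_mono1) simp
    ultimately show ?thesis by (rule ordIso_ordLeq_trans)
  qed
  then have "|UNIV :: 'i set| \<in> ?U" by (simp add: card_of_Card_order)
  from wfE_min[OF wf_ordLess this] obtain \<mu> where
    \<mu>: "\<mu> \<in> ?U" "\<And>\<nu>. (\<nu>, \<mu>) \<in> ordLess \<Longrightarrow> \<nu> \<notin> ?U" by blast
  have "\<mu> \<le>o \<nu>" if "Card_order \<nu> \<and> (\<forall>\<kappa>\<in>X. \<kappa> \<le>o \<nu>)" for \<nu> :: "'i rel"
  proof -
    have "\<not> \<nu> <o \<mu>" using \<mu>(2)[of \<nu>] that by blast
    moreover have "Well_order \<nu>" "Well_order \<mu>" using that \<mu>(1) by (simp_all add: card_order_on_def)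
    ultimately show ?thesis using not_ordLess_iff_ordLeq by blast
  qed
  then have "is_card_sup X \<mu>" using \<mu>(1) unfolding is_card_sup_def by blast
  then show ?thesis unfolding card_sup_def by (rule someI)
qed

lemma card_sup_mono:
  assumes "X \<subseteq> Y" "\<forall>\<kappa>\<in>Y. Card_order \<kappa>"
  shows "card_sup X \<le>o card_sup Y"
proof -
  have X: "is_card_sup X (card_sup X)" using assms by (intro is_card_sup_card_sup) blast
  have Y: "is_card_sup Y (card_sup Y)" using assms(2) by (rule is_card_sup_card_sup)
  then have "\<forall>\<kappa>\<in>X. \<kappa> \<le>o card_sup Y" using assms(1) unfolding is_card_sup_def by blast
  then show ?thesis using X Y unfolding is_card_sup_def by blast
qed

theorem theorem8p11:
  fixes L :: "('s, 'f, 'r) lang"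
    and T :: "('s, 'f, 'r) fm set"
    and \<kappa> :: "'k rel"
    and M :: "('s, 'f, 'r, 'm) struct"
    and A :: "'m set"
    and w :: "'s list"
    and p :: "('s, 'f, 'r, 'm) pfm set"
  assumes "complete_theory L T"
    and "monster_model L T \<kappa> M"
    and "dependent_theory L M"
    and "has_quotient_sorts L M"
    and "|A| <o \<kappa>"
    and "extension_base L M A"
    and "p \<in> complete_types L M w A"
  shows "spwt L M A w p \<le>o dp_rk L M A w p"
proof -
  have small: "|{\<phi>. \<exists>w. wf_fm L w \<phi>}| <o \<kappa>" and "Card_order \<kappa>" "is_struct L M" "saturated L \<kappa> M"
    "strongly_homogeneous L \<kappa> M"
    using assms(2) by (simp_all add: monster_model_def models_def)
  then interpret monster L \<kappa> M using assms(3) by unfold_locales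
  have A: "small A" unfolding small_def by (rule assms(5))
  let ?S = "{\<kappa>. Card_order \<kappa> \<and> (\<exists>a v q b. spwt_witness L M A w p (Field \<kappa>) a v q b)} :: 'm list rel set"
  let ?D = "{\<kappa>. Card_order \<kappa> \<and> (\<exists>\<phi> b. randomness_pattern L M A w p (Field \<kappa>) \<phi> b)} :: 'm list rel set"
  have "?S \<subseteq> ?D"
  proof
    fix \<mu> assume "\<mu> \<in> ?S"
    then obtain a v q b where "Card_order \<mu>" "spwt_witness L M A w p (Field \<mu>) a v q b" by blast
    then show "\<mu> \<in> ?D" using spwt_witness_pattern[OF assms(6) A assms(7)] by simp
  qed
  then have "card_sup ?S \<le>o card_sup ?D" by (rule card_sup_mono) simp
  then show ?thesis unfolding spwt_def dp_rk_def .
qed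

end
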